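(* Let $M=SU(2)/I^*$ be the Poincaré dodecahedral space with its spherical metric $g_0$ and let $E=E_{168}(g_0)$. Let $\ell:\Omega\to\mathbb P(E)$ be the lowest-eigenline map on the simple-lowest locus $\Omega\subset\mathscr B$, let $A_0=B(q_o)\in\Omega$ be the seed operator, and let $F_0\in E$ be a nonzero generator of the unique $I^*$-invariant line in $E$. Then $\ell(A_0)=[F_0]$ and the differential \[ d\ell_{A_0}:\mathscr B\to T_{[F_0]}\mathbb P(E) \] is surjective. Equivalently, $\ell$ is a submersion at $A_0$.
   Context: $I^*\subset SU(2)$ is the binary icosahedral group; $SU(2)\cong S^3$ has the round metric of curvature $1$, and $M=SU(2)/I^*$ (left cosets $aI^*$) carries the induced metric $g_0$. $E=E_{168}(g_0)$ is the real eigenspace of the nonnegative Laplacian of $g_0$ for its first positive eigenvalue $168$; $\dim E=13$. $E$ is equipped with the $L^2(M,g_0)$ inner product, and $\operatorname{Sym}(E)$ is the space of self-adjoint operators on $E$. The group $SU(2)$ acts orthogonally on $E$ by $(L_af)(x)=f(a^{-1}x)$; the subspace of $E$ fixed by $I^*$ under this action is one-dimensional, and this is the unique $I^*$-invariant line. $\mathcal P=\operatorname{span}\{fg: f,g\in E\}\subset L^2(M,g_0)$ (finite-dimensional). For $q\in C^\infty(M)$ define $B(q)\in\operatorname{Sym}(E)$ by $\langle B(q)f,g\rangle_{L^2(M,g_0)}=-\int_M q\,fg\,dV_{g_0}$ for $f,g\in E$, and let $\mathscr B=B(\mathcal P)\subset\operatorname{Sym}(E)$, a linear subspace. Let $o=eI^*\in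 M$. Let $q_o\in\mathcal P$ be the unique element with $h(o)=\int_M q_o\,h\,dV_{g_0}$ for all $h\in\mathcal P$, and set $A_0=B(q_o)$. For $A\in\mathscr B$ let $\lambda_1(A)\le\lambda_2(A)\le\cdots$ be its eigenvalues with multiplicity. $\Omega=\{A\in\mathscr B:\lambda_1(A)<\lambda_2(A)\}$ (open in $\mathscr B$), and for $A\in\Omega$, $\ell(A)\in\mathbb P(E)$ is the eigenline of $A$ for $\lambda_1(A)$. *)

theory Defs
  imports
    "HOL-Analysis.Analysis"
    "HOL-Algebra.Generated_Groups"
    "HOL-Library.Function_Algebras"
    "HOL-Library.Multiset"
begin

section \<open>The group \<open>SU(2)\<close> and the binary icosahedral group\<close>

definition hermitian_adjoint :: "complex^2^2 \<Rightarrow> complex^2^2" where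
  "hermitian_adjoint A = map_matrix cnj (transpose A)"

definition SU2 :: "(complex^2^2) monoid" where
  "SU2 = \<lparr>carrier = {A. A ** hermitian_adjoint A = mat 1 \<and> det A = 1},
          mult = (\<lambda>A B. A ** B), one = mat 1\<rparr>"

text \<open>The unit sphere of \<open>\<complex> \<times> \<complex> = \<real>\<^sup>4\<close> is identified with \<open>SU(2)\<close> by means of \<open>su2\<close>. The round
  metric of curvature 1 on \<open>SU(2)\<close> is the one induced from the Euclidean inner product of
  \<open>\<complex> \<times> \<complex>\<close>; it is invariant under left and right translations. In terms of quaternions,
  \<open>a + b i + c j + d k\<close> corresponds to \<open>su2 (a + b \<i>, c - d \<i>)\<close>.\<close>

definition su2 :: "complex \<times> complex \<Rightarrow> complex^2^2" where
  "su2 x = vector [vector [fst x, - cnj (snd x)], vector [snd x, cnj (fst x)]]"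

text \<open>The two generators are the quaternions \<open>(1 + i + j + k)/2\<close> and
  \<open>(\<phi> + \<phi>\<^sup>-\<^sup>1 i + j)/2\<close>, where \<open>\<phi>\<close> is the golden ratio; the group they generate
  has 120 elements.\<close>

definition golden :: real where
  "golden = (1 + sqrt 5) / 2"

definition Istar :: "(complex^2^2) set" where
  "Istar = generate SU2
     {su2 (Complex (1/2) (1/2), Complex (1/2) (-1/2)),
      su2 (Complex (golden / 2) (1 / (2 * golden)), Complex (1/2) 0)}"

section \<open>The Poincare dodecahedral space\<close>

typedef dodec = "{a <#\<^bsub>SU2\<^esub> Istar | a. a \<in> carrier SU2}"
  morphisms dodec_coset Abs_dodec
proof -
  have "mat 1 \<in> carrier SU2"
    by (simp add: SU2_def hermitian_adjoint_def vec_eq_iff mat_def transpose_def matrix_matrix_mult_def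
      map_matrix_def sum_2 forall_2 det_2)
  then show ?thesis by blast
qed

definition coset :: "complex^2^2 \<Rightarrow> dodec" where
  "coset a = Abs_dodec (a <#\<^bsub>SU2\<^esub> Istar)"

definition base_point :: dodec where
  "base_point = coset (mat 1)"

definition translate :: "complex^2^2 \<Rightarrow> (dodec \<Rightarrow> real) \<Rightarrow> (dodec \<Rightarrow> real)" where
  "translate a f = (\<lambda>p. f (Abs_dodec ((inv\<^bsub>SU2\<^esub> a) <#\<^bsub>SU2\<^esub> dodec_coset p)))"

text \<open>Pull-back of a function to \<open>S\<^sup>3\<close> along the covering \<open>S\<^sup>3 = SU(2) \<rightarrow> M\<close>, extended to
  \<open>\<real>\<^sup>4 - {0}\<close> as a function that is constant on rays. The value at 0 is irrelevant.\<close>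

definition lift :: "(dodec \<Rightarrow> real) \<Rightarrow> complex \<times> complex \<Rightarrow> real" where
  "lift f x = f (coset (su2 (sgn x)))"

subsection \<open>Smooth functions\<close>

text \<open>Only meant for open sets \<open>S\<close>.\<close>

primrec C_k_on :: "nat \<Rightarrow> 'a::euclidean_space set \<Rightarrow> ('a \<Rightarrow> real) \<Rightarrow> bool" where
  "C_k_on 0 S f \<longleftrightarrow> continuous_on S f"
| "C_k_on (Suc k) S f \<longleftrightarrow> f differentiable_on S \<and>
     (\<forall>b\<in>Basis. C_k_on k S (\<lambda>x. frechet_derivative f (at x) b))"

definition smooth_on :: "'a::euclidean_space set \<Rightarrow> ('a \<Rightarrow> real) \<Rightarrow> bool" where
  "smooth_on S f \<longleftrightarrow> (\<forall>k. C_k_on k S f)"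

text \<open>A function on \<open>S\<^sup>3\<close> is smooth iff its extension by constants along rays is smooth on
  \<open>\<real>\<^sup>4 - {0}\<close>, and the covering \<open>S\<^sup>3 \<rightarrow> M\<close> is a local diffeomorphism.\<close>

definition smooth_dodec :: "(dodec \<Rightarrow> real) \<Rightarrow> bool" where
  "smooth_dodec f \<longleftrightarrow> smooth_on (- {0}) (lift f)"

subsection \<open>The Laplacian\<close>

text \<open>For \<open>x \<in> S\<^sup>3\<close> and a unit tangent vector \<open>v\<close> at \<open>x\<close>, the curve \<open>cos t x + sin t v\<close> is the
  geodesic with initial velocity \<open>v\<close>, so \<open>hess u x v\<close> is the value at \<open>(v, v)\<close> of the Hessian
  of \<open>u\<close>. The frame is an orthonormal basis of the tangent space of \<open>S\<^sup>3\<close> at \<open>x\<close>, and the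
  nonnegative Laplacian is minus the trace of the Hessian.\<close>

definition hess :: "(complex \<times> complex \<Rightarrow> real) \<Rightarrow> complex \<times> complex \<Rightarrow> complex \<times> complex \<Rightarrow> real" where
  "hess u x v = deriv (deriv (\<lambda>t. u (cos t *\<^sub>R x + sin t *\<^sub>R v))) 0"

definition tangent_frame :: "complex \<times> complex \<Rightarrow> (complex \<times> complex) list" where
  "tangent_frame = (\<lambda>(a, b). [(\<i> * a, \<i> * b), (- cnj b, cnj a), (- \<i> * cnj b, \<i> * cnj a)])"

lemma tangent_frame_orthonormal:
  assumes "norm x = 1" "i < 3" "j < 3"
  shows "x \<bullet> (tangent_frame x ! i) = 0"
    and "(tangent_frame x ! i) \<bullet> (tangent_frame x ! j) = (if i = j then 1 else 0)"
proof -
  obtain a b where x: "x = (a, b)" by (cases x)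
  have n: "Re a * Re a + Im a * Im a + (Re b * Re b + Im b * Im b) = 1"
    using assms(1) unfolding x norm_eq_1 by (simp add: inner_complex_def)
  have ij: "i = 0 \<or> i = 1 \<or> i = 2" "j = 0 \<or> j = 1 \<or> j = 2" using assms by auto
  show "x \<bullet> (tangent_frame x ! i) = 0"
    using ij(1) by (auto simp: x tangent_frame_def inner_complex_def algebra_simps)
  show "(tangent_frame x ! i) \<bullet> (tangent_frame x ! j) = (if i = j then 1 else 0)"
    using ij n by (auto simp: x tangent_frame_def inner_complex_def algebra_simps)
qed

definition laplacian_S3 :: "(complex \<times> complex \<Rightarrow> real) \<Rightarrow> complex \<times> complex \<Rightarrow> real" where
  "laplacian_S3 u x = - (\<Sum>v\<leftarrow>tangent_frame x. hess u x v)"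

text \<open>The covering \<open>S\<^sup>3 \<rightarrow> M\<close> is a local isometry, so that the Laplacian of \<open>f\<close> pulls back to the
  Laplacian of the pull-back of \<open>f\<close>.\<close>

definition is_eigenfunction :: "real \<Rightarrow> (dodec \<Rightarrow> real) \<Rightarrow> bool" where
  "is_eigenfunction ev f \<longleftrightarrow>
     smooth_dodec f \<and> (\<forall>x\<in>sphere 0 1. laplacian_S3 (lift f) x = ev * lift f x)"

subsection \<open>Integration\<close>

text \<open>The Riemannian volume of \<open>S\<^sup>3\<close>: the volume of a subset \<open>A\<close> is 4 times the Lebesgue
  measure of the cone \<open>{t x | x \<in> A, 0 < t < 1}\<close>. Since \<open>S\<^sup>3 \<rightarrow> M\<close> is a Riemannian covering
  with 120 sheets, integrals over \<open>M\<close> are 1/120 of the integrals of the pull-backs.\<close>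

definition vol_S3 :: "(complex \<times> complex) measure" where
  "vol_S3 = distr (density lborel (\<lambda>x. ennreal (4 * indicator (ball 0 1) x))) borel sgn"

definition integral_dodec :: "(dodec \<Rightarrow> real) \<Rightarrow> real" where
  "integral_dodec f = (\<integral>x. lift f x \<partial>vol_S3) / 120"

section \<open>The eigenspace as a real inner product space\<close>

instantiation "fun" :: (type, real_vector) real_vector
begin
definition scaleR_fun :: "real \<Rightarrow> ('a \<Rightarrow> 'b) \<Rightarrow> 'a \<Rightarrow> 'b" where
  "scaleR_fun c f = (\<lambda>x. c *\<^sub>R f x)"
instance
  by standard (simp_all add: scaleR_fun_def fun_eq_iff scaleR_add_right scaleR_add_left)
end

lemma C_k_on_has_derivative:
  assumes "open S" "C_k_on (Suc k) S f" "x \<in> S"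
  shows "(f has_derivative frechet_derivative f (at x)) (at x)"
  using assms by (metis C_k_on.simps(2) differentiable_on_eq_differentiable_at frechet_derivative_works)

lemma C_k_on_cong:
  assumes "open S" "\<And>x. x \<in> S \<Longrightarrow> f x = g x" "C_k_on k S f"
  shows "C_k_on k S g"
  using assms(2,3)
proof (induction k arbitrary: f g)
  case 0
  then show ?case using continuous_on_eq by (auto 4 4)
next
  case (Suc k)
  have d: "(f has_derivative frechet_derivative f (at x)) (at x)" if "x \<in> S" for x
    by (rule C_k_on_has_derivative[OF assms(1) Suc.prems(2) that])
  have d': "(g has_derivative frechet_derivative f (at x)) (at x)" if "x \<in> S" for x
    using has_derivative_transform_within_open[OF d[OF that] assms(1) that] Suc.prems(1) by auto
  have eq: "frechet_derivative g (at x) = frechet_derivative f (at x)" if "x \<in> S" for x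
    using frechet_derivative_at[OF d'[OF that]] by simp
  show ?case
  proof (simp, intro conjI ballI)
    show "g differentiable_on S"
      using d' by (meson differentiable_at_imp_differentiable_on differentiableI)
    fix b :: 'a assume b: "b \<in> Basis"
    show "C_k_on k S (\<lambda>x. frechet_derivative g (at x) b)"
      by (rule Suc.IH[of "\<lambda>x. frechet_derivative f (at x) b"]) (use eq Suc.prems(2) b in auto)
  qed
qed

lemma C_k_on_add:
  assumes "open S" "C_k_on k S f" "C_k_on k S g"
  shows "C_k_on k S (\<lambda>x. f x + g x)"
  using assms(2,3)
proof (induction k arbitrary: f g)
  case 0
  then show ?case by (auto intro: continuous_on_add)
next
  case (Suc k)
  have d: "(f has_derivative frechet_derivative f (at x)) (at x)"
          "(g has_derivative frechet_derivative g (at x)) (at x)" if "x \<in> S" for x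
    using C_k_on_has_derivative[OF assms(1) _ that] Suc.prems by blast+
  have eq: "frechet_derivative (\<lambda>x. f x + g x) (at x) =
      (\<lambda>h. frechet_derivative f (at x) h + frechet_derivative g (at x) h)" if "x \<in> S" for x
    using frechet_derivative_at[OF has_derivative_add[OF d[OF that]]] by simp
  show ?case
  proof (simp, intro conjI ballI)
    show "(\<lambda>x. f x + g x) differentiable_on S"
      using Suc.prems by (auto intro: differentiable_on_add)
    fix b :: 'a assume b: "b \<in> Basis"
    show "C_k_on k S (\<lambda>x. frechet_derivative (\<lambda>x. f x + g x) (at x) b)"
      by (rule C_k_on_cong[OF assms(1) _ Suc.IH[of "\<lambda>x. frechet_derivative f (at x) b"
              "\<lambda>x. frechet_derivative g (at x) b"]])
         (use eq Suc.prems b in auto)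
  qed
qed

lemma C_k_on_const: "open S \<Longrightarrow> C_k_on k S (\<lambda>x. c)"
proof (induction k arbitrary: c)
  case (Suc k)
  have "frechet_derivative (\<lambda>x::'a. c) (at x) = (\<lambda>h. 0)" for x
    using frechet_derivative_at[OF has_derivative_const] by metis
  with Suc show ?case by simp
qed auto

lemma C_k_on_cmult:
  assumes "open S" "C_k_on k S f"
  shows "C_k_on k S (\<lambda>x. c * f x)"
  using assms(2)
proof (induction k arbitrary: f)
  case 0
  then show ?case by (auto intro: continuous_intros)
next
  case (Suc k)
  have d: "(f has_derivative frechet_derivative f (at x)) (at x)" if "x \<in> S" for x
    by (rule C_k_on_has_derivative[OF assms(1) Suc.prems that])
  have d': "((\<lambda>x. c * f x) has_derivative (\<lambda>h. c * frechet_derivative f (at x) h)) (at x)"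
    if "x \<in> S" for x
    using has_derivative_mult_right[OF d[OF that]] .
  have eq: "frechet_derivative (\<lambda>x. c * f x) (at x) = (\<lambda>h. c * frechet_derivative f (at x) h)"
    if "x \<in> S" for x
    using frechet_derivative_at[OF d'[OF that]] by simp
  show ?case
  proof (simp, intro conjI ballI)
    show "(\<lambda>x. c * f x) differentiable_on S"
      using d' by (meson differentiable_at_imp_differentiable_on differentiableI)
    fix b :: 'a assume b: "b \<in> Basis"
    show "C_k_on k S (\<lambda>x. frechet_derivative (\<lambda>x. c * f x) (at x) b)"
      by (rule C_k_on_cong[OF assms(1) _ Suc.IH[of "\<lambda>x. frechet_derivative f (at x) b"]])
         (use eq Suc.prems b in auto)
  qed
qed

lemma lift_add: "lift (f + g) x = lift f x + lift g x"
  by (simp add: lift_def)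

lemma lift_scaleR: "lift (c *\<^sub>R f) x = c * lift f x"
  by (simp add: lift_def scaleR_fun_def)

lemma lift_mult: "lift (\<lambda>p. f p * g p) x = lift f x * lift g x"
  by (simp add: lift_def)

lemma norm_geodesic:
  fixes x v :: "'a::real_inner"
  assumes "norm x = 1" "norm v = 1" "x \<bullet> v = 0"
  shows "norm (cos t *\<^sub>R x + sin t *\<^sub>R v) = 1"
proof -
  have 1: "x \<bullet> x = 1" "v \<bullet> v = 1" using assms by (simp_all add: norm_eq_1)
  have "(cos t *\<^sub>R x + sin t *\<^sub>R v) \<bullet> (cos t *\<^sub>R x + sin t *\<^sub>R v) = cos t * cos t + sin t * sin t"
    using assms(3) 1 by (simp add: inner_add_left inner_add_right inner_commute[of v x])
  also have "\<dots> = 1" by (metis sin_cos_squared_add3)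
  finally show ?thesis by (simp add: norm_eq_1)
qed

lemma geodesic_derivs:
  fixes u :: "'a::euclidean_space \<Rightarrow> real"
  assumes u: "smooth_on (-{0}) u" and "norm x = 1" "norm v = 1" "x \<bullet> v = 0"
  defines "h \<equiv> \<lambda>t. u (cos t *\<^sub>R x + sin t *\<^sub>R v)"
  shows "h differentiable (at t)" "deriv h differentiable (at t)"
proof -
  define c where "c = (\<lambda>t. cos t *\<^sub>R x + sin t *\<^sub>R v)"
  define c' where "c' = (\<lambda>t. - sin t *\<^sub>R x + cos t *\<^sub>R v)"
  have c0: "c t \<in> - {0}" for t
    using norm_geodesic[OF assms(2-4), of t] by (auto simp: c_def)
  have cd: "(c has_vector_derivative c' t) (at t)" for t
    unfolding c_def c'_def by (auto intro!: derivative_eq_intros)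
  have du: "(u has_derivative frechet_derivative u (at y)) (at y)" if "y \<in> -{0}" for y
  proof -
    have "C_k_on (Suc 0) (-{0}) u" using u by (simp only: smooth_on_def)
    from C_k_on_has_derivative[OF _ this that] show ?thesis by (simp add: open_Compl)
  qed
  have ddu: "(\<lambda>y. frechet_derivative u (at y) b) differentiable (at y)"
    if "y \<in> -{0}" "b \<in> Basis" for y b
  proof -
    have "C_k_on (Suc (Suc 0)) (-{0}) u" using u by (simp only: smooth_on_def)
    then have "(\<lambda>y. frechet_derivative u (at y) b) differentiable_on (-{0})"
      using that(2) by simp
    moreover have "open (-{0::'a})" by (simp add: open_Compl)
    ultimately show ?thesis using differentiable_on_eq_differentiable_at that(1) by blast
  qed
  have hd: "(h has_real_derivative frechet_derivative u (at (c t)) (c' t)) (at t)" for t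
  proof -
    have "((u \<circ> c) has_vector_derivative frechet_derivative u (at (c t)) (c' t)) (at t)"
      by (rule vector_derivative_diff_chain_within[OF cd has_derivative_at_withinI[OF du[OF c0]]])
    then show ?thesis
      by (simp add: has_real_derivative_iff_has_vector_derivative h_def c_def o_def)
  qed
  then show "h differentiable (at t)"
    using real_differentiable_def by blast
  have eq: "deriv h = (\<lambda>t. \<Sum>b\<in>Basis. (c' t \<bullet> b) * frechet_derivative u (at (c t)) b)"
  proof
    fix t
    have lin: "linear (frechet_derivative u (at (c t)))"
      using du[OF c0] has_derivative_linear by blast
    have "deriv h t = frechet_derivative u (at (c t)) (\<Sum>b\<in>Basis. (c' t \<bullet> b) *\<^sub>R b)"
      using DERIV_imp_deriv[OF hd] by (simp add: euclidean_representation)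
    also have "\<dots> = (\<Sum>b\<in>Basis. (c' t \<bullet> b) * frechet_derivative u (at (c t)) b)"
      using lin by (simp add: linear_sum linear_cmul)
    finally show "deriv h t = (\<Sum>b\<in>Basis. (c' t \<bullet> b) * frechet_derivative u (at (c t)) b)" .
  qed
  have cdiff: "c differentiable (at t)"
    using cd by (meson differentiableI_vector)
  have c'diff: "c' differentiable (at t)"
    unfolding c'_def
    by (rule differentiableI_vector[where y = "- cos t *\<^sub>R x + (- sin t) *\<^sub>R v"])
       (auto intro!: derivative_eq_intros)
  show "deriv h differentiable (at t)"
    unfolding eq
  proof (intro differentiable_sum finite_Basis ballI differentiable_mult)
    fix b :: 'a assume b: "b \<in> Basis"
    show "(\<lambda>t. c' t \<bullet> b) differentiable (at t)"
      using c'diff by (intro differentiable_inner) auto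
    show "(\<lambda>t. frechet_derivative u (at (c t)) b) differentiable (at t)"
      using differentiable_chain_at[OF cdiff ddu[OF c0 b]] by (simp add: o_def)
  qed
qed

lemma hess_add:
  fixes u w :: "complex \<times> complex \<Rightarrow> real"
  assumes "smooth_on (-{0}) u" "smooth_on (-{0}) w" "norm x = 1" "norm v = 1" "x \<bullet> v = 0"
  shows "hess (\<lambda>y. u y + w y) x v = hess u x v + hess w x v"
proof -
  note gu = geodesic_derivs[OF assms(1,3-5)] and gw = geodesic_derivs[OF assms(2-5)]
  define h k where "h = (\<lambda>t. u (cos t *\<^sub>R x + sin t *\<^sub>R v))" and "k = (\<lambda>t. w (cos t *\<^sub>R x + sin t *\<^sub>R v))"
  have d: "h field_differentiable at t" "deriv h field_differentiable at t"
    "k field_differentiable at t" "deriv k field_differentiable at t" for t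
    using gu gw by (simp_all add: h_def k_def field_differentiable_def real_differentiable_def)
  have "deriv (\<lambda>t. h t + k t) = (\<lambda>t. deriv h t + deriv k t)"
    using d by (auto simp: fun_eq_iff)
  moreover have "hess (\<lambda>y. u y + w y) x v = deriv (deriv (\<lambda>t. h t + k t)) 0"
    "hess u x v = deriv (deriv h) 0" "hess w x v = deriv (deriv k) 0"
    by (simp_all add: hess_def h_def k_def)
  ultimately show ?thesis
    using d by simp
qed

lemma hess_cmult:
  fixes u :: "complex \<times> complex \<Rightarrow> real"
  assumes "smooth_on (-{0}) u" "norm x = 1" "norm v = 1" "x \<bullet> v = 0"
  shows "hess (\<lambda>y. c * u y) x v = c * hess u x v"
proof -
  note gu = geodesic_derivs[OF assms]
  define h where "h = (\<lambda>t. u (cos t *\<^sub>R x + sin t *\<^sub>R v))"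
  have d: "h field_differentiable at t" "deriv h field_differentiable at t" for t
    using gu by (simp_all add: h_def field_differentiable_def real_differentiable_def)
  have "deriv (\<lambda>t. c * h t) = (\<lambda>t. c * deriv h t)"
    using d by (auto simp: fun_eq_iff deriv_cmult)
  moreover have "hess (\<lambda>y. c * u y) x v = deriv (deriv (\<lambda>t. c * h t)) 0"
    "hess u x v = deriv (deriv h) 0"
    by (simp_all add: hess_def h_def)
  ultimately show ?thesis
    using d by (simp add: deriv_cmult)
qed

lemma tangent_frame_mem:
  assumes "norm x = 1" "v \<in> set (tangent_frame x)"
  shows "x \<bullet> v = 0" "norm v = 1"
proof -
  have len: "length (tangent_frame x) = 3" by (cases x) (simp add: tangent_frame_def)
  then obtain i where i: "i < 3" "v = tangent_frame x ! i"
    using assms(2) by (metis in_set_conv_nth)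
  show "x \<bullet> v = 0" "norm v = 1"
    using tangent_frame_orthonormal[OF assms(1) i(1) i(1)] by (simp_all add: i(2) norm_eq_1)
qed

lemma is_eigenfunction_add:
  assumes "is_eigenfunction ev f" "is_eigenfunction ev g"
  shows "is_eigenfunction ev (f + g)"
proof -
  have s: "smooth_on (-{0}) (lift f)" "smooth_on (-{0}) (lift g)"
    using assms by (auto simp: is_eigenfunction_def smooth_dodec_def)
  have l: "lift (f + g) = (\<lambda>y. lift f y + lift g y)" by (simp add: fun_eq_iff lift_add)
  have "laplacian_S3 (lift (f + g)) x = laplacian_S3 (lift f) x + laplacian_S3 (lift g) x"
    if "norm x = 1" for x
  proof -
    have "map (hess (lift (f + g)) x) (tangent_frame x) =
        map (\<lambda>v. hess (lift f) x v + hess (lift g) x v) (tangent_frame x)"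
      unfolding l using hess_add[OF s that] tangent_frame_mem[OF that] by auto
    then show ?thesis by (simp only: laplacian_S3_def sum_list_addf minus_add_distrib)
  qed
  moreover have "smooth_on (-{0}) (lift (f + g))"
    using s unfolding l smooth_on_def by (auto intro: C_k_on_add)
  ultimately show ?thesis
    using assms by (auto simp: is_eigenfunction_def smooth_dodec_def lift_add algebra_simps)
qed

lemma is_eigenfunction_scaleR:
  assumes "is_eigenfunction ev f"
  shows "is_eigenfunction ev (c *\<^sub>R f)"
proof -
  have s: "smooth_on (-{0}) (lift f)"
    using assms by (auto simp: is_eigenfunction_def smooth_dodec_def)
  have l: "lift (c *\<^sub>R f) = (\<lambda>y. c * lift f y)" by (simp add: fun_eq_iff lift_scaleR)
  have "laplacian_S3 (lift (c *\<^sub>R f)) x = c * laplacian_S3 (lift f) x" if "norm x = 1" for x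
  proof -
    have "map (hess (lift (c *\<^sub>R f)) x) (tangent_frame x) =
        map (\<lambda>v. c * hess (lift f) x v) (tangent_frame x)"
      unfolding l using hess_cmult[OF s that] tangent_frame_mem[OF that] by auto
    then show ?thesis by (simp only: laplacian_S3_def sum_list_const_mult mult_minus_right)
  qed
  moreover have "smooth_on (-{0}) (lift (c *\<^sub>R f))"
    using s unfolding l smooth_on_def by (auto intro: C_k_on_cmult)
  ultimately show ?thesis
    using assms by (auto simp: is_eigenfunction_def smooth_dodec_def lift_scaleR algebra_simps)
qed

lemma is_eigenfunction_0: "is_eigenfunction ev 0"
proof -
  have l: "lift 0 = (\<lambda>y. 0)" by (simp add: fun_eq_iff lift_def)
  show ?thesis
    by (auto simp: is_eigenfunction_def smooth_dodec_def l smooth_on_def open_Compl intro!: C_k_on_const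
      simp: laplacian_S3_def hess_def tangent_frame_def case_prod_beta)
qed

lemma vol_S3_integrable:
  fixes g :: "complex \<times> complex \<Rightarrow> real"
  assumes cont: "continuous_on (-{0}) g" and hom: "\<And>x. g (sgn x) = g x"
  shows "integrable vol_S3 g" "integral\<^sup>L vol_S3 g = (\<integral>x. 4 * indicator (ball 0 1) x * g x \<partial>lborel)"
    "integrable lborel (\<lambda>x. 4 * indicator (ball 0 1) x * g x)"
proof -
  have meas: "g \<in> borel_measurable borel"
    by (rule borel_measurable_continuous_countable_exceptions[of "{0}"])
       (use cont in \<open>auto simp: Compl_eq_Diff_UNIV\<close>)
  have "compact (g ` sphere 0 1)"
    by (rule compact_continuous_image[OF continuous_on_subset[OF cont]]) auto
  then obtain K where "\<forall>x\<in>sphere 0 1. \<bar>g x\<bar> \<le> K"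
    by (auto dest!: compact_imp_bounded simp: bounded_iff)
  then have K: "\<bar>g x\<bar> \<le> K" if "norm x = 1" for x using that by simp
  have bd: "\<bar>g x\<bar> \<le> max K \<bar>g 0\<bar>" for x
    using K[of "sgn x"] hom[of x] by (cases "x = 0") (auto simp: norm_sgn)
  have "integrable lborel (\<lambda>x. indicator (ball 0 1) x *\<^sub>R (4 * g x))"
  proof (rule integrableI_bounded_set_indicator[where B = "4 * max K \<bar>g 0\<bar>"])
    show "emeasure lborel (ball 0 1 :: (complex \<times> complex) set) < \<infinity>"
      by (rule emeasure_bounded_finite) auto
    show "AE x in lborel. x \<in> ball 0 1 \<longrightarrow> norm (4 * g x) \<le> 4 * max K \<bar>g 0\<bar>"
      using bd by (auto simp: abs_mult)
  qed (use meas in auto)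
  then show i: "integrable lborel (\<lambda>x. 4 * indicator (ball 0 1) x * g x)"
    by (simp add: mult_ac)
  let ?d = "\<lambda>x :: complex \<times> complex. 4 * indicator (ball 0 1) x :: real"
  have dm: "?d \<in> borel_measurable borel"
    by (intro borel_measurable_times borel_measurable_const borel_measurable_indicator) simp
  have "integrable (density lborel (\<lambda>x. ennreal (?d x))) g"
    by (subst integrable_density) (use meas i dm in auto)
  then show "integrable vol_S3 g"
    unfolding vol_S3_def using meas by (simp add: integrable_distr_eq hom)
  have "integral\<^sup>L (density lborel (\<lambda>x. ennreal (?d x))) g = (\<integral>x. ?d x * g x \<partial>lborel)"
    by (subst integral_density) (use meas dm in auto)
  then show "integral\<^sup>L vol_S3 g = (\<integral>x. 4 * indicator (ball 0 1) x * g x \<partial>lborel)"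
    unfolding vol_S3_def using meas by (simp add: integral_distr hom)
qed

lemma smooth_dodec_continuous: "smooth_dodec f \<Longrightarrow> continuous_on (-{0}) (lift f)"
  unfolding smooth_dodec_def smooth_on_def by (metis C_k_on.simps(1))

lemma lift_sgn: "lift f (sgn x) = lift f x"
proof -
  have "sgn (sgn x) = sgn x" by (cases "x = 0") (simp_all add: sgn_div_norm)
  then show ?thesis by (simp add: lift_def)
qed

lemma integral_dodec_add:
  assumes "continuous_on (-{0}) (lift f)" "continuous_on (-{0}) (lift g)"
  shows "integral_dodec (\<lambda>p. f p + g p) = integral_dodec f + integral_dodec g"
proof -
  have "lift (\<lambda>p. f p + g p) = (\<lambda>x. lift f x + lift g x)" by (simp add: lift_def fun_eq_iff)
  then show ?thesis
    using vol_S3_integrable(1)[of "lift f", OF assms(1) lift_sgn]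
      vol_S3_integrable(1)[of "lift g", OF assms(2) lift_sgn]
    by (simp add: integral_dodec_def add_divide_distrib)
qed

lemma integral_dodec_cmult: "integral_dodec (\<lambda>p. c * f p) = c * integral_dodec f"
proof -
  have "lift (\<lambda>p. c * f p) = (\<lambda>x. c * lift f x)" by (simp add: lift_def fun_eq_iff)
  then show ?thesis by (simp add: integral_dodec_def)
qed

lemma continuous_on_lift_mult:
  assumes "continuous_on (-{0}) (lift f)" "continuous_on (-{0}) (lift g)"
  shows "continuous_on (-{0}) (lift (\<lambda>p. f p * g p))"
proof -
  have "lift (\<lambda>p. f p * g p) = (\<lambda>x. lift f x * lift g x)" by (simp add: lift_def fun_eq_iff)
  then show ?thesis using assms by (auto intro: continuous_on_mult)
qed

lemma SU2_eq_su2: "carrier SU2 = su2 ` sphere 0 1"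
proof (intro equalityI subsetI)
  fix A assume "A \<in> carrier SU2"
  then have u: "A ** hermitian_adjoint A = mat 1" and d: "det A = 1" by (auto simp: SU2_def)
  define a b c e where "a = A$1$1" and "b = A$1$2" and "c = A$2$1" and "e = A$2$2"
  have 1: "a * cnj a + b * cnj b = 1" "a * cnj c + b * cnj e = 0" "c * cnj a + e * cnj b = 0"
    using u by (auto simp: vec_eq_iff forall_2 matrix_matrix_mult_def sum_2 hermitian_adjoint_def
        transpose_def mat_def a_def b_def c_def e_def)
  have 2: "a * e - b * c = 1" using d by (simp add: det_2 a_def b_def c_def e_def)
  have e: "e = cnj a" using 1(1,3) 2 by algebra
  have c: "c = - cnj b" using 1(1,3) 2 by algebra
  have "complex_of_real ((norm a)\<^sup>2 + (norm b)\<^sup>2) = 1"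
    using 1(1) by (simp only: of_real_add complex_norm_square)
  then have "(norm a)\<^sup>2 + (norm b)\<^sup>2 = 1" using of_real_eq_1_iff by blast
  then have "norm (a, - cnj b) = 1" by (simp add: norm_Pair)
  moreover have "A = su2 (a, - cnj b)"
    using e c by (simp add: su2_def vec_eq_iff forall_2 a_def b_def c_def e_def)
  ultimately show "A \<in> su2 ` sphere 0 1" by auto
next
  fix A assume "A \<in> su2 ` sphere 0 1"
  then obtain a b where A: "A = su2 (a, b)" and n: "norm (a, b) = 1" by auto
  from n have "(norm a)\<^sup>2 + (norm b)\<^sup>2 = 1" by (simp add: norm_Pair)
  then have "complex_of_real ((norm a)\<^sup>2 + (norm b)\<^sup>2) = 1" by simp
  then have 1: "a * cnj a + b * cnj b = 1"
    by (simp only: of_real_add complex_norm_square)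
  then show "A \<in> carrier SU2"
    by (auto simp: A SU2_def su2_def vec_eq_iff forall_2 matrix_matrix_mult_def sum_2
        hermitian_adjoint_def transpose_def mat_def det_2 mult.commute add.commute)
qed

lemma dodec_cases:
  obtains x where "norm x = 1" "p = coset (su2 x)"
proof -
  obtain a where a: "a \<in> carrier SU2" "dodec_coset p = a <#\<^bsub>SU2\<^esub> Istar"
    using dodec_coset[of p] by blast
  then obtain x where x: "norm x = 1" "a = su2 x" by (auto simp: SU2_eq_su2)
  have "p = coset (su2 x)"
    using a(2) x(2) by (metis coset_def dodec_coset_inverse)
  with x that show ?thesis by blast
qed

lemma integral_dodec_nonneg: "(\<And>p. 0 \<le> f p) \<Longrightarrow> 0 \<le> integral_dodec f"
  by (simp add: integral_dodec_def lift_def)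

lemma integral_dodec_square_eq_0:
  assumes c: "continuous_on (-{0}) (lift f)" and 0: "integral_dodec (\<lambda>p. f p * f p) = 0"
  shows "f = 0"
proof -
  define g where "g = lift (\<lambda>p. f p * f p)"
  have g: "g x = lift f x * lift f x" for x by (simp add: g_def lift_def)
  have gc: "continuous_on (-{0}) g" unfolding g_def by (rule continuous_on_lift_mult[OF c c])
  have gh: "g (sgn x) = g x" for x unfolding g_def by (rule lift_sgn)
  note int = vol_S3_integrable[OF gc gh]
  have "(\<integral>x. 4 * indicator (ball 0 1) x * g x \<partial>lborel) = 0"
    using 0 by (simp add: integral_dodec_def int(2) flip: g_def)
  then have ae: "AE x in lborel. 4 * indicator (ball 0 1) x * g x = 0"
    using integral_nonneg_eq_0_iff_AE[OF int(3)] by (auto simp: g)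
  have z: "g x = 0" if x: "x \<in> ball 0 1 - {0}" for x
  proof (rule ccontr)
    assume nz: "g x \<noteq> 0"
    define U where "U = {y \<in> ball 0 1 - {0}. g y \<noteq> 0}"
    have oU: "open U"
    proof -
      have o: "open (ball 0 1 - {0} :: (complex \<times> complex) set)" by auto
      have c': "continuous_on (ball 0 1 - {0}) g" by (rule continuous_on_subset[OF gc]) auto
      have "U = (ball 0 1 - {0}) \<inter> g -` (-{0})" by (auto simp: U_def)
      then show ?thesis using continuous_open_preimage[OF c' o, of "-{0}"] by auto
    qed
    have "AE y in lborel. y \<notin> U" using ae by eventually_elim (auto simp: U_def)
    then have "U \<in> null_sets lborel"
      using AE_iff_null_sets[of U lborel] oU by auto
    then have "negligible U"
      using null_sets_completionI negligible_iff_null_sets by blast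
    then have "U = {}" using open_not_negligible[OF oU] by auto
    moreover have "x \<in> U" using x nz by (simp add: U_def)
    ultimately show False by blast
  qed
  show ?thesis
  proof
    fix p
    obtain x where x: "norm x = 1" "p = coset (su2 x)" by (rule dodec_cases)
    have s: "sgn ((1/2) *\<^sub>R x) = x" using x(1) by (simp add: sgn_div_norm)
    have "g ((1/2) *\<^sub>R x) = 0" by (rule z) (use x(1) in auto)
    then show "f p = 0 p" by (simp add: g lift_def s x(2))
  qed
qed

text \<open>The eigenspace of the Laplacian for the eigenvalue 168, with the \<open>L\<^sup>2\<close> inner product.\<close>

typedef eigenspace168 = "{f. is_eigenfunction 168 f}"
  morphisms eig_fun Abs_eigenspace168
  using is_eigenfunction_0 by blast

setup_lifting type_definition_eigenspace168

lemma eig_fun_smooth: "smooth_dodec (eig_fun F)"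
  using eig_fun[of F] by (simp add: is_eigenfunction_def)

lemma eig_fun_continuous: "continuous_on (-{0}) (lift (eig_fun F))"
  by (rule smooth_dodec_continuous[OF eig_fun_smooth])

instantiation eigenspace168 :: real_vector
begin

lift_definition zero_eigenspace168 :: eigenspace168 is 0
  by (rule is_eigenfunction_0)

lift_definition plus_eigenspace168 :: "eigenspace168 \<Rightarrow> eigenspace168 \<Rightarrow> eigenspace168" is "(+)"
  by (rule is_eigenfunction_add)

lift_definition scaleR_eigenspace168 :: "real \<Rightarrow> eigenspace168 \<Rightarrow> eigenspace168" is "(*\<^sub>R)"
  by (rule is_eigenfunction_scaleR)

definition uminus_eigenspace168 :: "eigenspace168 \<Rightarrow> eigenspace168" where
  "uminus_eigenspace168 F = (-1) *\<^sub>R F"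

definition minus_eigenspace168 :: "eigenspace168 \<Rightarrow> eigenspace168 \<Rightarrow> eigenspace168" where
  "minus_eigenspace168 F G = F + (- G)"

instance
proof
  fix F G H :: eigenspace168 and c d :: real
  show "F + G + H = F + (G + H)" by transfer (simp add: add.assoc)
  show "F + G = G + F" by transfer (simp add: add.commute)
  show "0 + F = F" by transfer simp
  show "- F + F = 0" unfolding uminus_eigenspace168_def
    by transfer (simp add: fun_eq_iff scaleR_fun_def)
  show "F - G = F + - G" by (rule minus_eigenspace168_def)
  show "c *\<^sub>R (F + G) = c *\<^sub>R F + c *\<^sub>R G" by transfer (rule scaleR_add_right)
  show "(c + d) *\<^sub>R F = c *\<^sub>R F + d *\<^sub>R F" by transfer (rule scaleR_add_left)
  show "c *\<^sub>R d *\<^sub>R F = (c * d) *\<^sub>R F" by transfer simp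
  show "1 *\<^sub>R F = F" by transfer simp
qed

end

instantiation eigenspace168 :: real_inner
begin

definition inner_eigenspace168 :: "eigenspace168 \<Rightarrow> eigenspace168 \<Rightarrow> real" where
  "inner_eigenspace168 F G = integral_dodec (\<lambda>p. eig_fun F p * eig_fun G p)"

definition norm_eigenspace168 :: "eigenspace168 \<Rightarrow> real" where
  "norm_eigenspace168 F = sqrt (F \<bullet> F)"

definition sgn_eigenspace168 :: "eigenspace168 \<Rightarrow> eigenspace168" where
  "sgn_eigenspace168 F = F /\<^sub>R norm F"

definition dist_eigenspace168 :: "eigenspace168 \<Rightarrow> eigenspace168 \<Rightarrow> real" where
  "dist_eigenspace168 F G = norm (F - G)"

definition uniformity_eigenspace168 :: "(eigenspace168 \<times> eigenspace168) filter" where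
  "uniformity_eigenspace168 = (INF e\<in>{0 <..}. principal {(F, G). dist F G < e})"

definition open_eigenspace168 :: "eigenspace168 set \<Rightarrow> bool" where
  "open_eigenspace168 U \<longleftrightarrow> (\<forall>F\<in>U. eventually (\<lambda>(F', G). F' = F \<longrightarrow> G \<in> U) uniformity)"

instance
proof
  fix F G H :: eigenspace168 and c d :: real and U :: "eigenspace168 set"
  show "sgn F = F /\<^sub>R norm F" by (rule sgn_eigenspace168_def)
  show "dist F G = norm (F - G)" by (rule dist_eigenspace168_def)
  show "(uniformity :: (eigenspace168 \<times> eigenspace168) filter) =
      (INF e\<in>{0 <..}. principal {(F, G). dist F G < e})"
    by (rule uniformity_eigenspace168_def)
  show "open U \<longleftrightarrow> (\<forall>F\<in>U. eventually (\<lambda>(F', G). F' = F \<longrightarrow> G \<in> U) uniformity)"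
    by (rule open_eigenspace168_def)
  show "norm F = sqrt (F \<bullet> F)" by (rule norm_eigenspace168_def)
  show "F \<bullet> G = G \<bullet> F" by (simp add: inner_eigenspace168_def mult.commute)
  show "(F + G) \<bullet> H = F \<bullet> H + G \<bullet> H"
    unfolding inner_eigenspace168_def plus_eigenspace168.rep_eq
    by (simp add: distrib_right integral_dodec_add continuous_on_lift_mult eig_fun_continuous)
  show "(c *\<^sub>R F) \<bullet> G = c * (F \<bullet> G)"
    unfolding inner_eigenspace168_def scaleR_eigenspace168.rep_eq
    by (simp add: scaleR_fun_def mult.assoc integral_dodec_cmult)
  show "0 \<le> F \<bullet> F" by (simp add: inner_eigenspace168_def integral_dodec_nonneg)
  show "F \<bullet> F = 0 \<longleftrightarrow> F = 0"
  proof
    assume "F \<bullet> F = 0"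
    then have "eig_fun F = 0"
      using integral_dodec_square_eq_0[OF eig_fun_continuous] by (simp add: inner_eigenspace168_def)
    then show "F = 0" by (simp add: zero_eigenspace168.rep_eq flip: eig_fun_inject)
  next
    assume "F = 0"
    then show "F \<bullet> F = 0"
      by (simp add: inner_eigenspace168_def zero_eigenspace168.rep_eq integral_dodec_def lift_def)
  qed
qed

end

definition invariant_line :: "eigenspace168 set" where
  "invariant_line = {F. \<forall>a\<in>Istar. translate a (eig_fun F) = eig_fun F}"

section \<open>The space of operators\<close>

definition product_space :: "(dodec \<Rightarrow> real) set" where
  "product_space = span {(\<lambda>p. eig_fun F p * eig_fun G p) | F G. True}"

text \<open>The defining identity determines \<open>B_op q\<close> uniquely and makes it self-adjoint.\<close>

definition B_op :: "(dodec \<Rightarrow> real) \<Rightarrow> eigenspace168 \<Rightarrow>\<^sub>L eigenspace168" where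
  "B_op q = (THE T. \<forall>F G. blinfun_apply T F \<bullet> G =
     - integral_dodec (\<lambda>p. q p * eig_fun F p * eig_fun G p))"

definition op_space :: "(eigenspace168 \<Rightarrow>\<^sub>L eigenspace168) set" where
  "op_space = B_op ` product_space"

definition q_o :: "dodec \<Rightarrow> real" where
  "q_o = (THE q. q \<in> product_space \<and>
     (\<forall>h\<in>product_space. h base_point = integral_dodec (\<lambda>p. q p * h p)))"

definition A_0 :: "eigenspace168 \<Rightarrow>\<^sub>L eigenspace168" where
  "A_0 = B_op q_o"

section \<open>The lowest eigenline\<close>

definition eigenspace :: "('a::real_normed_vector \<Rightarrow>\<^sub>L 'a) \<Rightarrow> real \<Rightarrow> 'a set" where
  "eigenspace A \<mu> = {F. blinfun_apply A F = \<mu> *\<^sub>R F}"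

definition eigenvalues :: "('a::real_normed_vector \<Rightarrow>\<^sub>L 'a) \<Rightarrow> real list" where
  "eigenvalues A = sorted_list_of_multiset
     (\<Sum>\<mu> | eigenspace A \<mu> \<noteq> {0}. replicate_mset (dim (eigenspace A \<mu>)) \<mu>)"

text \<open>Numbered from 1, in increasing order and with multiplicity.\<close>

definition eigval :: "nat \<Rightarrow> ('a::real_normed_vector \<Rightarrow>\<^sub>L 'a) \<Rightarrow> real" where
  "eigval k A = eigenvalues A ! (k - 1)"

definition Omega :: "(eigenspace168 \<Rightarrow>\<^sub>L eigenspace168) set" where
  "Omega = {A \<in> op_space. eigval 1 A < eigval 2 A}"

definition lowest_line :: "('a::real_normed_vector \<Rightarrow>\<^sub>L 'a) \<Rightarrow> 'a set" where
  "lowest_line A = eigenspace A (eigval 1 A)"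

section \<open>Differentials of maps into projective space\<close>

text \<open>Points of the projective space \<open>P(E)\<close> are the lines \<open>span {F}\<close>, \<open>F \<noteq> 0\<close>. The affine
  chart centred at \<open>[F]\<close> maps a line \<open>L\<close> that is not orthogonal to \<open>F\<close> to the vector \<open>v\<close>
  orthogonal to \<open>F\<close> such that \<open>F + v\<close> spans \<open>L\<close>. It sends \<open>[F]\<close> to 0 and identifies the
  tangent space of \<open>P(E)\<close> at \<open>[F]\<close> with the orthogonal complement of \<open>F\<close>.\<close>

definition line_chart :: "'a::real_inner \<Rightarrow> 'a set \<Rightarrow> 'a" where
  "line_chart F L = (THE v. v \<bullet> F = 0 \<and> F + v \<in> L)"

definition proj_tangent_space :: "'a::real_inner \<Rightarrow> 'a set" where
  "proj_tangent_space F = {v. v \<bullet> F = 0}"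

text \<open>\<open>D\<close> restricted to \<open>V\<close> is the differential at \<open>a\<close>, read in the chart centred at \<open>[F]\<close>, of a
  map \<open>\<Phi>\<close> that is defined on a neighbourhood of \<open>a\<close> in the linear subspace \<open>V\<close> and
  takes the value \<open>[F]\<close> at \<open>a\<close>.\<close>

definition has_proj_differential ::
  "('b::real_normed_vector \<Rightarrow> 'a::real_inner set) \<Rightarrow> ('b \<Rightarrow> 'a) \<Rightarrow> 'a \<Rightarrow> 'b \<Rightarrow> 'b set \<Rightarrow> bool" where
  "has_proj_differential \<Phi> D F a V \<longleftrightarrow>
     \<Phi> a = span {F} \<and> ((\<lambda>x. line_chart F (\<Phi> x)) has_derivative D) (at a within V)"

end

theory Submission
  imports Defs "HOL-Computational_Algebra.Polynomial"
begin

text \<open>For \<open>F \<in> E\<close> and a unit vector \<open>w\<close>, Green's formula applied to \<open>F\<close> and the zonal function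
  \<open>(x \<bullet> w)\<^sup>d\<close> relates the moments of \<open>F\<close> of order \<open>d\<close> and \<open>d - 2\<close> at \<open>w\<close>; since
  \<open>d (d + 2) = 168\<close> only for \<open>d = 12\<close>, they are all determined by the one of order 12. As they
  determine \<open>F w\<close> and translations act transitively, \<open>F\<close> is a constant multiple of its moment of
  order 12, a homogeneous polynomial in \<open>w\<close>. Hence \<open>E\<close> is finite-dimensional and a product of two nonzero
  elements of \<open>E\<close> is nonzero.

  Since \<open>A\<^sub>0 = - \<langle>\<cdot>, k\<rangle> k\<close>, where \<open>k\<close> represents the evaluation at \<open>o\<close> and is therefore
  \<open>I\<^sup>*\<close>-invariant, \<open>[F\<^sub>0] = [k]\<close> is the lowest eigenline, and it is simple. First-order
  perturbation theory shows that the differential maps \<open>B(q)\<close> to a nonzero multiple of the component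
  of \<open>B(q) F\<^sub>0\<close> orthogonal to \<open>F\<^sub>0\<close>. If \<open>z \<perpendicular> F\<^sub>0\<close> is orthogonal to the image, then taking
  \<open>q = F\<^sub>0 z\<close> gives \<open>\<integral> (F\<^sub>0 z)\<^sup>2 = 0\<close>, so \<open>F\<^sub>0 z = 0\<close> and \<open>z = 0\<close>.\<close>

section \<open>Invariance of the volume of the sphere\<close>

text \<open>Every integral over the quotient is pulled back to \<open>vol_S3\<close>, and the proof
  rests on two invariances of that measure: under left multiplications, which makes translations
  isometries of \<open>E\<close>, and under the flows of the left-invariant fields, which gives
  Green's formula. Both kinds of maps are rotations of R^4 and are factored into shears, for which
  invariance of Lebesgue measure is Fubini plus translation invariance. The number 12 comes from a
  resonance: on the sphere the Laplacian sends (x.w)^d to d(d+2) (x.w)^d - d(d-1) (x.w)^(d-2), and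
  168 = 12 * 14. Moments of order below 12 and of odd order therefore vanish, and the even ones
  above 12 propagate from order 12. Finite dimension is needed for more than the final linear
  algebra: it gives the descriptions \<open>q_o\<close> and \<open>B_op\<close> their meaning, keeps
  \<open>dim\<close> and the multiset of eigenvalues away from default values, and makes the unit
  sphere of \<open>E\<close> compact, so that a lowest eigenvalue exists for every nearby operator.
  Simplicity of the lowest eigenvalue also needs a vector orthogonal to \<open>F0\<close> in
  \<open>E\<close>; it is a translate of \<open>F0\<close> that vanishes at the base point.\<close>

definition measure_pres :: "(complex \<times> complex \<Rightarrow> complex \<times> complex) \<Rightarrow> bool" where
  "measure_pres T \<longleftrightarrow> T \<in> borel_measurable borel \<and> distr lborel borel T = lborel"

text \<open>Composition is the reason for stating invariance on all of R^4: the shears below do not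
  preserve the norm, so they do not act on the sphere, but their product does.\<close>

lemma measure_pres_comp:
  assumes "measure_pres S" "measure_pres T"
  shows "measure_pres (\<lambda>x. S (T x))"
proof -
  have m: "S \<in> borel \<rightarrow>\<^sub>M borel" "T \<in> lborel \<rightarrow>\<^sub>M borel"
    using assms by (auto simp: measure_pres_def)
  have "distr (distr lborel borel T) borel S = distr lborel borel (S \<circ> T)"
    by (rule distr_distr[OF m])
  then show ?thesis
    using assms m by (auto simp: measure_pres_def comp_def)
qed

text \<open>On each fibre with fixed \<open>a\<close> the shear is a translation, so Fubini applies.
  The map \<open>m\<close> is only assumed Borel, which covers both complex linear and conjugate
  linear shears.\<close>

lemma measure_pres_shear2:
  assumes [measurable]: "m \<in> borel_measurable borel"
  shows "measure_pres (\<lambda>(a, b). (a, b + m a))"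
proof -
  have M: "(\<lambda>(a, b). (a, b + m a)) \<in> (borel :: (complex \<times> complex) measure) \<rightarrow>\<^sub>M borel"
    unfolding borel_prod[symmetric] by measurable
  have "distr lborel borel (\<lambda>(a, b). (a, b + m a)) = lborel"
  proof (rule measure_eqI)
    fix X assume "X \<in> sets (distr lborel borel (\<lambda>(a, b). (a, b + m a)))"
    then have X: "X \<in> sets borel" by simp
    let ?T = "\<lambda>(a, b). (a, b + m a)"
    have P: "sets ((lborel :: complex measure) \<Otimes>\<^sub>M (lborel :: complex measure)) = sets borel"
      by (simp only: lborel_prod sets_lborel)
    have TX: "?T -` X \<in> sets borel"
      using measurable_sets[OF M X] by simp
    have "emeasure (distr lborel borel ?T) X = emeasure (lborel \<Otimes>\<^sub>M lborel) (?T -` X)"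
      using M X by (simp add: emeasure_distr lborel_prod)
    also have "\<dots> = (\<integral>\<^sup>+a. emeasure lborel (Pair a -` (?T -` X)) \<partial>lborel)"
      by (rule sigma_finite_measure.emeasure_pair_measure_alt[OF sigma_finite_lborel])
         (use TX P in blast)
    also have "\<dots> = (\<integral>\<^sup>+a. emeasure lborel (Pair a -` X) \<partial>lborel)"
    proof (rule nn_integral_cong)
      fix a
      have S: "Pair a -` X \<in> sets borel"
        using X by (intro measurable_sets_borel[where M=borel]) auto
      have "emeasure lborel (Pair a -` X) = emeasure (distr lborel borel ((+) (m a))) (Pair a -` X)"
        by (simp add: lborel_distr_plus)
      also have "\<dots> = emeasure lborel ((+) (m a) -` (Pair a -` X))"
        using S by (subst emeasure_distr) auto
      also have "(+) (m a) -` (Pair a -` X) = Pair a -` (?T -` X)"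
        by (auto simp: add.commute)
      finally show "emeasure lborel (Pair a -` (?T -` X)) = emeasure lborel (Pair a -` X)" ..
    qed
    also have "\<dots> = emeasure (lborel \<Otimes>\<^sub>M lborel) X"
      by (rule sigma_finite_measure.emeasure_pair_measure_alt[OF sigma_finite_lborel, symmetric])
         (use X P in blast)
    finally show "emeasure (distr lborel borel ?T) X = emeasure lborel X" by (simp add: lborel_prod)
  qed simp
  with M show ?thesis by (simp add: measure_pres_def)
qed

lemma measure_pres_swap: "measure_pres (\<lambda>(a, b). (b, a))"
proof -
  have M: "(\<lambda>(a, b). (b, a)) \<in> (borel :: (complex \<times> complex) measure) \<rightarrow>\<^sub>M borel"
    unfolding borel_prod[symmetric] by measurable
  have "(lborel :: complex measure) \<Otimes>\<^sub>M lborel = distr (lborel \<Otimes>\<^sub>M lborel) (lborel \<Otimes>\<^sub>M lborel) (\<lambda>(x, y). (y, x))"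
    by (rule lborel_pair.distr_pair_swap)
  then have "distr (lborel :: (complex \<times> complex) measure) lborel (\<lambda>(x, y). (y, x)) = lborel"
    unfolding lborel_prod by (rule sym)
  moreover have "distr (lborel :: (complex \<times> complex) measure) borel (\<lambda>(x, y). (y, x)) =
      distr (lborel :: (complex \<times> complex) measure) lborel (\<lambda>(x, y). (y, x))"
    by (rule distr_cong) auto
  ultimately show ?thesis using M by (simp add: measure_pres_def)
qed

lemma measure_pres_shear1:
  assumes "m \<in> borel_measurable borel"
  shows "measure_pres (\<lambda>(a, b). (a + m b, b))"
proof -
  have "measure_pres (\<lambda>x. (\<lambda>(a, b). (b, a)) ((\<lambda>(a, b). (a, b + m a)) ((\<lambda>(a, b). (b, a)) x)))"
    by (rule measure_pres_comp[OF measure_pres_swap measure_pres_comp[OF measure_pres_shear2[OF assms] measure_pres_swap]])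
  then show ?thesis by (simp add: case_prod_beta' fun_eq_iff)
qed

text \<open>The product in \<open>SU(2)\<close>, extended to \<open>\<real>\<^sup>4\<close>: the first column of \<open>su2 y ** su2 x\<close>.\<close>

definition qmul :: "complex \<times> complex \<Rightarrow> complex \<times> complex \<Rightarrow> complex \<times> complex" where
  "qmul y x = (fst y * fst x - cnj (snd y) * snd x, snd y * fst x + cnj (fst y) * snd x)"

definition qcnj :: "complex \<times> complex \<Rightarrow> complex \<times> complex" where
  "qcnj y = (cnj (fst y), - snd y)"

lemma unit_pair_cnj:
  assumes "norm (y :: complex \<times> complex) = 1"
  shows "fst y * cnj (fst y) + snd y * cnj (snd y) = 1"
proof -
  have "(norm (fst y))\<^sup>2 + (norm (snd y))\<^sup>2 = 1"
    using assms by (cases y) (simp add: norm_Pair)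
  then have "complex_of_real ((norm (fst y))\<^sup>2 + (norm (snd y))\<^sup>2) = 1" by simp
  then show ?thesis by (simp only: of_real_add complex_norm_square)
qed

lemma norm_qmul:
  assumes "norm y = 1"
  shows "norm (qmul y x) = norm x"
proof -
  obtain c d where y: "y = (c, d)" by (cases y)
  obtain a b where x: "x = (a, b)" by (cases x)
  have n: "c * cnj c + d * cnj d = 1" using unit_pair_cnj[OF assms] by (simp add: y)
  have "complex_of_real ((norm (c*a - cnj d * b))\<^sup>2 + (norm (d*a + cnj c * b))\<^sup>2) =
      (c*a - cnj d * b) * cnj (c*a - cnj d * b) + (d*a + cnj c * b) * cnj (d*a + cnj c * b)"
    by (simp only: of_real_add complex_norm_square)
  also have "\<dots> = (c * cnj c + d * cnj d) * (a * cnj a + b * cnj b)"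
    by (simp add: algebra_simps)
  also have "\<dots> = complex_of_real ((norm a)\<^sup>2 + (norm b)\<^sup>2)"
    by (simp only: n of_real_add complex_norm_square mult_1)
  finally have "(norm (c*a - cnj d * b))\<^sup>2 + (norm (d*a + cnj c * b))\<^sup>2 = (norm a)\<^sup>2 + (norm b)\<^sup>2"
    by (simp only: of_real_eq_iff)
  then show ?thesis by (simp add: qmul_def y x norm_Pair)
qed

lemma linear_qmul: "linear (qmul y)"
  by (rule linearI) (simp_all add: qmul_def algebra_simps scaleR_conv_of_real)

text \<open>An element of \<open>SL(2)\<close> with nonzero lower left entry is a product of three shears.\<close>

lemma measure_pres_qmul_shears:
  assumes "norm y = 1" "snd y \<noteq> 0"
  shows "measure_pres (qmul y)"
proof -
  obtain c d where y: "y = (c, d)" by (cases y)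
  have n: "c * cnj c + d * cnj d = 1" using unit_pair_cnj[OF assms(1)] by (simp add: y)
  have d: "d \<noteq> 0" using assms by (simp add: y)
  \<comment> \<open>Read off from the factorisation into upper, lower and upper unipotent matrices
    with off-diagonal entries \<open>p\<close>, \<open>d\<close>, \<open>q\<close>: its diagonal is
    1 + p d, 1 + q d. The remaining entry is then forced by determinant 1, which is
    \<open>pc\<close>.\<close>
  define p q where "p = (c - 1) / d" and "q = (cnj c - 1) / d"
  have p: "p * d = c - 1" "q * d = cnj c - 1" using d by (simp_all add: p_def q_def)
  have pc: "p + c * q = - cnj d"
  proof -
    have "d * (p + c * q) = p * d + c * (q * d)" by (simp add: algebra_simps)
    also have "\<dots> = c * cnj c - 1" unfolding p by (simp add: algebra_simps)
    also have "\<dots> = d * (- cnj d)" using n by (simp add: algebra_simps)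
    finally have "d * (p + c * q) = d * (- cnj d)" .
    with d show ?thesis by (simp only: mult_cancel_left) simp
  qed
  have "measure_pres (\<lambda>x. (\<lambda>(a, b). (a + (\<lambda>b. p * b) b, b))
      ((\<lambda>(a, b). (a, b + (\<lambda>a. d * a) a)) ((\<lambda>(a, b). (a + (\<lambda>b. q * b) b, b)) x)))"
    by (rule measure_pres_comp[OF measure_pres_shear1 measure_pres_comp[OF measure_pres_shear2 measure_pres_shear1]]) simp_all
  also have "(\<lambda>x. (\<lambda>(a, b). (a + (\<lambda>b. p * b) b, b))
      ((\<lambda>(a, b). (a, b + (\<lambda>a. d * a) a)) ((\<lambda>(a, b). (a + (\<lambda>b. q * b) b, b)) x))) = qmul y"
  proof
    fix x :: "complex \<times> complex"
    obtain a b where x: "x = (a, b)" by (cases x)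
    have "b + d * (a + q * b) = d * a + (1 + q * d) * b" by (simp add: algebra_simps)
    then have "b + d * (a + q * b) = d * a + cnj c * b" by (simp add: p)
    moreover have "a + q * b + p * (b + d * (a + q * b)) = c * a - cnj d * b"
    proof -
      have "a + q * b + p * (b + d * (a + q * b)) = a + (p * d) * a + (q + p + p * d * q) * b"
        by (simp add: algebra_simps)
      also have "\<dots> = c * a + (p + c * q) * b" unfolding p by (simp add: algebra_simps)
      finally show ?thesis by (simp add: pc)
    qed
    ultimately show "(\<lambda>(a, b). (a + (\<lambda>b. p * b) b, b))
      ((\<lambda>(a, b). (a, b + (\<lambda>a. d * a) a)) ((\<lambda>(a, b). (a + (\<lambda>b. q * b) b, b)) x)) = qmul y x"
      by (simp add: x y qmul_def)
  qed
  finally show ?thesis .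
qed

lemma measure_pres_qmul:
  assumes "norm y = 1"
  shows "measure_pres (qmul y)"
proof (cases "snd y = 0")
  case True
  \<comment> \<open>A diagonal element has no lower left entry; multiplying by \<open>(0, 1)\<close>
    moves the nonzero entry \<open>fst y\<close> there, and \<open>(0, -1)\<close> undoes
    this.\<close>
  have "measure_pres (\<lambda>x. qmul (0, -1) (qmul (qmul (0, 1) y) x))"
  proof (rule measure_pres_comp[OF measure_pres_qmul_shears measure_pres_qmul_shears])
    show "snd (qmul (0, 1) y) \<noteq> 0"
      using True assms by (cases y) (auto simp: qmul_def norm_Pair)
  qed (use assms in \<open>auto simp: norm_qmul norm_Pair\<close>)
  also have "(\<lambda>x. qmul (0, -1) (qmul (qmul (0, 1) y) x)) = qmul y"
    by (auto simp: qmul_def fun_eq_iff)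
  finally show ?thesis .
qed (use measure_pres_qmul_shears assms in auto)

text \<open>Right multiplication by a unit quaternion without \<open>i\<close>-component. It is only real linear, but
  again a product of three shears.\<close>

lemma measure_pres_right:
  fixes r :: real
  assumes n: "r\<^sup>2 + (norm \<beta>)\<^sup>2 = 1" and "\<beta> \<noteq> 0"
  shows "measure_pres (\<lambda>(a, b). (of_real r * a - \<beta> * cnj b, of_real r * b + \<beta> * cnj a))"
proof -
  \<comment> \<open>For r = cos s and |\<beta>| = sin s this is tan(s/2) times the phase of \<beta>:
    the usual factorisation of a rotation into three shears, here with conjugate linear
    ones.\<close>
  define \<tau> where "\<tau> = of_real (1 - r) / cnj \<beta>"
  have t: "\<beta> * cnj \<tau> = of_real (1 - r)" "\<tau> * cnj \<beta> = of_real (1 - r)"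
    using assms by (simp_all add: \<tau>_def)
  have "complex_of_real (r\<^sup>2 + (norm \<beta>)\<^sup>2) = 1" using n by simp
  then have n': "of_real r * of_real r + \<beta> * cnj \<beta> = 1"
    by (simp only: of_real_add complex_norm_square of_real_mult power2_eq_square[of r])
  have tr: "\<tau> * (1 + of_real r) = \<beta>"
  proof -
    have "cnj \<beta> * (\<tau> * (1 + of_real r)) = (\<tau> * cnj \<beta>) * (1 + of_real r)" by simp
    also have "\<dots> = 1 - of_real r * of_real r" unfolding t by (simp add: algebra_simps)
    also have "\<dots> = cnj \<beta> * \<beta>" using n' by (metis add_diff_cancel_left' mult.commute)
    finally show ?thesis using assms by simp
  qed
  have "measure_pres (\<lambda>x. (\<lambda>(a, b). (a + (\<lambda>b. - \<tau> * cnj b) b, b))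
      ((\<lambda>(a, b). (a, b + (\<lambda>a. \<beta> * cnj a) a)) ((\<lambda>(a, b). (a + (\<lambda>b. - \<tau> * cnj b) b, b)) x)))"
    by (rule measure_pres_comp[OF measure_pres_shear1 measure_pres_comp[OF measure_pres_shear2 measure_pres_shear1]];
        intro borel_measurable_continuous_onI continuous_intros)
  also have "(\<lambda>x. (\<lambda>(a, b). (a + (\<lambda>b. - \<tau> * cnj b) b, b))
      ((\<lambda>(a, b). (a, b + (\<lambda>a. \<beta> * cnj a) a)) ((\<lambda>(a, b). (a + (\<lambda>b. - \<tau> * cnj b) b, b)) x))) =
     (\<lambda>(a, b). (of_real r * a - \<beta> * cnj b, of_real r * b + \<beta> * cnj a))"
  proof
    fix x :: "complex \<times> complex"
    obtain a b where x: "x = (a, b)" by (cases x)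
    have 1: "b + \<beta> * cnj (a - \<tau> * cnj b) = of_real r * b + \<beta> * cnj a"
    proof -
      have "b + \<beta> * cnj (a - \<tau> * cnj b) = b + \<beta> * cnj a - (\<beta> * cnj \<tau>) * b"
        by (simp add: algebra_simps)
      also have "\<dots> = of_real r * b + \<beta> * cnj a" by (simp add: t algebra_simps)
      finally show ?thesis .
    qed
    have "a - \<tau> * cnj b - \<tau> * cnj (of_real r * b + \<beta> * cnj a) = of_real r * a - \<beta> * cnj b"
    proof -
      have "a - \<tau> * cnj b - \<tau> * cnj (of_real r * b + \<beta> * cnj a) =
        a - (\<tau> * (1 + of_real r)) * cnj b - (\<tau> * cnj \<beta>) * a"
        by (simp add: algebra_simps)
      also have "\<dots> = of_real r * a - \<beta> * cnj b" by (simp only: t tr) (simp add: algebra_simps)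
      finally show ?thesis .
    qed
    with 1 show "(\<lambda>(a, b). (a + (\<lambda>b. - \<tau> * cnj b) b, b))
      ((\<lambda>(a, b). (a, b + (\<lambda>a. \<beta> * cnj a) a)) ((\<lambda>(a, b). (a + (\<lambda>b. - \<tau> * cnj b) b, b)) x)) =
       (\<lambda>(a, b). (of_real r * a - \<beta> * cnj b, of_real r * b + \<beta> * cnj a)) x"
      by (simp add: x)
  qed
  finally show ?thesis .
qed

text \<open>\<open>X_flow j\<close> is the flow of \<open>X_field j\<close>, since \<open>X_field j \<circ> X_field j = - id\<close>.\<close>

definition X_field :: "nat \<Rightarrow> complex \<times> complex \<Rightarrow> complex \<times> complex" where
  "X_field j x = tangent_frame x ! j"

definition X_flow :: "nat \<Rightarrow> real \<Rightarrow> complex \<times> complex \<Rightarrow> complex \<times> complex" where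
  "X_flow j t x = cos t *\<^sub>R x + sin t *\<^sub>R X_field j x"

lemma X_field_simps:
  "X_field 0 (a, b) = (\<i> * a, \<i> * b)"
  "X_field (Suc 0) (a, b) = (- cnj b, cnj a)"
  "X_field 2 (a, b) = (- \<i> * cnj b, \<i> * cnj a)"
  by (simp_all add: X_field_def tangent_frame_def)

lemma less_3_cases: "j < (3::nat) \<Longrightarrow> j = 0 \<or> j = Suc 0 \<or> j = 2"
  by auto

text \<open>Flow time \<open>t\<close> is right multiplication by the unit quaternion cos t + sin t
  e, with e the imaginary unit of the field. The range of \<open>t\<close> makes sin t nonzero, as
  the three-shear factorisation requires for the second and third fields.\<close>

lemma measure_pres_X_flow:
  assumes "j < 3" "0 < t" "t < pi"
  shows "measure_pres (X_flow j t)"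
proof -
  have s: "sin t > 0" using assms by (simp add: sin_gt_zero)
  consider "j = 0" | "j = Suc 0" | "j = 2" using less_3_cases[OF assms(1)] by blast
  then show ?thesis
  proof cases
    case 1
    \<comment> \<open>The first field multiplies by \<open>cis t\<close>, which has an i-component;
      it is the product of two quaternions with r = 0, given by \<beta> = -1 and \<beta> =
      \<open>cis t\<close>.\<close>
    have "measure_pres (\<lambda>x. (\<lambda>(a, b). (of_real 0 * a - cis t * cnj b, of_real 0 * b + cis t * cnj a))
      ((\<lambda>(a, b). (of_real 0 * a - (-1) * cnj b, of_real 0 * b + (-1) * cnj a)) x))"
      by (rule measure_pres_comp[OF measure_pres_right measure_pres_right]) auto
    also have "(\<lambda>x. (\<lambda>(a, b). (of_real 0 * a - cis t * cnj b, of_real 0 * b + cis t * cnj a))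
      ((\<lambda>(a, b). (of_real 0 * a - (-1) * cnj b, of_real 0 * b + (-1) * cnj a)) x)) = X_flow j t"
      by (auto simp: fun_eq_iff X_flow_def 1 X_field_simps complex_eq_iff algebra_simps)
    finally show ?thesis .
  next
    case 2
    have "measure_pres (\<lambda>(a, b). (of_real (cos t) * a - of_real (sin t) * cnj b, of_real (cos t) * b + of_real (sin t) * cnj a))"
      by (intro measure_pres_right) (use s in auto)
    also have "(\<lambda>(a, b). (of_real (cos t) * a - of_real (sin t) * cnj b, of_real (cos t) * b + of_real (sin t) * cnj a)) = X_flow j t"
      by (auto simp: fun_eq_iff X_flow_def 2 X_field_simps scaleR_conv_of_real)
    finally show ?thesis .
  next
    case 3
    have "measure_pres (\<lambda>(a, b). (of_real (cos t) * a - (\<i> * of_real (sin t)) * cnj b, of_real (cos t) * b + (\<i> * of_real (sin t)) * cnj a))"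
      by (intro measure_pres_right) (use s in \<open>auto simp: norm_mult\<close>)
    also have "(\<lambda>(a, b). (of_real (cos t) * a - (\<i> * of_real (sin t)) * cnj b, of_real (cos t) * b + (\<i> * of_real (sin t)) * cnj a)) = X_flow j t"
      by (auto simp: fun_eq_iff X_flow_def 3 X_field_simps scaleR_conv_of_real algebra_simps)
    finally show ?thesis .
  qed
qed

lemma linear_X_field: "j < 3 \<Longrightarrow> linear (X_field j)"
  by (drule less_3_cases, rule linearI)
     (auto simp: X_field_simps algebra_simps scaleR_conv_of_real)

lemma X_field_orthogonal:
  assumes "j < 3"
  shows "x \<bullet> X_field j x = 0" "norm (X_field j x) = norm x" "X_field j (X_field j x) = - x"
    "x \<bullet> X_field j y = - (X_field j x \<bullet> y)"
proof -
  show "x \<bullet> X_field j y = - (X_field j x \<bullet> y)" for x y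
    using less_3_cases[OF assms] by (cases x; cases y) (auto simp: X_field_simps inner_complex_def algebra_simps)
  from this[of x x] show "x \<bullet> X_field j x = 0" by (simp add: inner_commute)
  show "X_field j (X_field j x) = - x"
    using less_3_cases[OF assms] by (cases x) (auto simp: X_field_simps)
  show "norm (X_field j x) = norm x"
    using less_3_cases[OF assms] by (cases x) (auto simp: X_field_simps norm_Pair norm_mult)
qed

lemma linear_X_flow: "j < 3 \<Longrightarrow> linear (X_flow j t)"
  unfolding X_flow_def using linear_X_field[of j]
  by (intro linear_compose_add linear_compose_scale_right linear_id[unfolded id_def])

lemma norm_X_flow:
  assumes "j < 3"
  shows "norm (X_flow j t x) = norm x"
proof -
  have n: "X_field j x \<bullet> X_field j x = x \<bullet> x"
    using X_field_orthogonal(2)[OF assms, of x] by (simp add: norm_eq_sqrt_inner)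
  have "X_flow j t x \<bullet> X_flow j t x = cos t * (cos t * (x \<bullet> x)) + sin t * (sin t * (x \<bullet> x))"
    using X_field_orthogonal(1)[OF assms, of x]
    by (simp add: X_flow_def inner_add_left inner_add_right inner_commute[of "X_field j x" x] n)
  also have "\<dots> = (cos t * cos t + sin t * sin t) * (x \<bullet> x)" by (simp only: distrib_right mult.assoc)
  also have "\<dots> = x \<bullet> x" by simp
  finally show ?thesis by (simp add: norm_eq_sqrt_inner)
qed

section \<open>Integrals over the sphere of functions that need not be constant on rays\<close>

lemma continuous_nonzero_measurable:
  fixes h :: "complex \<times> complex \<Rightarrow> real"
  assumes "continuous_on (-{0}) h"
  shows "h \<in> borel_measurable borel"
  by (rule borel_measurable_continuous_countable_exceptions[of "{0}"])
     (use assms in \<open>auto simp: Compl_eq_Diff_UNIV\<close>)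

lemma sgn_sgn_idem [simp]: "sgn (sgn x) = sgn (x :: 'a::real_normed_vector)"
  by (cases "x = 0") (simp_all add: sgn_div_norm)

lemma continuous_on_sgn_comp:
  fixes h :: "complex \<times> complex \<Rightarrow> real"
  assumes "continuous_on (-{0}) h"
  shows "continuous_on (-{0}) (\<lambda>x. h (sgn x))"
  by (rule continuous_on_compose2[OF assms]) (auto intro!: continuous_intros simp: sgn_zero_iff)

text \<open>\<open>vol_S3\<close> is an image measure under \<open>sgn\<close>, so \<open>h\<close>
  may be replaced by its extension along rays. This brings zonal functions and their products with
  lifts, which are not constant on rays, under the integration lemmas for lifts.\<close>

lemma integral_vol_S3_sgn:
  fixes h :: "complex \<times> complex \<Rightarrow> real"
  assumes "h \<in> borel_measurable borel"
  shows "integral\<^sup>L vol_S3 (\<lambda>x. h (sgn x)) = integral\<^sup>L vol_S3 h"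
    "integrable vol_S3 (\<lambda>x. h (sgn x)) \<longleftrightarrow> integrable vol_S3 h"
proof -
  have h': "(\<lambda>x. h (sgn x)) \<in> borel_measurable borel" using assms by measurable
  have s: "sgn \<in> density lborel (\<lambda>x :: complex \<times> complex. ennreal (4 * indicator (ball 0 1) x)) \<rightarrow>\<^sub>M borel"
    by simp
  show "integral\<^sup>L vol_S3 (\<lambda>x. h (sgn x)) = integral\<^sup>L vol_S3 h"
    unfolding vol_S3_def integral_distr[OF s h'] integral_distr[OF s assms] by simp
  show "integrable vol_S3 (\<lambda>x. h (sgn x)) \<longleftrightarrow> integrable vol_S3 h"
    unfolding vol_S3_def integrable_distr_eq[OF s h'] integrable_distr_eq[OF s assms] by simp
qed

lemma vol_S3_integrable_continuous:
  fixes h :: "complex \<times> complex \<Rightarrow> real"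
  assumes "continuous_on (-{0}) h"
  shows "integrable vol_S3 h"
  using vol_S3_integrable(1)[OF continuous_on_sgn_comp[OF assms]]
    integral_vol_S3_sgn(2)[OF continuous_nonzero_measurable[OF assms]] by simp

lemma integral_vol_S3_eq:
  fixes h :: "complex \<times> complex \<Rightarrow> real"
  assumes "continuous_on (-{0}) h"
  shows "integral\<^sup>L vol_S3 h = (\<integral>x. 4 * indicator (ball 0 1) x * h (sgn x) \<partial>lborel)"
  using vol_S3_integrable(2)[OF continuous_on_sgn_comp[OF assms]]
    integral_vol_S3_sgn(1)[OF continuous_nonzero_measurable[OF assms]] by simp

lemma integral_vol_S3_cong:
  fixes h :: "complex \<times> complex \<Rightarrow> real"
  assumes "continuous_on (-{0}) h" "continuous_on (-{0}) k" "\<And>x. norm x = 1 \<Longrightarrow> h x = k x"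
  shows "integral\<^sup>L vol_S3 h = integral\<^sup>L vol_S3 k"
  unfolding integral_vol_S3_eq[OF assms(1)] integral_vol_S3_eq[OF assms(2)]
proof (rule integral_cong_AE)
  have "AE x in lborel. x \<noteq> (0 :: complex \<times> complex)" by (rule AE_lborel_singleton)
  then show "AE x in lborel. 4 * indicator (ball 0 1) x * h (sgn x) = 4 * indicator (ball 0 1) x * k (sgn x)"
    by eventually_elim (simp add: assms(3) norm_sgn)
  have m: "(\<lambda>x. 4 * indicator (ball 0 1) x * f (sgn x)) \<in> borel_measurable lborel"
    if "continuous_on (-{0}) f" for f :: "complex \<times> complex \<Rightarrow> real"
  proof -
    have "(\<lambda>x. 4 * indicator (ball 0 1) x * f (sgn x)) \<in> borel_measurable borel"
      by (intro borel_measurable_times borel_measurable_const borel_measurable_indicator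
          continuous_nonzero_measurable[OF continuous_on_sgn_comp[OF that]]) simp
    then show ?thesis by (simp only: measurable_def space_lborel sets_lborel)
  qed
  show "(\<lambda>x. 4 * indicator (ball 0 1) x * h (sgn x)) \<in> borel_measurable lborel"
    "(\<lambda>x. 4 * indicator (ball 0 1) x * k (sgn x)) \<in> borel_measurable lborel"
    by (rule m[OF assms(1)], rule m[OF assms(2)])
qed

text \<open>Such a \<open>T\<close> preserves the unit ball and commutes with \<open>sgn\<close>, so
  it preserves the cone description of the spherical volume together with Lebesgue measure.\<close>

lemma integral_vol_S3_pres:
  fixes h :: "complex \<times> complex \<Rightarrow> real"
  assumes h: "continuous_on (-{0}) h" and T: "measure_pres T" "linear T" "\<And>x. norm (T x) = norm x"
  shows "integral\<^sup>L vol_S3 (\<lambda>x. h (T x)) = integral\<^sup>L vol_S3 h"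
proof -
  have c: "continuous_on (-{0}) (\<lambda>x. h (T x))"
  proof (rule continuous_on_compose2[OF h])
    show "continuous_on (-{0}) T" using T(2) by (simp add: linear_continuous_on linear_linear)
    show "T ` (-{0}) \<subseteq> -{0}"
    proof
      fix y assume "y \<in> T ` (-{0})"
      then obtain x where "y = T x" "x \<noteq> 0" by auto
      then have "norm y \<noteq> 0" using T(3)[of x] by simp
      then show "y \<in> -{0}" by auto
    qed
  qed
  have sg: "T (sgn x) = sgn (T x)" for x
    using T(2,3) by (simp add: sgn_div_norm linear_cmul)
  have m: "(\<lambda>x. 4 * indicator (ball 0 1) x * h (sgn x)) \<in> borel_measurable (borel :: (complex \<times> complex) measure)"
    by (intro borel_measurable_times borel_measurable_const borel_measurable_indicator
        continuous_nonzero_measurable[OF continuous_on_sgn_comp[OF h]]) simp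
  have Tm: "T \<in> lborel \<rightarrow>\<^sub>M borel" using T(1) by (auto simp: measure_pres_def)
  have "integral\<^sup>L vol_S3 (\<lambda>x. h (T x)) = (\<integral>x. 4 * indicator (ball 0 1) (T x) * h (sgn (T x)) \<partial>lborel)"
    unfolding integral_vol_S3_eq[OF c] by (simp add: sg T(3) indicator_def)
  also have "\<dots> = (\<integral>x. 4 * indicator (ball 0 1) x * h (sgn x) \<partial>distr lborel borel T)"
    by (rule integral_distr[OF Tm m, symmetric])
  also have "\<dots> = integral\<^sup>L vol_S3 h"
    using T(1) by (simp add: integral_vol_S3_eq[OF h] measure_pres_def)
  finally show ?thesis .
qed

lemma integral_vol_S3_qmul:
  fixes h :: "complex \<times> complex \<Rightarrow> real"
  assumes "continuous_on (-{0}) h" "norm y = 1"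
  shows "integral\<^sup>L vol_S3 (\<lambda>x. h (qmul y x)) = integral\<^sup>L vol_S3 h"
  by (rule integral_vol_S3_pres[OF assms(1) measure_pres_qmul[OF assms(2)] linear_qmul norm_qmul[OF assms(2)]])

lemma integral_vol_S3_nonneg:
  fixes h :: "complex \<times> complex \<Rightarrow> real"
  assumes "\<And>x. 0 \<le> h x"
  shows "0 \<le> integral\<^sup>L vol_S3 h"
  using assms by simp

lemma integral_vol_S3_eq_0:
  fixes h :: "complex \<times> complex \<Rightarrow> real"
  assumes c: "continuous_on (-{0}) h" and nn: "\<And>x. norm x = 1 \<Longrightarrow> 0 \<le> h x"
    and 0: "integral\<^sup>L vol_S3 h = 0" and x: "norm x = 1"
  shows "h x = 0"
proof (rule ccontr)
  assume nz: "h x \<noteq> 0"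
  define g where "g y = h (sgn y)" for y
  have gc: "continuous_on (-{0}) g" unfolding g_def by (rule continuous_on_sgn_comp[OF c])
  have gs: "g (sgn y) = g y" for y by (simp add: g_def)
  note int = vol_S3_integrable[OF gc gs]
  have g0: "AE y in lborel. 0 \<le> 4 * indicator (ball 0 1) y * g y"
  proof -
    have "AE y in lborel. y \<noteq> (0 :: complex \<times> complex)" by (rule AE_lborel_singleton)
    then show ?thesis by eventually_elim (simp add: g_def nn norm_sgn)
  qed
  have "(\<integral>y. 4 * indicator (ball 0 1) y * g y \<partial>lborel) = 0"
    using 0 integral_vol_S3_eq[OF c] by (simp add: g_def)
  then have ae: "AE y in lborel. 4 * indicator (ball 0 1) y * g y = 0"
    using integral_nonneg_eq_0_iff_AE[OF int(3) g0] by auto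
  define U where "U = (ball 0 1 - {0}) \<inter> g -` (-{0})"
  have oU: "open U"
  proof -
    have o: "open (ball 0 1 - {0} :: (complex \<times> complex) set)" by auto
    have c': "continuous_on (ball 0 1 - {0}) g" by (rule continuous_on_subset[OF gc]) auto
    then show ?thesis unfolding U_def using continuous_open_preimage[OF c' o, of "-{0}"] by auto
  qed
  have "AE y in lborel. y \<notin> U" using ae by eventually_elim (auto simp: U_def)
  then have "U \<in> null_sets lborel"
    using AE_iff_null_sets[of U lborel] oU by auto
  then have "negligible U"
    using null_sets_completionI negligible_iff_null_sets by blast
  then have "U = {}" using open_not_negligible[OF oU] by auto
  \<comment> \<open>The point \<open>x\<close> lies on the boundary of the open ball; half of it
    lies inside and has the same \<open>sgn\<close>.\<close>
  moreover have "(1/2) *\<^sub>R x \<in> U"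
    using x nz by (auto simp: U_def g_def sgn_div_norm)
  ultimately show False by blast
qed

section \<open>Smooth functions and the Laplacian in terms of the left-invariant fields\<close>

lemma C_k_on_Suc_D: "C_k_on (Suc k) S f \<Longrightarrow> open S \<Longrightarrow> C_k_on k S f"
proof (induction k arbitrary: f)
  case 0
  then show ?case by (auto intro: differentiable_imp_continuous_on)
next
  case (Suc k)
  then show ?case by (metis C_k_on.simps(2))
qed

lemma C_k_on_mult:
  assumes "open S" "C_k_on k S f" "C_k_on k S g"
  shows "C_k_on k S (\<lambda>x. f x * g x)"
  using assms(2,3)
proof (induction k arbitrary: f g)
  case 0
  then show ?case by (auto intro: continuous_on_mult)
next
  case (Suc k)
  have d: "(f has_derivative frechet_derivative f (at x)) (at x)"
          "(g has_derivative frechet_derivative g (at x)) (at x)" if "x \<in> S" for x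
    using C_k_on_has_derivative[OF assms(1) _ that] Suc.prems by blast+
  have d': "((\<lambda>x. f x * g x) has_derivative
      (\<lambda>h. f x * frechet_derivative g (at x) h + frechet_derivative f (at x) h * g x)) (at x)"
    if "x \<in> S" for x
    by (rule has_derivative_mult[OF d[OF that]])
  have eq: "frechet_derivative (\<lambda>x. f x * g x) (at x) =
      (\<lambda>h. f x * frechet_derivative g (at x) h + frechet_derivative f (at x) h * g x)" if "x \<in> S" for x
    using frechet_derivative_at[OF d'[OF that]] by simp
  show ?case
  proof (simp, intro conjI ballI)
    show "(\<lambda>x. f x * g x) differentiable_on S"
      using d' by (meson differentiable_at_imp_differentiable_on differentiableI)
    fix b :: 'a assume b: "b \<in> Basis"
    have "C_k_on k S (\<lambda>x. f x * frechet_derivative g (at x) b + frechet_derivative f (at x) b * g x)"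
      by (intro C_k_on_add[OF assms(1)] Suc.IH)
         (use Suc.prems b C_k_on_Suc_D[OF _ assms(1)] in \<open>auto simp del: C_k_on.simps(1)\<close>)
    then show "C_k_on k S (\<lambda>x. frechet_derivative (\<lambda>x. f x * g x) (at x) b)"
      by (rule C_k_on_cong[OF assms(1), rotated]) (use eq in auto)
  qed
qed

lemma C_k_on_linear:
  fixes f :: "'a::euclidean_space \<Rightarrow> real"
  assumes "open S" "linear f"
  shows "C_k_on k S f"
proof (cases k)
  case 0
  then show ?thesis using assms by (simp add: linear_continuous_on linear_linear)
next
  case (Suc m)
  have d: "(f has_derivative f) (at x)" for x
    using assms(2) by (simp add: bounded_linear_imp_has_derivative linear_linear)
  have "frechet_derivative f (at x) = f" for x
    using frechet_derivative_at[OF d] by simp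
  moreover have "f differentiable_on S"
    using d by (meson differentiable_at_imp_differentiable_on differentiableI)
  ultimately show ?thesis using C_k_on_const[OF assms(1)] by (simp add: Suc)
qed

lemma C_k_on_sum:
  assumes "open S" "\<And>i. i \<in> A \<Longrightarrow> C_k_on k S (f i)"
  shows "C_k_on k S (\<lambda>x. \<Sum>i\<in>A. f i x)"
  using assms(2)
  by (induction A rule: infinite_finite_induct)
     (auto intro: C_k_on_const[OF assms(1)] C_k_on_add[OF assms(1)])

text \<open>By the chain rule each partial derivative of the composite is a constant linear
  combination of partial derivatives of \<open>f\<close> composed with the same \<open>L\<close>, so
  the induction closes. It gives smoothness of translates.\<close>

lemma C_k_on_comp_linear:
  assumes "open S" "linear L" "C_k_on k S f" "\<And>x. x \<in> S \<Longrightarrow> L x \<in> S"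
  shows "C_k_on k S (\<lambda>x. f (L x))"
  using assms(3)
proof (induction k arbitrary: f)
  case 0
  show ?case
    unfolding C_k_on.simps
    by (rule continuous_on_compose2[of S f S L])
       (use 0 assms(2,4) in \<open>auto simp: linear_continuous_on linear_linear\<close>)
next
  case (Suc k)
  have bL: "bounded_linear L" using assms(2) by (simp add: linear_linear)
  have d: "(f has_derivative frechet_derivative f (at x)) (at x)" if "x \<in> S" for x
    by (rule C_k_on_has_derivative[OF assms(1) Suc.prems that])
  have d': "((\<lambda>x. f (L x)) has_derivative (\<lambda>h. frechet_derivative f (at (L x)) (L h))) (at x)"
    if "x \<in> S" for x
    by (rule has_derivative_compose[OF bounded_linear_imp_has_derivative[OF bL]]) (rule d[OF assms(4)[OF that]])
  have eq: "frechet_derivative (\<lambda>x. f (L x)) (at x) h =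
      (\<Sum>b\<in>Basis. (L h \<bullet> b) * frechet_derivative f (at (L x)) b)"
    if "x \<in> S" for x h
  proof -
    have lin: "linear (frechet_derivative f (at (L x)))"
      using d[OF assms(4)[OF that]] has_derivative_linear by blast
    have "frechet_derivative (\<lambda>x. f (L x)) (at x) h = frechet_derivative f (at (L x)) (L h)"
      using frechet_derivative_at[OF d'[OF that]] by (simp add: fun_eq_iff)
    also have "\<dots> = frechet_derivative f (at (L x)) (\<Sum>b\<in>Basis. (L h \<bullet> b) *\<^sub>R b)"
      by (simp add: euclidean_representation)
    finally show ?thesis using lin by (simp add: linear_sum linear_cmul)
  qed
  show ?case
  proof (simp, intro conjI ballI)
    show "(\<lambda>x. f (L x)) differentiable_on S"
      using d' by (meson differentiable_at_imp_differentiable_on differentiableI)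
    fix b :: 'a assume b: "b \<in> Basis"
    have "C_k_on k S (\<lambda>x. \<Sum>c\<in>Basis. (L b \<bullet> c) * frechet_derivative f (at (L x)) c)"
      by (intro C_k_on_sum C_k_on_cmult assms(1) Suc.IH) (use Suc.prems in auto)
    then show "C_k_on k S (\<lambda>x. frechet_derivative (\<lambda>x. f (L x)) (at x) b)"
      by (rule C_k_on_cong[OF assms(1), rotated]) (use eq in auto)
  qed
qed

lemma smooth_on_mult:
  "open S \<Longrightarrow> smooth_on S f \<Longrightarrow> smooth_on S g \<Longrightarrow> smooth_on S (\<lambda>x. f x * g x)"
  by (simp add: smooth_on_def C_k_on_mult)

lemma smooth_on_const: "open S \<Longrightarrow> smooth_on S (\<lambda>x. c)"
  by (simp add: smooth_on_def C_k_on_const)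

lemma smooth_on_linear:
  fixes f :: "'a::euclidean_space \<Rightarrow> real"
  shows "open S \<Longrightarrow> linear f \<Longrightarrow> smooth_on S f"
  by (simp add: smooth_on_def C_k_on_linear)

lemma smooth_on_add:
  "open S \<Longrightarrow> smooth_on S f \<Longrightarrow> smooth_on S g \<Longrightarrow> smooth_on S (\<lambda>x. f x + g x)"
  by (simp add: smooth_on_def C_k_on_add)

lemma smooth_on_sum:
  "open S \<Longrightarrow> (\<And>i. i \<in> A \<Longrightarrow> smooth_on S (f i)) \<Longrightarrow> smooth_on S (\<lambda>x. \<Sum>i\<in>A. f i x)"
  by (simp add: smooth_on_def C_k_on_sum)

lemma smooth_on_power: "open S \<Longrightarrow> smooth_on S f \<Longrightarrow> smooth_on S (\<lambda>x. f x ^ n)"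
  by (induction n) (auto intro: smooth_on_const smooth_on_mult)

lemma smooth_on_cong:
  "open S \<Longrightarrow> smooth_on S f \<Longrightarrow> (\<And>x. x \<in> S \<Longrightarrow> f x = g x) \<Longrightarrow> smooth_on S g"
  unfolding smooth_on_def by (blast intro: C_k_on_cong)

lemma smooth_on_frechet: "smooth_on S f \<Longrightarrow> b \<in> Basis \<Longrightarrow> smooth_on S (\<lambda>x. frechet_derivative f (at x) b)"
  unfolding smooth_on_def by (metis C_k_on.simps(2))

lemma smooth_on_has_derivative:
  "open S \<Longrightarrow> smooth_on S f \<Longrightarrow> x \<in> S \<Longrightarrow> (f has_derivative frechet_derivative f (at x)) (at x)"
  unfolding smooth_on_def by (blast intro: C_k_on_has_derivative)

lemma smooth_on_continuous: "smooth_on S f \<Longrightarrow> continuous_on S f"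
  unfolding smooth_on_def by (metis C_k_on.simps(1))

lemma open_minus_0 [simp]: "open (-{0 :: 'a::{t1_space,zero}})"
  by (simp add: open_Compl)

definition Xd :: "nat \<Rightarrow> (complex \<times> complex \<Rightarrow> real) \<Rightarrow> complex \<times> complex \<Rightarrow> real" where
  "Xd j u x = frechet_derivative u (at x) (X_field j x)"

lemma Xd_eqI: "(u has_derivative u') (at x) \<Longrightarrow> Xd j u x = u' (X_field j x)"
  using frechet_derivative_at by (fastforce simp: Xd_def)

lemma smooth_on_Xd:
  assumes "smooth_on (-{0}) u" "j < 3"
  shows "smooth_on (-{0}) (Xd j u)"
proof -
  have "smooth_on (-{0}) (\<lambda>x. \<Sum>b\<in>Basis. (X_field j x \<bullet> b) * frechet_derivative u (at x) b)"
  proof (rule smooth_on_sum[OF open_minus_0], rule smooth_on_mult[OF open_minus_0 smooth_on_linear smooth_on_frechet])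
    show "linear (\<lambda>x. X_field j x \<bullet> b)" for b
      using linear_X_field[OF assms(2)] by (simp add: linear_iff inner_add_left)
  qed (use assms in auto)
  then show ?thesis
  proof (rule smooth_on_cong[OF open_minus_0])
    fix x :: "complex \<times> complex" assume x: "x \<in> -{0}"
    have lin: "linear (frechet_derivative u (at x))"
      using smooth_on_has_derivative[OF open_minus_0 assms(1) x] has_derivative_linear by blast
    have "Xd j u x = frechet_derivative u (at x) (\<Sum>b\<in>Basis. (X_field j x \<bullet> b) *\<^sub>R b)"
      by (simp only: Xd_def euclidean_representation)
    then show "(\<Sum>b\<in>Basis. (X_field j x \<bullet> b) * frechet_derivative u (at x) b) = Xd j u x"
      using lin by (simp add: linear_sum linear_cmul)
  qed
qed

lemma X_flow_nonzero: "j < 3 \<Longrightarrow> x \<noteq> 0 \<Longrightarrow> X_flow j t x \<noteq> 0"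
  using norm_X_flow[of j t x] by auto

lemma X_flow_zero: "X_flow j 0 x = x"
  by (simp add: X_flow_def)

text \<open>Since the field squares to minus the identity, the velocity of the great circle is the
  field at the current point: the geodesic is an integral curve.\<close>

lemma X_flow_has_derivative:
  assumes u: "smooth_on (-{0}) u" and "j < 3" "x \<noteq> 0"
  shows "((\<lambda>t. u (X_flow j t x)) has_real_derivative Xd j u (X_flow j t x)) (at t)"
proof -
  have "((\<lambda>t. X_flow j t x) has_vector_derivative (- sin t *\<^sub>R x + cos t *\<^sub>R X_field j x)) (at t)"
    unfolding X_flow_def by (auto intro!: derivative_eq_intros)
  moreover have "- sin t *\<^sub>R x + cos t *\<^sub>R X_field j x = X_field j (X_flow j t x)"
    using linear_X_field[OF assms(2)]
    by (simp add: X_flow_def linear_add linear_cmul X_field_orthogonal(3)[OF assms(2)])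
  ultimately have c: "((\<lambda>t. X_flow j t x) has_vector_derivative X_field j (X_flow j t x)) (at t)" by simp
  have "((u \<circ> (\<lambda>t. X_flow j t x)) has_vector_derivative
      frechet_derivative u (at (X_flow j t x)) (X_field j (X_flow j t x))) (at t)"
    by (rule vector_derivative_diff_chain_within[OF c
          has_derivative_at_withinI[OF smooth_on_has_derivative[OF open_minus_0 u]]])
       (use X_flow_nonzero[OF assms(2,3)] in auto)
  then show ?thesis
    by (simp add: has_real_derivative_iff_has_vector_derivative o_def Xd_def)
qed

text \<open>Because the geodesic in direction \<open>X_field j x\<close> stays an integral curve for
  all times, differentiating twice along it applies the field twice, with no first-order correction.
  Hence the Laplacian is minus a sum of squares of fields.\<close>

lemma hess_X_field:
  assumes u: "smooth_on (-{0}) u" and "j < 3" "x \<noteq> 0"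
  shows "hess u x (X_field j x) = Xd j (Xd j u) x"
proof -
  have "deriv (\<lambda>t. u (X_flow j t x)) = (\<lambda>t. Xd j u (X_flow j t x))"
    using DERIV_imp_deriv[OF X_flow_has_derivative[OF assms]] by (simp add: fun_eq_iff)
  moreover have "deriv (\<lambda>t. Xd j u (X_flow j t x)) 0 = Xd j (Xd j u) (X_flow j 0 x)"
    by (rule DERIV_imp_deriv[OF X_flow_has_derivative[OF smooth_on_Xd[OF assms(1,2)] assms(2,3)]])
  ultimately show ?thesis by (simp add: hess_def X_flow_def)
qed

lemma laplacian_S3_Xd:
  assumes u: "smooth_on (-{0}) u" and "x \<noteq> 0"
  shows "laplacian_S3 u x = - (\<Sum>j<3. Xd j (Xd j u) x)"
proof -
  have "tangent_frame x = [X_field 0 x, X_field (Suc 0) x, X_field 2 x]"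
    by (cases x) (simp add: tangent_frame_def X_field_simps)
  then show ?thesis
    using hess_X_field[OF u _ assms(2)] by (simp add: laplacian_S3_def lessThan_nat_numeral lessThan_Suc)
qed

section \<open>Green's formula\<close>

lemma AE_vol_S3: "AE x in vol_S3. norm x = 1"
proof -
  have s: "sgn \<in> density lborel (\<lambda>x :: complex \<times> complex. ennreal (4 * indicator (ball 0 1) x)) \<rightarrow>\<^sub>M borel"
    by simp
  have "AE x in lborel. x \<noteq> (0 :: complex \<times> complex)" by (rule AE_lborel_singleton)
  then have "AE x in density lborel (\<lambda>x :: complex \<times> complex. ennreal (4 * indicator (ball 0 1) x)). norm (sgn x) = 1"
  proof (subst AE_density)
    have "(\<lambda>x :: complex \<times> complex. 4 * indicator (ball 0 1) x :: real) \<in> borel_measurable borel"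
      by (intro borel_measurable_times borel_measurable_const borel_measurable_indicator) simp
    then show "(\<lambda>x :: complex \<times> complex. ennreal (4 * indicator (ball 0 1) x)) \<in> borel_measurable lborel"
      by simp
  qed (auto simp: norm_sgn)
  moreover have "{x :: complex \<times> complex. norm x = 1} \<in> sets borel" by measurable
  ultimately show ?thesis
    unfolding vol_S3_def by (subst AE_distr_iff[OF s]) auto
qed

text \<open>The difference quotients of \<open>g\<close> along the flow have integral zero by
  invariance. They converge to \<open>Xd j g\<close>, and the mean value theorem bounds them by the
  maximum of |\<open>Xd j g\<close>| on the sphere, so dominated convergence applies.\<close>

lemma integral_Xd:
  assumes g: "smooth_on (-{0}) g" and j: "j < 3"
  shows "integral\<^sup>L vol_S3 (Xd j g) = 0"
proof -
  have cg: "continuous_on (-{0}) g" and cX: "continuous_on (-{0}) (Xd j g)"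
    using smooth_on_continuous g smooth_on_Xd[OF g j] by auto
  \<comment> \<open>Positive step sizes at most 1, hence below pi, as the invariance under the flow
    demands.\<close>
  define h where "h n = 1 / real (Suc n)" for n
  have h: "0 < h n" "h n \<le> 1" for n by (auto simp: h_def field_simps)
  have h0: "h \<longlonglongrightarrow> 0" unfolding h_def using LIMSEQ_inverse_real_of_nat by (simp add: inverse_eq_divide)
  define s where "s n x = (g (X_flow j (h n) x) - g x) / h n" for n x
  have cf: "continuous_on (-{0}) (\<lambda>x. g (X_flow j (h n) x))" for n
  proof (rule continuous_on_compose2[OF cg])
    show "continuous_on (-{0}) (X_flow j (h n))"
      using linear_X_flow[OF j] by (simp add: linear_continuous_on linear_linear)
    show "X_flow j (h n) ` (-{0}) \<subseteq> -{0}"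
      by (intro image_subsetI) (simp add: X_flow_nonzero[OF j])
  qed
  have cs: "continuous_on (-{0}) (s n)" for n
    unfolding s_def using cf cg h(1)[of n] by (auto intro!: continuous_intros)
  have s0: "integral\<^sup>L vol_S3 (s n) = 0" for n
  proof -
    have "h n < pi" using h(2)[of n] pi_gt3 by linarith
    then have "integral\<^sup>L vol_S3 (\<lambda>x. g (X_flow j (h n) x)) = integral\<^sup>L vol_S3 g"
      by (intro integral_vol_S3_pres[OF cg measure_pres_X_flow[OF j h(1)] linear_X_flow[OF j] norm_X_flow[OF j]])
    then show ?thesis
      unfolding s_def using vol_S3_integrable_continuous[OF cf] vol_S3_integrable_continuous[OF cg] by simp
  qed
  have "compact (Xd j g ` sphere 0 1)"
    by (rule compact_continuous_image[OF continuous_on_subset[OF cX]]) auto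
  then obtain K where "\<forall>x\<in>sphere 0 1. \<bar>Xd j g x\<bar> \<le> K"
    by (auto dest!: compact_imp_bounded simp: bounded_iff)
  then have K: "\<bar>Xd j g x\<bar> \<le> K" if "norm x = 1" for x using that by simp
  have "(\<lambda>n. integral\<^sup>L vol_S3 (s n)) \<longlonglongrightarrow> integral\<^sup>L vol_S3 (Xd j g)"
  proof (rule integral_dominated_convergence[where w = "\<lambda>x. K"])
    show "Xd j g \<in> borel_measurable vol_S3" "\<And>n. s n \<in> borel_measurable vol_S3"
      using vol_S3_integrable_continuous[OF cX] vol_S3_integrable_continuous[OF cs] by auto
    show "integrable vol_S3 (\<lambda>x. K)" by (rule vol_S3_integrable_continuous) auto
    show "AE x in vol_S3. (\<lambda>n. s n x) \<longlonglongrightarrow> Xd j g x"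
      using AE_vol_S3
    proof eventually_elim
      case (elim x)
      then have "x \<noteq> 0" by auto
      from X_flow_has_derivative[OF g j this, of 0]
      have "(\<lambda>t. (g (X_flow j t x) - g x) / t) \<midarrow>0\<rightarrow> Xd j g x"
        by (simp add: DERIV_def X_flow_zero)
      moreover have "filterlim h (at 0) sequentially"
        using h0 h(1) by (auto simp: filterlim_at intro!: always_eventually less_imp_neq[symmetric])
      ultimately show ?case unfolding s_def by (rule filterlim_compose)
    qed
    show "AE x in vol_S3. norm (s n x) \<le> K" for n
      using AE_vol_S3
    proof eventually_elim
      case (elim x)
      then have "x \<noteq> 0" by auto
      have "\<exists>z>0. z < h n \<and> g (X_flow j (h n) x) - g (X_flow j 0 x) = (h n - 0) * Xd j g (X_flow j z x)"
        using h(1)[of n] X_flow_has_derivative[OF g j \<open>x \<noteq> 0\<close>]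
        by (intro MVT2[where f = "\<lambda>t. g (X_flow j t x)"]) auto
      then obtain z where "g (X_flow j (h n) x) - g (X_flow j 0 x) = (h n - 0) * Xd j g (X_flow j z x)"
        by blast
      then have "s n x = Xd j g (X_flow j z x)"
        using h(1)[of n] by (simp add: s_def X_flow_zero)
      then show ?case using K[of "X_flow j z x"] norm_X_flow[OF j, of z x] elim by simp
    qed
  qed
  then show ?thesis unfolding s0 using LIMSEQ_unique tendsto_const by blast
qed

lemma Xd_mult:
  assumes "smooth_on (-{0}) f" "smooth_on (-{0}) g" "x \<noteq> 0"
  shows "Xd j (\<lambda>x. f x * g x) x = f x * Xd j g x + Xd j f x * g x"
proof -
  have x: "x \<in> -{0}" using assms by simp
  show ?thesis
    using Xd_eqI[OF has_derivative_mult[OF smooth_on_has_derivative[OF open_minus_0 assms(1) x]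
          smooth_on_has_derivative[OF open_minus_0 assms(2) x]]]
    by (simp add: Xd_def)
qed

text \<open>Integrating the field derivative of \<open>p * Xd j u\<close> to zero turns each term
  into minus the integral of \<open>Xd j p * Xd j u\<close>, which is symmetric in \<open>u\<close>
  and \<open>p\<close>.\<close>

lemma green:
  assumes u: "smooth_on (-{0}) u" and p: "smooth_on (-{0}) p"
  shows "integral\<^sup>L vol_S3 (\<lambda>x. p x * (\<Sum>j<3. Xd j (Xd j u) x)) =
         integral\<^sup>L vol_S3 (\<lambda>x. u x * (\<Sum>j<3. Xd j (Xd j p) x))"
proof -
  have 1: "integral\<^sup>L vol_S3 (\<lambda>x. p x * Xd j (Xd j u) x) = - integral\<^sup>L vol_S3 (\<lambda>x. Xd j p x * Xd j u x)"
    "integrable vol_S3 (\<lambda>x. p x * Xd j (Xd j u) x)"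
    if j: "j < 3" and u: "smooth_on (-{0}) u" and p: "smooth_on (-{0}) p" for j u p
  proof -
    note sm = smooth_on_mult[OF open_minus_0] smooth_on_Xd u p j
    have sp: "smooth_on (-{0}) (\<lambda>x. p x * Xd j u x)"
      "smooth_on (-{0}) (\<lambda>x. p x * Xd j (Xd j u) x)"
      "smooth_on (-{0}) (\<lambda>x. Xd j p x * Xd j u x)" by (intro sm)+
    note i = vol_S3_integrable_continuous[OF smooth_on_continuous]
    show "integrable vol_S3 (\<lambda>x. p x * Xd j (Xd j u) x)" by (rule i[OF sp(2)])
    have "0 = integral\<^sup>L vol_S3 (Xd j (\<lambda>x. p x * Xd j u x))"
      using integral_Xd[OF sp(1) j] by simp
    also have "\<dots> = integral\<^sup>L vol_S3 (\<lambda>x. p x * Xd j (Xd j u) x + Xd j p x * Xd j u x)"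
    proof (rule integral_vol_S3_cong)
      fix x :: "complex \<times> complex" assume "norm x = 1"
      then have "x \<noteq> 0" by auto
      then show "Xd j (\<lambda>x. p x * Xd j u x) x = p x * Xd j (Xd j u) x + Xd j p x * Xd j u x"
        by (rule Xd_mult[OF p smooth_on_Xd[OF u j]])
    qed (intro smooth_on_continuous smooth_on_add[OF open_minus_0] sm sp j)+
    also have "\<dots> = integral\<^sup>L vol_S3 (\<lambda>x. p x * Xd j (Xd j u) x) + integral\<^sup>L vol_S3 (\<lambda>x. Xd j p x * Xd j u x)"
      by (rule Bochner_Integration.integral_add[OF i[OF sp(2)] i[OF sp(3)]])
    finally show "integral\<^sup>L vol_S3 (\<lambda>x. p x * Xd j (Xd j u) x) = - integral\<^sup>L vol_S3 (\<lambda>x. Xd j p x * Xd j u x)"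
      by simp
  qed
  have "integral\<^sup>L vol_S3 (\<lambda>x. p x * (\<Sum>j<3. Xd j (Xd j u) x)) = (\<Sum>j<3. integral\<^sup>L vol_S3 (\<lambda>x. p x * Xd j (Xd j u) x))"
    unfolding sum_distrib_left by (rule Bochner_Integration.integral_sum) (use 1(2)[OF _ u p] in auto)
  also have "\<dots> = (\<Sum>j<3. integral\<^sup>L vol_S3 (\<lambda>x. u x * Xd j (Xd j p) x))"
    by (rule sum.cong[OF refl]) (use 1(1)[OF _ u p] 1(1)[OF _ p u] in \<open>simp add: mult.commute\<close>)
  also have "\<dots> = integral\<^sup>L vol_S3 (\<lambda>x. u x * (\<Sum>j<3. Xd j (Xd j p) x))"
    unfolding sum_distrib_left by (rule Bochner_Integration.integral_sum[symmetric]) (use 1(2)[OF _ p u] in auto)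
  finally show ?thesis .
qed

section \<open>Moments of an eigenfunction\<close>

lemma smooth_zonal: "smooth_on (-{0}) (\<lambda>x. (x \<bullet> w) ^ d)"
  by (intro smooth_on_power smooth_on_linear) (auto simp: linear_iff inner_add_left)

lemma Xd_zonal: "Xd j (\<lambda>x. (x \<bullet> w) ^ d) x = real d * (x \<bullet> w) ^ (d - 1) * (X_field j x \<bullet> w)"
proof -
  have "((\<lambda>x. (x \<bullet> w) ^ d) has_derivative (\<lambda>h. real d * (h \<bullet> w) * (x \<bullet> w) ^ (d - 1))) (at x)"
    by (auto intro!: derivative_eq_intros)
  from Xd_eqI[OF this] show ?thesis by (simp add: mult_ac)
qed

text \<open>The last term comes from the field squaring to minus the identity. For
  \<open>d < 2\<close> the exponent is truncated, but then its coefficient is zero.\<close>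

lemma Xd_Xd_zonal:
  assumes "j < 3"
  shows "Xd j (Xd j (\<lambda>x. (x \<bullet> w) ^ d)) x =
    real d * real (d - 1) * (x \<bullet> w) ^ (d - 2) * (X_field j x \<bullet> w)\<^sup>2 - real d * (x \<bullet> w) ^ d"
proof -
  have lin: "bounded_linear (X_field j)" using linear_X_field[OF assms] by (simp add: linear_linear)
  have "((\<lambda>x. real d * (x \<bullet> w) ^ (d - 1) * (X_field j x \<bullet> w)) has_derivative
     (\<lambda>h. real d * (x \<bullet> w) ^ (d - 1) * (X_field j h \<bullet> w) +
        (real d * (real (d - 1) * (h \<bullet> w) * (x \<bullet> w) ^ (d - 1 - 1))) * (X_field j x \<bullet> w))) (at x)"
    by (auto intro!: derivative_eq_intros bounded_linear_imp_has_derivative[OF lin])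
  from Xd_eqI[OF this] have "Xd j (Xd j (\<lambda>x. (x \<bullet> w) ^ d)) x =
      real d * (x \<bullet> w) ^ (d - 1) * (X_field j (X_field j x) \<bullet> w) +
        (real d * (real (d - 1) * (X_field j x \<bullet> w) * (x \<bullet> w) ^ (d - 1 - 1))) * (X_field j x \<bullet> w)"
    by (simp only: Xd_zonal[abs_def])
  moreover have "real d * (x \<bullet> w) ^ (d - 1) * (X_field j (X_field j x) \<bullet> w) = - (real d * (x \<bullet> w) ^ d)"
    by (cases d) (auto simp: X_field_orthogonal(3)[OF assms])
  moreover have "d - 1 - 1 = d - 2" by simp
  ultimately show ?thesis
    by (simp add: power2_eq_square mult_ac)
qed

text \<open>For a unit vector \<open>x\<close>, the vector and its three fields form an orthonormal
  basis of R^4; this is Parseval's identity for \<open>w\<close> with the \<open>x\<close>-component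
  moved to the right.\<close>

lemma X_field_parseval: "(\<Sum>j<3. (X_field j x \<bullet> w)\<^sup>2) = (norm x)\<^sup>2 * (norm w)\<^sup>2 - (x \<bullet> w)\<^sup>2"
proof -
  obtain a b where x: "x = (a, b)" by (cases x)
  obtain c d where w: "w = (c, d)" by (cases w)
  have n: "(norm x)\<^sup>2 = (Re a)\<^sup>2 + (Im a)\<^sup>2 + ((Re b)\<^sup>2 + (Im b)\<^sup>2)"
    "(norm w)\<^sup>2 = (Re c)\<^sup>2 + (Im c)\<^sup>2 + ((Re d)\<^sup>2 + (Im d)\<^sup>2)"
    by (simp_all add: x w norm_Pair cmod_power2)
  show ?thesis
    unfolding n by (simp add: x w lessThan_nat_numeral lessThan_Suc X_field_simps inner_complex_def
        power2_eq_square algebra_simps)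
qed

lemma laplacian_zonal:
  assumes "norm x = 1" "norm w = 1"
  shows "(\<Sum>j<3. Xd j (Xd j (\<lambda>x. (x \<bullet> w) ^ d)) x) =
    real d * real (d - 1) * (x \<bullet> w) ^ (d - 2) - real d * (real d + 2) * (x \<bullet> w) ^ d"
proof -
  have "(\<Sum>j<3. Xd j (Xd j (\<lambda>x. (x \<bullet> w) ^ d)) x) =
     real d * real (d - 1) * (x \<bullet> w) ^ (d - 2) * (\<Sum>j<3. (X_field j x \<bullet> w)\<^sup>2) - 3 * (real d * (x \<bullet> w) ^ d)"
    by (simp add: Xd_Xd_zonal sum_subtractf flip: sum_distrib_left)
  also have "\<dots> = real d * real (d - 1) * (x \<bullet> w) ^ (d - 2) * (1 - (x \<bullet> w)\<^sup>2) - 3 * (real d * (x \<bullet> w) ^ d)"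
    by (simp add: X_field_parseval assms)
  also have "real d * real (d - 1) * (x \<bullet> w) ^ (d - 2) * (1 - (x \<bullet> w)\<^sup>2) =
      real d * real (d - 1) * (x \<bullet> w) ^ (d - 2) - real d * real (d - 1) * (x \<bullet> w) ^ d"
  proof (cases "d \<ge> 2")
    case True
    then have "(x \<bullet> w) ^ d = (x \<bullet> w) ^ (d - 2) * (x \<bullet> w)\<^sup>2"
      by (metis le_add_diff_inverse2 power_add)
    then show ?thesis by (simp add: algebra_simps)
  next
    case False
    then have "d = 0 \<or> d = 1" by auto
    then show ?thesis by auto
  qed
  also have "real d * real (d - 1) * (x \<bullet> w) ^ d + 3 * (real d * (x \<bullet> w) ^ d) = real d * (real d + 2) * (x \<bullet> w) ^ d"
    by (cases d) (auto simp: algebra_simps)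
  then have "real d * real (d - 1) * (x \<bullet> w) ^ (d - 2) - real d * real (d - 1) * (x \<bullet> w) ^ d - 3 * (real d * (x \<bullet> w) ^ d) =
    real d * real (d - 1) * (x \<bullet> w) ^ (d - 2) - real d * (real d + 2) * (x \<bullet> w) ^ d" by linarith
  finally show ?thesis .
qed

abbreviation eigl :: "eigenspace168 \<Rightarrow> complex \<times> complex \<Rightarrow> real" where
  "eigl F \<equiv> lift (eig_fun F)"

text \<open>Defined for all \<open>w\<close> in R^4 and not only for unit vectors, so that it is a
  homogeneous polynomial in \<open>w\<close> that can be restricted to straight lines.\<close>

definition moment :: "nat \<Rightarrow> eigenspace168 \<Rightarrow> complex \<times> complex \<Rightarrow> real" where
  "moment d F w = integral\<^sup>L vol_S3 (\<lambda>x. eigl F x * (x \<bullet> w) ^ d)"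

lemma eigl_smooth: "smooth_on (-{0}) (eigl F)"
  using eig_fun_smooth by (simp add: smooth_dodec_def)

lemma moment_recurrence:
  assumes "norm w = 1"
  shows "(real d * (real d + 2) - 168) * moment d F w = real d * real (d - 1) * moment (d - 2) F w"
proof -
  let ?p = "\<lambda>d x. (x \<bullet> w) ^ d"
  note c = smooth_on_continuous[OF eigl_smooth] smooth_on_continuous[OF smooth_zonal]
  have cm: "continuous_on (-{0}) (\<lambda>x. eigl F x * (x \<bullet> w) ^ d)" for d
    by (intro continuous_on_mult c)
  have L: "(\<Sum>j<3. Xd j (Xd j (eigl F)) x) = - (168 * eigl F x)" if "norm x = 1" for x
  proof -
    have "laplacian_S3 (eigl F) x = 168 * eigl F x"
      using eig_fun[of F] that by (auto simp: is_eigenfunction_def)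
    moreover have "x \<noteq> 0" using that by auto
    ultimately show ?thesis using laplacian_S3_Xd[OF eigl_smooth, of x F] by simp
  qed
  have "-168 * moment d F w = integral\<^sup>L vol_S3 (\<lambda>x. -168 * (eigl F x * ?p d x))"
    by (simp add: moment_def)
  also have "\<dots> = integral\<^sup>L vol_S3 (\<lambda>x. ?p d x * (\<Sum>j<3. Xd j (Xd j (eigl F)) x))"
    by (rule integral_vol_S3_cong)
       (auto intro!: continuous_intros cm c smooth_on_continuous[OF smooth_on_Xd] smooth_on_Xd eigl_smooth simp: L)
  also have "\<dots> = integral\<^sup>L vol_S3 (\<lambda>x. eigl F x * (\<Sum>j<3. Xd j (Xd j (?p d)) x))"
    by (rule green[OF eigl_smooth smooth_zonal])
  also have "\<dots> = integral\<^sup>L vol_S3 (\<lambda>x. real d * real (d - 1) * (eigl F x * ?p (d - 2) x)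
      - real d * (real d + 2) * (eigl F x * ?p d x))"
    by (rule integral_vol_S3_cong)
       (auto intro!: continuous_intros cm c smooth_on_continuous[OF smooth_on_Xd] smooth_on_Xd smooth_zonal
         simp: laplacian_zonal[OF _ assms] algebra_simps)
  also have "\<dots> = real d * real (d - 1) * moment (d - 2) F w - real d * (real d + 2) * moment d F w"
    using vol_S3_integrable_continuous[OF cm] by (simp add: moment_def)
  finally show ?thesis by (simp add: algebra_simps)
qed

text \<open>For \<open>d \<noteq> 12\<close> the factor \<open>d (d + 2) - 168\<close> is nonzero, so that the moment of order 12
  determines all others.\<close>

lemma moments_vanish:
  assumes "norm w = 1" "moment 12 F w = 0"
  shows "moment d F w = 0"
proof (induction d rule: less_induct)
  case (less d)
  show ?case
  proof (cases "d = 12")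
    case False
    have "real d * (real d + 2) - 168 = (real d - 12) * (real d + 14)" by (simp add: algebra_simps)
    with False have nz: "real d * (real d + 2) - 168 \<noteq> 0" by simp
    \<comment> \<open>For \<open>d = 0\<close> the coefficient vanishes; otherwise the truncated
      \<open>d - 2\<close> is smaller than \<open>d\<close>, and the induction hypothesis
      applies.\<close>
    have "real d * real (d - 1) * moment (d - 2) F w = 0"
      using less[of "d - 2"] by (cases "d = 0") auto
    then have "(real d * (real d + 2) - 168) * moment d F w = 0"
      by (simp only: moment_recurrence[OF assms(1)])
    with nz show ?thesis unfolding mult_eq_0_iff by blast
  qed (use assms in auto)
qed

text \<open>The recurrence of order 0 reads -168 times the moment equals 0, so eigenfunctions have
  mean zero. The moment of order 0 does not involve \<open>w\<close>, hence the choice of one unit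
  vector.\<close>

lemma moment_zero_order: "moment 0 F w = 0"
proof -
  have "moment 0 F (1, 0) = 0"
    using moment_recurrence[of "(1, 0)" 0 F] by (simp add: norm_Pair)
  then show ?thesis by (simp add: moment_def)
qed

text \<open>By Weierstrass approximation, \<open>h\<close> integrates to 0 against a bump function of \<open>x \<bullet> w\<close>
  supported near \<open>w\<close>.\<close>

lemma zonal_moments_zero_imp_not_pos:
  fixes h :: "complex \<times> complex \<Rightarrow> real"
  assumes h: "continuous_on (-{0}) h" and w: "norm w = 1"
    and 0: "\<And>d. integral\<^sup>L vol_S3 (\<lambda>x. h x * (x \<bullet> w) ^ d) = 0"
  shows "\<not> h w > 0"
proof
  assume pos: "h w > 0"
  have cont: "isCont h w"
    using h w by (metis continuous_on_eq_continuous_at open_minus_0 ComplI singletonD norm_zero zero_neq_one)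
  obtain r where r: "r > 0" "\<And>x. dist x w < r \<Longrightarrow> \<bar>h x - h w\<bar> < h w"
    using cont pos unfolding continuous_at_eps_delta dist_real_def by blast
  have hr: "h x > 0" if "dist x w < r" for x using r(2)[OF that] by linarith
  \<comment> \<open>On the sphere |x - w|^2 = 2 - 2 (x.w), so \<psi>(x.w) is positive exactly at
    distance less than \<open>r\<close> from \<open>w\<close>, where \<open>h\<close> is
    positive.\<close>
  define \<psi> where "\<psi> s = max 0 (s - 1 + r\<^sup>2 / 2)" for s :: real
  have c\<psi>: "continuous_on S \<psi>" for S unfolding \<psi>_def by (intro continuous_intros)
  have c1: "continuous_on (-{0}) (\<lambda>x :: complex \<times> complex. \<psi> (x \<bullet> w))"
    by (rule continuous_on_compose2[OF c\<psi>[of UNIV]]) (auto intro!: continuous_intros)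
  have chp: "continuous_on (-{0}) (\<lambda>x. h x * \<psi> (x \<bullet> w))" by (intro continuous_on_mult h c1)
  have nn: "0 \<le> h x * \<psi> (x \<bullet> w)" if "norm x = 1" for x
  proof (cases "\<psi> (x \<bullet> w) = 0")
    case False
    then have gt: "x \<bullet> w > 1 - r\<^sup>2 / 2" by (auto simp: \<psi>_def max_def split: if_splits)
    have "(dist x w)\<^sup>2 = 2 - 2 * (x \<bullet> w)"
      using that w by (simp add: dist_norm norm_diff_ineq power2_norm_eq_inner inner_diff_left inner_diff_right inner_commute norm_eq_1)
    then have "(dist x w)\<^sup>2 < r\<^sup>2" using gt by simp
    then have "dist x w < r" by (rule power2_less_imp_less) (use r(1) in simp)
    then show ?thesis using hr[of x] by (simp add: \<psi>_def)
  qed simp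
  have "compact (h ` sphere 0 1)"
    by (rule compact_continuous_image[OF continuous_on_subset[OF h]]) auto
  then obtain K where "\<forall>x\<in>sphere 0 1. \<bar>h x\<bar> \<le> K"
    by (auto dest!: compact_imp_bounded simp: bounded_iff)
  then have K: "\<bar>h x\<bar> \<le> K" if "norm x = 1" for x using that by simp
  have "integral\<^sup>L vol_S3 (\<lambda>x. h x * \<psi> (x \<bullet> w)) = 0"
  proof (rule ccontr)
    let ?I = "integral\<^sup>L vol_S3 (\<lambda>x. h x * \<psi> (x \<bullet> w))"
    let ?V = "integral\<^sup>L vol_S3 (\<lambda>x. K + 1)"
    assume "?I \<noteq> 0"
    have K0: "K \<ge> 0" using K[OF w] by linarith
    have V0: "?V \<ge> 0" using K0 by (intro integral_vol_S3_nonneg) auto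
    \<comment> \<open>Chosen so that \<open>e * ?V < \<bar>?I\<bar>\<close>. A polynomial within
      \<open>e\<close> of \<psi> integrates to zero against \<open>h\<close>, so |\<open>?I\<close>|
      is at most \<open>e * ?V\<close>. The 1 added to \<open>?V\<close> keeps the denominator
      positive.\<close>
    define e where "e = \<bar>?I\<bar> / (2 * (?V + 1))"
    have e: "e > 0" using V0 \<open>?I \<noteq> 0\<close> by (simp add: e_def)
    obtain p where p: "real_polynomial_function p" "\<And>s. s \<in> {-1..1} \<Longrightarrow> \<bar>\<psi> s - p s\<bar> < e"
      using Stone_Weierstrass_real_polynomial_function[of "{-1..1::real}" \<psi> e] c\<psi> e by auto
    then obtain a n where a: "p = (\<lambda>s. \<Sum>i\<le>n. a i * s ^ i)"
      using real_polynomial_function_iff_sum by auto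
    have ci: "continuous_on (-{0}) (\<lambda>x. h x * (x \<bullet> w) ^ i)" for i
      by (intro continuous_intros h)
    have I0: "integral\<^sup>L vol_S3 (\<lambda>x. h x * p (x \<bullet> w)) = 0"
    proof -
      have "(\<lambda>x. h x * p (x \<bullet> w)) = (\<lambda>x. \<Sum>i\<le>n. a i * (h x * (x \<bullet> w) ^ i))"
        by (simp add: a sum_distrib_left mult_ac)
      then show ?thesis
        using vol_S3_integrable_continuous[OF ci] 0 by (simp add: Bochner_Integration.integral_sum)
    qed
    have cp: "continuous_on (-{0}) (\<lambda>x. h x * p (x \<bullet> w))"
      unfolding a by (intro continuous_intros h)
    have "?I = integral\<^sup>L vol_S3 (\<lambda>x. h x * \<psi> (x \<bullet> w) - h x * p (x \<bullet> w))"
      using I0 vol_S3_integrable_continuous[OF cp] vol_S3_integrable_continuous[OF chp] by simp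
    then have "\<bar>?I\<bar> \<le> integral\<^sup>L vol_S3 (\<lambda>x. \<bar>h x * \<psi> (x \<bullet> w) - h x * p (x \<bullet> w)\<bar>)"
      using integral_abs_bound by simp
    also have "\<dots> \<le> integral\<^sup>L vol_S3 (\<lambda>x. e * (K + 1))"
    proof (rule integral_mono_AE)
      show "integrable vol_S3 (\<lambda>x. \<bar>h x * \<psi> (x \<bullet> w) - h x * p (x \<bullet> w)\<bar>)"
        using vol_S3_integrable_continuous[OF cp] vol_S3_integrable_continuous[OF chp] by simp
      show "integrable vol_S3 (\<lambda>x. e * (K + 1))" by (rule vol_S3_integrable_continuous) simp
      show "AE x in vol_S3. \<bar>h x * \<psi> (x \<bullet> w) - h x * p (x \<bullet> w)\<bar> \<le> e * (K + 1)"
        using AE_vol_S3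
      proof eventually_elim
        case (elim x)
        have "\<bar>x \<bullet> w\<bar> \<le> 1" using Cauchy_Schwarz_ineq2[of x w] elim w by simp
        then have "\<bar>\<psi> (x \<bullet> w) - p (x \<bullet> w)\<bar> \<le> e" using p(2)[of "x \<bullet> w"] by (auto simp: abs_le_iff)
        then have "\<bar>h x\<bar> * \<bar>\<psi> (x \<bullet> w) - p (x \<bullet> w)\<bar> \<le> (K + 1) * e"
          using K[OF elim] K0 by (intro mult_mono) auto
        then show ?case by (simp add: abs_mult mult_ac flip: right_diff_distrib)
      qed
    qed
    also have "integral\<^sup>L vol_S3 (\<lambda>x. e * (K + 1)) = e * ?V" by (rule integral_mult_right_zero)
    also have "\<dots> < \<bar>?I\<bar>"
    proof -
      have "b / (2 * (v + 1)) * v < b" if "0 \<le> v" "0 < b" for b v :: real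
      proof -
        have "0 \<le> b * v" using that by simp
        moreover have "b * (2 * (v + 1)) = 2 * (b * v) + 2 * b" by (simp add: algebra_simps)
        ultimately have "v * b < b * (2 * (v + 1))" using that by (simp only: mult.commute[of v b])
        then show ?thesis using that by (simp add: pos_divide_less_eq mult_ac)
      qed
      from this[OF V0] \<open>?I \<noteq> 0\<close> show ?thesis unfolding e_def by simp
    qed
    finally show False by simp
  qed
  then have "h w * \<psi> (w \<bullet> w) = 0"
    using integral_vol_S3_eq_0[OF chp nn _ w] by simp
  moreover have "\<psi> (w \<bullet> w) > 0" using w r(1) by (simp add: \<psi>_def norm_eq_1 max_def)
  ultimately show False using pos by simp
qed

lemma eigl_eq_0:
  assumes "norm w = 1" "moment 12 F w = 0"
  shows "eigl F w = 0"
proof -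
  have c: "continuous_on (-{0}) (eigl F)" by (rule eig_fun_continuous)
  have m: "integral\<^sup>L vol_S3 (\<lambda>x. eigl F x * (x \<bullet> w) ^ d) = 0" for d
    using moments_vanish[OF assms] by (simp add: moment_def)
  have "\<not> eigl F w > 0" by (rule zonal_moments_zero_imp_not_pos[OF c assms(1) m])
  moreover have "\<not> - eigl F w > 0"
    by (rule zonal_moments_zero_imp_not_pos[where h="\<lambda>x. - eigl F x", OF _ assms(1)])
       (use m c in \<open>auto intro!: continuous_intros\<close>)
  ultimately show ?thesis by simp
qed

section \<open>Translations\<close>

lemma su2_mult: "su2 y ** su2 x = su2 (qmul y x)"
  by (simp add: su2_def qmul_def vec_eq_iff forall_2 matrix_matrix_mult_def sum_2 algebra_simps)

lemma su2_one: "su2 (1, 0) = mat 1"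
  by (simp add: su2_def vec_eq_iff forall_2 mat_def)

lemma norm_qcnj: "norm (qcnj y) = norm y"
  by (cases y) (simp add: qcnj_def norm_Pair)

lemma qcnj_qcnj: "qcnj (qcnj y) = y"
  by (simp add: qcnj_def)

lemma qmul_qcnj: "norm y = 1 \<Longrightarrow> qmul (qcnj y) y = (1, 0)"
  using unit_pair_cnj[of y] by (simp add: qmul_def qcnj_def mult.commute)

lemma qmul_one: "qmul y (1, 0) = y" "qmul (1, 0) y = y"
  by (simp_all add: qmul_def)

lemma qmul_assoc: "qmul (qmul x y) z = qmul x (qmul y z)"
  by (simp add: qmul_def algebra_simps)

lemma carrier_SU2: "A \<in> carrier SU2 \<longleftrightarrow> (\<exists>y. norm y = 1 \<and> A = su2 y)"
  unfolding SU2_eq_su2 image_iff Bex_def by (simp del: split_paired_Ex)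

lemma su2_carrier: "norm y = 1 \<Longrightarrow> su2 y \<in> carrier SU2"
  using carrier_SU2 by blast

lemma group_SU2: "group SU2"
proof (rule groupI)
  show "\<one>\<^bsub>SU2\<^esub> \<in> carrier SU2"
    using su2_carrier[of "(1, 0)"] by (simp add: su2_one norm_Pair SU2_def)
  fix A B assume "A \<in> carrier SU2" "B \<in> carrier SU2"
  then obtain x y where "norm x = 1" "norm y = 1" "A = su2 x" "B = su2 y" by (auto simp: carrier_SU2)
  then show "A \<otimes>\<^bsub>SU2\<^esub> B \<in> carrier SU2"
    using su2_carrier[of "qmul x y"] by (simp add: SU2_def su2_mult norm_qmul)
next
  fix A assume "A \<in> carrier SU2"
  then obtain x where "norm x = 1" "A = su2 x" by (auto simp: carrier_SU2)
  then show "\<exists>B\<in>carrier SU2. B \<otimes>\<^bsub>SU2\<^esub> A = \<one>\<^bsub>SU2\<^esub>"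
    using su2_carrier[of "qcnj x"]
    by (intro bexI[of _ "su2 (qcnj x)"]) (simp_all add: SU2_def su2_mult norm_qcnj qmul_qcnj su2_one)
qed (auto simp: SU2_def matrix_mul_assoc)

lemma inv_su2: "norm y = 1 \<Longrightarrow> inv\<^bsub>SU2\<^esub> (su2 y) = su2 (qcnj y)"
  by (rule group.inv_equality[OF group_SU2])
     (simp_all add: su2_carrier norm_qcnj, simp add: SU2_def su2_mult qmul_qcnj su2_one)

lemma golden_inverse: "1 / golden = golden - 1" "golden\<^sup>2 = golden + 1" "golden > 0"
proof -
  show g: "golden > 0" by (simp add: golden_def add_pos_nonneg)
  show s: "golden\<^sup>2 = golden + 1" by (simp add: golden_def power2_eq_square field_simps)
  have "golden * (golden - 1) = 1" using s by (simp add: power2_eq_square algebra_simps)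
  then show "1 / golden = golden - 1" using g by (simp add: field_simps)
qed

lemma subgroup_Istar: "subgroup Istar SU2"
proof -
  have "norm (Complex (1/2) (1/2), Complex (1/2) (-1/2)) = 1"
    by (simp add: norm_Pair cmod_power2) (simp add: power2_eq_square)
  moreover have "norm (Complex (golden / 2) (1 / (2 * golden)), Complex (1/2) 0) = 1"
  proof -
    have "1 / (2 * golden) = (golden - 1) / 2" using golden_inverse(1) by (simp add: field_simps)
    then have "(norm (Complex (golden / 2) (1 / (2 * golden))))\<^sup>2 = (golden\<^sup>2 + (golden - 1)\<^sup>2) / 4"
      by (simp only:) (simp add: cmod_power2 power_divide add_divide_distrib)
    also have "\<dots> = 3 / 4" using golden_inverse(2) by (simp add: power2_eq_square algebra_simps)
    finally have 1: "(norm (Complex (golden / 2) (1 / (2 * golden))))\<^sup>2 = 3 / 4" .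
    have 2: "(norm (Complex (1 / 2) 0))\<^sup>2 = 1 / 4" by (simp add: cmod_power2) (simp add: power2_eq_square)
    show ?thesis unfolding norm_Pair 1 2 by simp
  qed
  ultimately show ?thesis
    unfolding Istar_def by (intro group.generate_is_subgroup[OF group_SU2]) (auto intro: su2_carrier)
qed

lemma coset_Istar:
  assumes "a \<in> Istar"
  shows "coset a = base_point"
proof -
  interpret SU2: group SU2 by (rule group_SU2)
  interpret I: subgroup Istar SU2 by (rule subgroup_Istar)
  have "a <#\<^bsub>SU2\<^esub> Istar = \<one>\<^bsub>SU2\<^esub> <#\<^bsub>SU2\<^esub> Istar"
  proof -
    have "a \<in> \<one>\<^bsub>SU2\<^esub> <#\<^bsub>SU2\<^esub> Istar"
      using assms I.subset by (simp add: SU2.lcos_mult_one)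
    then show ?thesis
      using SU2.l_repr_independence[OF _ SU2.one_closed subgroup_Istar] by metis
  qed
  then show ?thesis by (simp add: coset_def base_point_def SU2_def)
qed

lemma eig_fun_base_point: "eig_fun F base_point = eigl F (1, 0)"
  by (simp add: lift_def base_point_def sgn_div_norm norm_Pair su2_one)

text \<open>Away from 0 the matrix \<open>su2 (sgn x)\<close> lies in \<open>SU2\<close>, so its
  coset is a genuine element of the quotient and \<open>Abs_dodec\<close> can be inverted.\<close>

lemma lift_translate:
  assumes y: "norm y = 1" and x: "x \<noteq> 0"
  shows "lift (translate (su2 y) f) x = lift f (qmul (qcnj y) x)"
proof -
  interpret SU2: group SU2 by (rule group_SU2)
  interpret I: subgroup Istar SU2 by (rule subgroup_Istar)
  have n: "norm (sgn x) = 1" using x by (simp add: norm_sgn)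
  have "dodec_coset (coset (su2 (sgn x))) = su2 (sgn x) <#\<^bsub>SU2\<^esub> Istar"
    unfolding coset_def by (rule Abs_dodec_inverse) (use su2_carrier[OF n] in auto)
  moreover have "inv\<^bsub>SU2\<^esub> (su2 y) <#\<^bsub>SU2\<^esub> (su2 (sgn x) <#\<^bsub>SU2\<^esub> Istar) =
      su2 (qmul (qcnj y) (sgn x)) <#\<^bsub>SU2\<^esub> Istar"
    using SU2.lcos_m_assoc[OF I.subset, of "su2 (qcnj y)" "su2 (sgn x)"] y
    by (simp add: inv_su2 su2_carrier n norm_qcnj) (simp add: SU2_def su2_mult)
  moreover have "qmul (qcnj y) (sgn x) = sgn (qmul (qcnj y) x)"
    using y by (simp add: sgn_div_norm norm_qmul norm_qcnj linear_cmul[OF linear_qmul])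
  ultimately show ?thesis by (simp add: lift_def translate_def flip: coset_def)
qed

text \<open>The fields are right multiplications by the quaternions \<open>(\<i>, 0)\<close>,
  \<open>(0, 1)\<close> and \<open>(0, \<i>)\<close>, so this is associativity. It makes left
  translations carry geodesics of the frame to geodesics of the frame, hence preserve the
  Laplacian.\<close>

lemma X_field_qmul: "j < 3 \<Longrightarrow> X_field j (qmul y x) = qmul y (X_field j x)"
  by (drule less_3_cases, cases x) (auto simp: X_field_simps qmul_def algebra_simps)

lemma X_flow_qmul: "j < 3 \<Longrightarrow> X_flow j t (qmul y x) = qmul y (X_flow j t x)"
  by (simp add: X_flow_def X_field_qmul linear_add[OF linear_qmul] linear_cmul[OF linear_qmul])

lemma qmul_nonzero: "norm y = 1 \<Longrightarrow> x \<noteq> 0 \<Longrightarrow> qmul y x \<noteq> 0"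
  using norm_qmul[of y x] by auto

lemma is_eigenfunction_translate:
  assumes y: "norm y = 1" and f: "is_eigenfunction ev f"
  shows "is_eigenfunction ev (translate (su2 y) f)"
proof -
  let ?L = "qmul (qcnj y)" and ?g = "translate (su2 y) f"
  have y': "norm (qcnj y) = 1" using y by (simp add: norm_qcnj)
  have sf: "smooth_on (-{0}) (lift f)" using f by (simp add: is_eigenfunction_def smooth_dodec_def)
  have "smooth_on (-{0}) (\<lambda>x. lift f (?L x))"
    unfolding smooth_on_def
  proof
    fix k
    show "C_k_on k (-{0}) (\<lambda>x. lift f (?L x))"
      by (rule C_k_on_comp_linear[OF open_minus_0 linear_qmul])
         (use sf qmul_nonzero[OF y'] in \<open>simp_all add: smooth_on_def\<close>)
  qed
  then have sg: "smooth_on (-{0}) (lift ?g)"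
    by (rule smooth_on_cong[OF open_minus_0]) (simp add: lift_translate[OF y])
  have "laplacian_S3 (lift ?g) x = laplacian_S3 (lift f) (?L x)" if x: "norm x = 1" for x
  proof -
    have x0: "x \<noteq> 0" using x by auto
    have h: "hess (lift ?g) x (X_field j x) = hess (lift f) (?L x) (X_field j (?L x))" if j: "j < 3" for j
    proof -
      have "lift ?g (X_flow j t x) = lift f (X_flow j t (?L x))" for t
        using lift_translate[OF y X_flow_nonzero[OF j x0]] by (simp add: X_flow_qmul[OF j])
      then show ?thesis by (simp add: hess_def X_flow_def)
    qed
    have "tangent_frame z = [X_field 0 z, X_field (Suc 0) z, X_field 2 z]" for z
      by (cases z) (simp add: tangent_frame_def X_field_simps)
    then show ?thesis using h by (simp add: laplacian_S3_def)
  qed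
  moreover have "lift ?g x = lift f (?L x)" if "norm x = 1" for x
    by (rule lift_translate[OF y]) (use that in auto)
  moreover have "laplacian_S3 (lift f) (?L x) = ev * lift f (?L x)" if "norm x = 1" for x
    using f that norm_qmul[OF y'] by (simp add: is_eigenfunction_def)
  ultimately show ?thesis
    using sg by (simp add: is_eigenfunction_def smooth_dodec_def)
qed

definition eig_translate :: "complex \<times> complex \<Rightarrow> eigenspace168 \<Rightarrow> eigenspace168" where
  "eig_translate y F = Abs_eigenspace168 (translate (su2 y) (eig_fun F))"

lemma eig_fun_eig_translate: "norm y = 1 \<Longrightarrow> eig_fun (eig_translate y F) = translate (su2 y) (eig_fun F)"
  unfolding eig_translate_def
  by (rule Abs_eigenspace168_inverse) (use eig_fun[of F] is_eigenfunction_translate in auto)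

lemma eigl_eig_translate: "norm y = 1 \<Longrightarrow> x \<noteq> 0 \<Longrightarrow> eigl (eig_translate y F) x = eigl F (qmul (qcnj y) x)"
  by (simp add: eig_fun_eig_translate lift_translate)

lemma eig_fun_eq_eigl:
  obtains x where "norm x = 1" "p = coset (su2 x)" "\<And>f. f p = lift f x"
proof -
  obtain x where "norm x = 1" "p = coset (su2 x)" by (rule dodec_cases)
  then show ?thesis using that[of x] by (simp add: lift_def sgn_div_norm)
qed

lemma eigl_zeroI:
  assumes "\<And>w. norm w = 1 \<Longrightarrow> eigl F w = 0"
  shows "F = 0"
proof -
  have "eig_fun F p = 0" for p
    by (rule eig_fun_eq_eigl[of p]) (metis assms)
  then have "eig_fun F = eig_fun 0" by (simp add: fun_eq_iff zero_eigenspace168.rep_eq)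
  then show ?thesis by (simp add: eig_fun_inject)
qed

lemma eigl_add: "eigl (F + G) x = eigl F x + eigl G x"
  by (simp add: plus_eigenspace168.rep_eq lift_add)

lemma eigl_scaleR: "eigl (c *\<^sub>R F) x = c * eigl F x"
  by (simp add: scaleR_eigenspace168.rep_eq lift_scaleR)

lemma integrable_moment: "integrable vol_S3 (\<lambda>x. eigl F x * (x \<bullet> w) ^ d)"
  by (intro vol_S3_integrable_continuous continuous_intros eig_fun_continuous)

lemma moment_add: "moment d (F + G) w = moment d F w + moment d G w"
  unfolding moment_def
  using Bochner_Integration.integral_add[OF integrable_moment[of F] integrable_moment[of G]]
  by (simp add: eigl_add distrib_right)

lemma moment_scaleR: "moment d (c *\<^sub>R F) w = c * moment d F w"
  by (simp add: moment_def eigl_scaleR mult.assoc)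

text \<open>Polarisation of \<open>norm_qmul\<close>.\<close>

lemma inner_qmul:
  assumes "norm y = 1"
  shows "qmul y x \<bullet> qmul y z = x \<bullet> z"
proof -
  have n: "qmul y u \<bullet> qmul y u = u \<bullet> u" for u
    using norm_qmul[OF assms, of u] by (simp add: norm_eq_sqrt_inner)
  show ?thesis
    using n[of "x + z"] n[of x] n[of z]
    by (simp add: linear_add[OF linear_qmul] inner_add_left inner_add_right inner_commute)
qed

lemma moment_eig_translate:
  assumes y: "norm y = 1"
  shows "moment d (eig_translate y F) w = moment d F (qmul (qcnj y) w)"
proof -
  let ?L = "qmul (qcnj y)"
  have y': "norm (qcnj y) = 1" using y by (simp add: norm_qcnj)
  have c: "continuous_on (-{0}) (\<lambda>x. eigl F x * (x \<bullet> z) ^ d)" for F z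
    by (intro continuous_intros eig_fun_continuous)
  have cL: "continuous_on (-{0}) (\<lambda>x. eigl F (?L x) * (?L x \<bullet> ?L w) ^ d)"
  proof (rule continuous_on_compose2[OF c])
    show "continuous_on (-{0}) ?L"
      using linear_qmul by (simp add: linear_continuous_on linear_linear)
    show "?L ` (-{0}) \<subseteq> -{0}" by (intro image_subsetI) (simp add: qmul_nonzero[OF y'])
  qed
  have "moment d (eig_translate y F) w = integral\<^sup>L vol_S3 (\<lambda>x. eigl F (?L x) * (?L x \<bullet> ?L w) ^ d)"
    unfolding moment_def
  proof (rule integral_vol_S3_cong[OF c cL])
    fix x :: "complex \<times> complex" assume "norm x = 1"
    then have "x \<noteq> 0" by auto
    then show "eigl (eig_translate y F) x * (x \<bullet> w) ^ d = eigl F (?L x) * (?L x \<bullet> ?L w) ^ d"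
      by (simp add: eigl_eig_translate[OF y] inner_qmul[OF y'])
  qed
  also have "\<dots> = moment d F (?L w)"
    unfolding moment_def by (rule integral_vol_S3_qmul[OF c y'])
  finally show ?thesis .
qed

lemma inner_eig_translate:
  assumes y: "norm y = 1"
  shows "eig_translate y F \<bullet> eig_translate y G = F \<bullet> G"
proof -
  let ?L = "qmul (qcnj y)"
  have y': "norm (qcnj y) = 1" using y by (simp add: norm_qcnj)
  have c: "continuous_on (-{0}) (\<lambda>x. eigl F x * eigl G x)" for F G
    by (intro continuous_intros eig_fun_continuous)
  have cL: "continuous_on (-{0}) (\<lambda>x. eigl F (?L x) * eigl G (?L x))"
  proof (rule continuous_on_compose2[OF c])
    show "continuous_on (-{0}) ?L"
      using linear_qmul by (simp add: linear_continuous_on linear_linear)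
    show "?L ` (-{0}) \<subseteq> -{0}" by (intro image_subsetI) (simp add: qmul_nonzero[OF y'])
  qed
  have "integral\<^sup>L vol_S3 (\<lambda>x. eigl (eig_translate y F) x * eigl (eig_translate y G) x) =
      integral\<^sup>L vol_S3 (\<lambda>x. eigl F (?L x) * eigl G (?L x))"
  proof (rule integral_vol_S3_cong[OF c cL])
    fix x :: "complex \<times> complex" assume "norm x = 1"
    then have "x \<noteq> 0" by auto
    then show "eigl (eig_translate y F) x * eigl (eig_translate y G) x = eigl F (?L x) * eigl G (?L x)"
      by (simp add: eigl_eig_translate[OF y])
  qed
  also have "\<dots> = integral\<^sup>L vol_S3 (\<lambda>x. eigl F x * eigl G x)"
    by (rule integral_vol_S3_qmul[OF c y'])
  finally show ?thesis
    by (simp add: inner_eigenspace168_def integral_dodec_def lift_mult)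
qed

section \<open>The reproducing formula and its consequences\<close>

text \<open>At the point \<open>(1, 0)\<close> evaluation and the moment of order 12 are linear
  functionals of \<open>F\<close>, and the kernel of the second lies in that of the first by
  \<open>eigl_eq_0\<close>; so they are proportional. Translating \<open>(1, 0)\<close> to
  \<open>w\<close> changes both sides alike, which gives the same constant for all
  \<open>w\<close>.\<close>

lemma reproducing_formula:
  obtains c where "\<And>F w. norm w = 1 \<Longrightarrow> eigl F w = c * moment 12 F w"
proof -
  let ?e = "(1, 0) :: complex \<times> complex"
  have e: "norm ?e = 1" by (simp add: norm_Pair)
  have ratio: "eigl F ?e * moment 12 G ?e = eigl G ?e * moment 12 F ?e" for F G
  proof -
    \<comment> \<open>The combination of \<open>F\<close> and \<open>G\<close> whose moment of order
      12 at \<open>?e\<close> cancels.\<close>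
    define H where "H = moment 12 G ?e *\<^sub>R F + (- moment 12 F ?e) *\<^sub>R G"
    have "moment 12 H ?e = 0" by (simp add: H_def moment_add moment_scaleR del: scaleR_minus_left)
    then have "eigl H ?e = 0" by (rule eigl_eq_0[OF e])
    then show ?thesis by (simp add: H_def eigl_add eigl_scaleR mult.commute del: scaleR_minus_left)
  qed
  have "\<exists>c. \<forall>F. eigl F ?e = c * moment 12 F ?e"
  proof (cases "\<exists>G. moment 12 G ?e \<noteq> 0")
    case True
    then obtain G where "moment 12 G ?e \<noteq> 0" by blast
    then show ?thesis using ratio[of _ G] by (intro exI[of _ "eigl G ?e / moment 12 G ?e"]) (simp add: field_simps)
  next
    case False
    then show ?thesis using eigl_eq_0[OF e] by auto
  qed
  then obtain c where c: "\<And>F. eigl F ?e = c * moment 12 F ?e" by blast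
  have "eigl F w = c * moment 12 F w" if w: "norm w = 1" for F w
  proof -
    have w': "norm (qcnj w) = 1" using w by (simp add: norm_qcnj)
    have "?e \<noteq> 0" using e by force
    then show ?thesis
      using c[of "eig_translate (qcnj w) F"] by (simp add: eigl_eig_translate[OF w'] moment_eig_translate[OF w'] qcnj_qcnj qmul_one)
  qed
  with that show ?thesis by blast
qed

text \<open>Expanding (x.w)^d over all words of \<open>d\<close> basis vectors separates
  \<open>x\<close> from \<open>w\<close>: the moment is a combination of finitely many monomials in
  \<open>w\<close> that do not depend on \<open>F\<close>.\<close>

lemma moment_expand:
  "moment d F w = (\<Sum>i\<in>Pi\<^sub>E {..<d} (\<lambda>_. Basis).
     integral\<^sup>L vol_S3 (\<lambda>x. eigl F x * (\<Prod>k<d. x \<bullet> i k)) * (\<Prod>k<d. w \<bullet> i k))"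
proof -
  have "(x \<bullet> w) ^ d = (\<Sum>i\<in>Pi\<^sub>E {..<d} (\<lambda>_. Basis). (\<Prod>k<d. x \<bullet> i k) * (\<Prod>k<d. w \<bullet> i k))" for x
  proof -
    have "(x \<bullet> w) ^ d = (\<Prod>k<d. \<Sum>b\<in>Basis. (x \<bullet> b) * (w \<bullet> b))"
      by (simp add: euclidean_inner[of x w])
    also have "\<dots> = (\<Sum>i\<in>Pi\<^sub>E {..<d} (\<lambda>_. Basis). (\<Prod>k<d. (x \<bullet> i k) * (w \<bullet> i k)))"
      by (rule prod_sum_PiE) auto
    finally show ?thesis by (simp add: prod.distrib)
  qed
  then have "moment d F w = integral\<^sup>L vol_S3 (\<lambda>x. \<Sum>i\<in>Pi\<^sub>E {..<d} (\<lambda>_. Basis).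
      eigl F x * (\<Prod>k<d. x \<bullet> i k) * (\<Prod>k<d. w \<bullet> i k))"
    by (simp add: moment_def sum_distrib_left mult.assoc)
  also have "\<dots> = (\<Sum>i\<in>Pi\<^sub>E {..<d} (\<lambda>_. Basis).
     integral\<^sup>L vol_S3 (\<lambda>x. eigl F x * (\<Prod>k<d. x \<bullet> i k) * (\<Prod>k<d. w \<bullet> i k)))"
    by (rule Bochner_Integration.integral_sum)
       (intro vol_S3_integrable_continuous continuous_intros eig_fun_continuous)
  finally show ?thesis by simp
qed

lemma sum_fun_apply: "(\<Sum>i\<in>A. f i) x = (\<Sum>i\<in>A. f i x)"
  by (induction A rule: infinite_finite_induct) auto

text \<open>The moment of order 12 is an injective linear map from \<open>E\<close> into functions
  of \<open>w\<close>, with image in the span of the finite set of monomials of degree 12. A basis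
  of \<open>E\<close> is mapped to an independent set there, so it is finite.\<close>

lemma finite_dim_eigenspace168:
  obtains B :: "eigenspace168 set" where "finite B" "independent B" "span B = UNIV"
proof -
  obtain B :: "eigenspace168 set" where B: "independent B" "UNIV \<subseteq> span B"
    using basis_exists[of UNIV] by blast
  define T where "T F = (\<lambda>w. moment 12 F w)" for F
  define g where "g i = (\<lambda>w :: complex \<times> complex. \<Prod>k<12. w \<bullet> i k)" for i :: "nat \<Rightarrow> complex \<times> complex"
  define I where "I = Pi\<^sub>E {..<12::nat} (\<lambda>_. Basis :: (complex \<times> complex) set)"
  have fin: "finite (g ` I)" unfolding I_def by (intro finite_imageI finite_PiE) auto
  have lin: "linear T"
    by (rule linearI) (simp_all add: T_def moment_add moment_scaleR fun_eq_iff scaleR_fun_def)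
  have "T F = (\<Sum>i\<in>I. integral\<^sup>L vol_S3 (\<lambda>x. eigl F x * (\<Prod>k<12. x \<bullet> i k)) *\<^sub>R g i)" for F
    by (simp add: fun_eq_iff T_def g_def I_def moment_expand[of 12 F] scaleR_fun_def sum_fun_apply)
  then have "T F \<in> span (g ` I)" for F
    by (simp only:) (intro span_sum span_scale span_base imageI)
  then have sub: "T ` B \<subseteq> span (g ` I)" by auto
  have inj: "inj T"
  proof (subst linear_injective_0[OF lin], intro allI impI)
    fix F assume "T F = 0"
    then have "moment 12 F w = 0" for w unfolding T_def by (metis zero_fun_def)
    then show "F = 0" by (intro eigl_zeroI eigl_eq_0)
  qed
  have "independent (T ` B)"
    by (rule linear_independent_injective_image[OF lin B(1)]) (use inj in \<open>auto intro: inj_on_subset\<close>)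
  from independent_span_bound[OF fin this sub] have "finite (T ` B)" by blast
  then have "finite B" using inj by (meson finite_imageD inj_on_subset subset_UNIV)
  then show ?thesis using that[OF _ B(1)] B(2) by blast
qed

text \<open>Restriction to a line gives univariate real polynomials, for which the absence of zero
  divisors is at hand.\<close>

lemma moment_line_poly:
  obtains P :: "real poly" where "\<And>t. poly P t = moment d F (a + t *\<^sub>R b)"
proof -
  define c where "c k = of_nat (d choose k) * integral\<^sup>L vol_S3 (\<lambda>x. eigl F x * ((x \<bullet> b) ^ k * (x \<bullet> a) ^ (d - k)))" for k
  have "moment d F (a + t *\<^sub>R b) = (\<Sum>k\<le>d. c k * t ^ k)" for t
  proof -
    have "(x \<bullet> (a + t *\<^sub>R b)) ^ d = (\<Sum>k\<le>d. of_nat (d choose k) * (t * (x \<bullet> b)) ^ k * (x \<bullet> a) ^ (d - k))" for x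
      using binomial_ring[of "t * (x \<bullet> b)" "x \<bullet> a" d] by (simp add: inner_add_right add.commute)
    then have "moment d F (a + t *\<^sub>R b) = integral\<^sup>L vol_S3
       (\<lambda>x. \<Sum>k\<le>d. (of_nat (d choose k) * t ^ k) * (eigl F x * ((x \<bullet> b) ^ k * (x \<bullet> a) ^ (d - k))))"
      by (simp add: moment_def sum_distrib_left power_mult_distrib mult_ac)
    also have "\<dots> = (\<Sum>k\<le>d. integral\<^sup>L vol_S3
       (\<lambda>x. (of_nat (d choose k) * t ^ k) * (eigl F x * ((x \<bullet> b) ^ k * (x \<bullet> a) ^ (d - k)))))"
      by (rule Bochner_Integration.integral_sum)
         (intro vol_S3_integrable_continuous continuous_intros eig_fun_continuous)
    also have "\<dots> = (\<Sum>k\<le>d. (of_nat (d choose k) * t ^ k) * integral\<^sup>L vol_S3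
       (\<lambda>x. eigl F x * ((x \<bullet> b) ^ k * (x \<bullet> a) ^ (d - k))))"
      by (simp only: integral_mult_right_zero)
    also have "\<dots> = (\<Sum>k\<le>d. c k * t ^ k)" by (simp only: c_def mult_ac)
    finally show ?thesis .
  qed
  then have "poly (\<Sum>k\<le>d. monom (c k) k) t = moment d F (a + t *\<^sub>R b)" for t
    by (simp add: poly_sum poly_monom)
  with that show ?thesis by blast
qed

lemma moment_homogeneous: "moment d F (c *\<^sub>R w) = c ^ d * moment d F w"
proof -
  have "(\<lambda>x. eigl F x * (x \<bullet> (c *\<^sub>R w)) ^ d) = (\<lambda>x. c ^ d * (eigl F x * (x \<bullet> w) ^ d))"
    by (simp add: power_mult_distrib mult_ac fun_eq_iff)
  then show ?thesis by (simp add: moment_def)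
qed

text \<open>By the reproducing formula eigenfunctions are restrictions of homogeneous polynomials, which
  form a domain.\<close>

lemma eigl_mult_eq_0:
  assumes 0: "\<And>w. norm w = 1 \<Longrightarrow> eigl F w * eigl G w = 0"
  shows "F = 0 \<or> G = 0"
proof (rule ccontr)
  assume "\<not> (F = 0 \<or> G = 0)"
  then obtain a b where ab: "norm a = 1" "eigl F a \<noteq> 0" "norm b = 1" "eigl G b \<noteq> 0"
    using eigl_zeroI by metis
  obtain c where c: "\<And>F w. norm w = 1 \<Longrightarrow> eigl F w = c * moment 12 F w"
    by (rule reproducing_formula) blast
  \<comment> \<open>The line runs from \<open>a\<close> at t = 0, where the first factor is nonzero,
    to \<open>b\<close> at t = 1, where the second one is.\<close>
  obtain P where P: "\<And>t. poly P t = moment 12 F (a + t *\<^sub>R (b - a))" by (rule moment_line_poly) blast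
  obtain Q where Q: "\<And>t. poly Q t = moment 12 G (a + t *\<^sub>R (b - a))" by (rule moment_line_poly) blast
  have c0: "c \<noteq> 0" using c[OF ab(1), of F] ab(2) by auto
  \<comment> \<open>The line leaves the sphere and may pass through 0, so homogeneity is used to
    extend the vanishing of the product to all of R^4.\<close>
  have z: "moment 12 F z * moment 12 G z = 0" for z
  proof (cases "z = 0")
    case False
    then have n: "norm (sgn z) = 1" by (simp add: norm_sgn)
    have "moment 12 F (sgn z) * moment 12 G (sgn z) = 0"
      using 0[OF n] c0 by (simp add: c[OF n])
    moreover have "z = norm z *\<^sub>R sgn z" using False by (simp add: sgn_div_norm)
    ultimately show ?thesis
      using moment_homogeneous[of 12 F "norm z" "sgn z"] moment_homogeneous[of 12 G "norm z" "sgn z"] by auto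
  qed (use moment_homogeneous[of 12 F 0 0] in simp)
  have "poly (P * Q) t = 0" for t by (simp add: P Q z)
  then have "P * Q = 0" using poly_all_0_iff_0 by blast
  then have "P = 0 \<or> Q = 0" by simp
  moreover have "poly P 0 \<noteq> 0" using ab(2) c[OF ab(1)] by (simp add: P)
  moreover have "poly Q 1 \<noteq> 0" using ab(4) c[OF ab(3)] by (simp add: Q)
  ultimately show False by auto
qed

text \<open>A nowhere vanishing eigenfunction would have constant sign on the connected sphere,
  contradicting its mean zero. The zero later yields a vector of \<open>E\<close> orthogonal to
  \<open>F0\<close>.\<close>

lemma eigl_has_zero: obtains w where "norm w = 1" "eigl F w = 0"
proof (rule ccontr)
  assume "\<not> thesis"
  then have nz: "eigl F w \<noteq> 0" if "norm w = 1" for w using that \<open>\<And>w. norm w = 1 \<Longrightarrow> eigl F w = 0 \<Longrightarrow> thesis\<close> by blast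
  have c: "continuous_on (-{0}) (eigl F)" by (rule eig_fun_continuous)
  have I: "integral\<^sup>L vol_S3 (eigl F) = 0" using moment_zero_order[of F "(1,0)"] by (simp add: moment_def)
  let ?e = "(1, 0) :: complex \<times> complex"
  have e: "norm ?e = 1" by (simp add: norm_Pair)
  have con: "connected (eigl F ` sphere 0 1)"
  proof (rule connected_continuous_image)
    show "continuous_on (sphere 0 1) (eigl F)" by (rule continuous_on_subset[OF c]) auto
    show "connected (sphere (0 :: complex \<times> complex) 1)" by (simp add: connected_sphere_eq)
  qed
  have "(\<forall>w\<in>sphere 0 1. eigl F w \<ge> 0) \<or> (\<forall>w\<in>sphere 0 1. - eigl F w \<ge> 0)"
  proof (rule ccontr)
    assume "\<not> ?thesis"
    then obtain a b where "a \<in> sphere 0 1" "b \<in> sphere 0 1" "eigl F a < 0" "eigl F b > 0"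
      by (auto simp: not_le simp del: split_paired_All)
    then have "0 \<in> eigl F ` sphere 0 1"
      using con[unfolded connected_iff_interval, rule_format, of "eigl F a" "eigl F b" 0] by auto
    then show False using nz by auto
  qed
  then show False
  proof
    assume "\<forall>w\<in>sphere 0 1. eigl F w \<ge> 0"
    then have "eigl F ?e = 0" by (intro integral_vol_S3_eq_0[OF c _ I e]) simp
    with nz[OF e] show False by simp
  next
    assume n: "\<forall>w\<in>sphere 0 1. - eigl F w \<ge> 0"
    have "- eigl F ?e = 0"
      by (rule integral_vol_S3_eq_0[where h = "\<lambda>x. - eigl F x", OF _ _ _ e])
         (use n c I in \<open>auto intro!: continuous_intros\<close>)
    with nz[OF e] show False by simp
  qed
qed

section \<open>Finite-dimensional inner product spaces\<close>

text \<open>Riesz representation by Gram-Schmidt, as an induction on the spanning set. The form is a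
  parameter with hypotheses relative to \<open>span B\<close>, because the L^2 form on functions is
  additive and definite only on suitable subspaces such as \<open>product_space\<close>.\<close>

lemma riesz_form:
  fixes \<beta> :: "'a::real_vector \<Rightarrow> 'a \<Rightarrow> real"
  assumes "finite B"
    and "\<And>x y. x \<in> span B \<Longrightarrow> y \<in> span B \<Longrightarrow> \<beta> x y = \<beta> y x"
    and "\<And>x y z. x \<in> span B \<Longrightarrow> y \<in> span B \<Longrightarrow> z \<in> span B \<Longrightarrow> \<beta> x (y + z) = \<beta> x y + \<beta> x z"
    and "\<And>x y c. x \<in> span B \<Longrightarrow> y \<in> span B \<Longrightarrow> \<beta> x (c *\<^sub>R y) = c * \<beta> x y"
    and "\<And>x. x \<in> span B \<Longrightarrow> \<beta> x x = 0 \<Longrightarrow> x = 0"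
    and "\<And>x y. x \<in> span B \<Longrightarrow> y \<in> span B \<Longrightarrow> l (x + y) = l x + l y"
    and "\<And>x c. x \<in> span B \<Longrightarrow> l (c *\<^sub>R x) = c * l x"
  shows "\<exists>q\<in>span B. \<forall>h\<in>span B. l h = \<beta> q h"
  using assms
proof (induction B arbitrary: l rule: finite_induct)
  case empty
  have "l 0 = 0" "\<beta> 0 0 = 0" using empty(5)[of 0 0] empty(2)[of 0 0 0] by simp_all
  then show ?case by simp
next
  case (insert b B)
  note sym = insert.prems(1) and add = insert.prems(2) and scale = insert.prems(3)
    and pos = insert.prems(4) and ladd = insert.prems(5) and lscale = insert.prems(6)
  have sub: "x \<in> span (insert b B)" if "x \<in> span B" for x
    using that span_mono[of B "insert b B"] by blast
  have b: "b \<in> span (insert b B)" by (simp add: span_base)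
  note IH = insert.IH[OF sym add scale pos, OF sub sub sub sub sub sub sub sub]
  obtain b0 where b0: "b0 \<in> span B" "\<And>h. h \<in> span B \<Longrightarrow> \<beta> b h = \<beta> b0 h"
    using IH[of "\<beta> b"] add[OF b sub sub] scale[OF b sub] by blast
  obtain q0 where q0: "q0 \<in> span B" "\<And>h. h \<in> span B \<Longrightarrow> l h = \<beta> q0 h"
    using IH[of l] ladd[OF sub sub] lscale[OF sub] by blast
  \<comment> \<open>Since \<open>b0\<close> represents \<beta> b on \<open>span B\<close>, the
    difference is orthogonal to \<open>span B\<close>.\<close>
  define b' where "b' = b - b0"
  have b': "b' \<in> span (insert b B)" unfolding b'_def by (intro span_diff b sub b0)
  have ortho: "\<beta> h b' = 0" if h: "h \<in> span B" for h
  proof -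
    have "\<beta> h b' = \<beta> h b + \<beta> h (-1 *\<^sub>R b0)"
      unfolding b'_def using add[OF sub[OF h] b sub[OF span_scale[OF b0(1), of "-1"]]] by simp
    also have "\<dots> = \<beta> b h - \<beta> b0 h"
      using scale[OF sub[OF h] sub[OF b0(1)], of "-1"] sym[OF sub[OF h] b] sym[OF sub[OF h] sub[OF b0(1)]] by simp
    finally show ?thesis using b0(2)[OF h] by simp
  qed
  have decomp: "\<exists>k h. h \<in> span B \<and> x = h + k *\<^sub>R b'" if x: "x \<in> span (insert b B)" for x
  proof -
    obtain k where "x - k *\<^sub>R b \<in> span B" using x unfolding span_breakdown_eq by blast
    then have "x - k *\<^sub>R b + k *\<^sub>R b0 \<in> span B" by (intro span_add span_scale b0)
    moreover have "x = (x - k *\<^sub>R b + k *\<^sub>R b0) + k *\<^sub>R b'" by (simp add: b'_def algebra_simps)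
    ultimately show ?thesis by blast
  qed
  \<comment> \<open>The multiple of \<open>b'\<close> that corrects the value at \<open>b'\<close>;
    if \<open>b'\<close> is 0, then \<open>b\<close> already lies in \<open>span B\<close> and
    nothing is to be corrected.\<close>
  define s where "s = (if b' = 0 then 0 else l b' / \<beta> b' b')"
  define q where "q = q0 + s *\<^sub>R b'"
  have q: "q \<in> span (insert b B)" unfolding q_def by (intro span_add span_scale sub q0 b')
  have l0: "l 0 = 0" using lscale[OF b, of 0] by simp
  have sb: "s * \<beta> b' b' = l b'"
    using pos[OF b'] by (auto simp: s_def l0)
  have "l x = \<beta> q x" if x: "x \<in> span (insert b B)" for x
  proof -
    obtain k h where h: "h \<in> span B" and x_eq: "x = h + k *\<^sub>R b'" using decomp[OF x] by blast
    have kb: "k *\<^sub>R b' \<in> span (insert b B)" by (intro span_scale b')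
    have 1: "\<beta> q y = \<beta> q0 y + s * \<beta> b' y" if y: "y \<in> span (insert b B)" for y
    proof -
      have "\<beta> q y = \<beta> y q" by (rule sym[OF q y])
      also have "\<dots> = \<beta> y q0 + s * \<beta> y b'"
        unfolding q_def using add[OF y sub[OF q0(1)] span_scale[OF b']] scale[OF y b'] by simp
      finally show ?thesis using sym[OF y sub[OF q0(1)]] sym[OF y b'] by simp
    qed
    have "\<beta> q x = \<beta> q h + k * \<beta> q b'"
      unfolding x_eq using add[OF q sub[OF h] kb] scale[OF q b'] by simp
    also have "\<beta> q h = l h" using 1[OF sub[OF h]] ortho[OF h] sym[OF b' sub[OF h]] q0(2)[OF h] by simp
    also have "\<beta> q b' = l b'" using 1[OF b'] ortho[OF q0(1)] sb by simp
    also have "l h + k * l b' = l x"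
      unfolding x_eq using ladd[OF sub[OF h] kb] lscale[OF b'] by simp
    finally show ?thesis ..
  qed
  with q show ?case by blast
qed

lemma blinfun_eqI_inner:
  assumes "\<And>x y. blinfun_apply S x \<bullet> y = blinfun_apply T x \<bullet> y"
  shows "S = T"
proof (rule blinfun_eqI)
  fix x
  have "(blinfun_apply S x - blinfun_apply T x) \<bullet> y = 0" for y
    using assms by (simp add: inner_diff_left)
  then show "blinfun_apply S x = blinfun_apply T x"
    using inner_eq_zero_iff by (metis right_minus_eq)
qed

text \<open>An orthonormal basis as a parameter, since finite dimension of
  \<open>eigenspace168\<close> is a theorem about a \<open>real_inner\<close> type and not part of
  its class.\<close>

locale finite_dim =
  fixes C :: "'a::real_inner set"
  assumes finite_C: "finite C" and unit_C: "\<And>c. c \<in> C \<Longrightarrow> norm c = 1"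
    and orth_C: "pairwise orthogonal C" and span_C: "span C = UNIV"

lemma finite_dim_ex:
  fixes B :: "'a::real_inner set"
  assumes "finite B" "span B = UNIV"
  obtains C :: "'a set" where "finite_dim C"
proof -
  obtain C where C: "finite C" "span C = span B" "pairwise orthogonal C"
    using basis_orthogonal[OF assms(1)] by blast
  define C' where "C' = sgn ` (C - {0})"
  have "x \<in> span C'" if "x \<in> C" for x
  proof (cases "x = 0")
    case False
    then have "sgn x \<in> span C'" using that by (auto simp: C'_def intro: span_base)
    then have "norm x *\<^sub>R sgn x \<in> span C'" by (rule span_scale)
    then show ?thesis using False by (simp add: sgn_div_norm)
  qed (simp add: span_zero)
  then have "span C \<subseteq> span C'" by (intro span_minimal subspace_span) auto
  then have "span C' = UNIV" using C(2) assms(2) by auto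
  moreover have "pairwise orthogonal C'"
  proof (rule pairwiseI)
    fix x y assume "x \<in> C'" "y \<in> C'" "x \<noteq> y"
    then obtain u v where "u \<in> C" "v \<in> C" "u \<noteq> v" "x = sgn u" "y = sgn v" by (auto simp: C'_def)
    then show "orthogonal x y"
      using C(3) by (auto simp: pairwise_def orthogonal_def sgn_div_norm)
  qed
  ultimately have "finite_dim C'"
    by unfold_locales (use C(1) in \<open>auto simp: C'_def norm_sgn split: if_splits\<close>)
  then show ?thesis using that by blast
qed

context finite_dim
begin

lemma expansion: "x = (\<Sum>c\<in>C. (x \<bullet> c) *\<^sub>R c)"
proof -
  have eq: "c \<bullet> c' = (if c = c' then 1 else 0)" if "c \<in> C" "c' \<in> C" for c c'
    using that orth_C unit_C by (auto simp: pairwise_def orthogonal_def norm_eq_1)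
  have "x \<in> span C" by (simp add: span_C)
  then show ?thesis
  proof (induction rule: span_induct_alt)
    case (step a b y)
    have "(\<Sum>c\<in>C. ((a *\<^sub>R b + y) \<bullet> c) *\<^sub>R c) =
        a *\<^sub>R (\<Sum>c\<in>C. (b \<bullet> c) *\<^sub>R c) + (\<Sum>c\<in>C. (y \<bullet> c) *\<^sub>R c)"
      by (simp add: inner_add_left scaleR_add_left sum.distrib scaleR_sum_right)
    also have "(\<Sum>c\<in>C. (b \<bullet> c) *\<^sub>R c) = (\<Sum>c\<in>C. if b = c then c else 0)"
      by (rule sum.cong) (use eq step(1) in auto)
    also have "\<dots> = b" using step(1) finite_C by simp
    finally show ?case using step by simp
  qed simp
qed

lemma linear_bounded_linear:
  fixes f :: "'a \<Rightarrow> 'b::real_normed_vector"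
  assumes "linear f"
  shows "bounded_linear f"
proof -
  have "f = (\<lambda>x. \<Sum>c\<in>C. (x \<bullet> c) *\<^sub>R f c)"
  proof
    fix x
    have "f x = f (\<Sum>c\<in>C. (x \<bullet> c) *\<^sub>R c)" using expansion[of x] by simp
    then show "f x = (\<Sum>c\<in>C. (x \<bullet> c) *\<^sub>R f c)" by (simp add: linear_sum[OF assms] linear_cmul[OF assms])
  qed
  moreover have "bounded_linear (\<lambda>x. \<Sum>c\<in>C. (x \<bullet> c) *\<^sub>R f c)"
    by (intro bounded_linear_sum bounded_linear_compose[OF bounded_linear_scaleR_left bounded_linear_inner_left])
  ultimately show ?thesis by simp
qed

lemma riesz_functional:
  fixes l :: "'a \<Rightarrow> real"
  assumes "linear l"
  obtains k where "\<And>x. l x = x \<bullet> k"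
proof -
  have "l x = x \<bullet> (\<Sum>c\<in>C. l c *\<^sub>R c)" for x
  proof -
    have "l x = l (\<Sum>c\<in>C. (x \<bullet> c) *\<^sub>R c)" using expansion[of x] by simp
    then show ?thesis
      by (simp add: linear_sum[OF assms] linear_cmul[OF assms] inner_sum_right mult.commute)
  qed
  then show ?thesis using that by blast
qed

lemma bilinear_operator:
  fixes b :: "'a \<Rightarrow> 'a \<Rightarrow> real"
  assumes l1: "\<And>y. linear (\<lambda>x. b x y)" and l2: "\<And>x. linear (b x)"
  shows "\<exists>!T. \<forall>x y. blinfun_apply T x \<bullet> y = b x y"
proof -
  define f where "f x = (\<Sum>c\<in>C. b x c *\<^sub>R c)" for x
  have "linear f"
    unfolding f_def
    by (rule linearI)
       (simp_all add: linear_add[OF l1] linear_cmul[OF l1] scaleR_add_left sum.distrib scaleR_sum_right)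
  then have ap: "blinfun_apply (Blinfun f) = f"
    by (intro bounded_linear_Blinfun_apply linear_bounded_linear)
  have "f x \<bullet> y = b x y" for x y
  proof -
    have "b x y = b x (\<Sum>c\<in>C. (y \<bullet> c) *\<^sub>R c)" using expansion[of y] by simp
    then show ?thesis
      by (simp add: linear_sum[OF l2] linear_cmul[OF l2] f_def inner_sum_left inner_sum_right inner_commute mult.commute)
  qed
  then have ex: "\<forall>x y. blinfun_apply (Blinfun f) x \<bullet> y = b x y" by (simp add: ap)
  moreover have "T = Blinfun f" if "\<forall>x y. blinfun_apply T x \<bullet> y = b x y" for T
    by (rule blinfun_eqI_inner) (simp add: that ex)
  ultimately show ?thesis by blast
qed

text \<open>The cube of coordinate functions with values in [-1, 1] is compact by Tychonoff, and
  summation against \<open>C\<close> maps it continuously onto a compact set in which the sphere is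
  closed.\<close>

lemma compact_sphere: "compact (sphere (0::'a) 1)"
proof -
  define K :: "('a \<Rightarrow> real) set" where "K = Pi\<^sub>E UNIV (\<lambda>_. {-1..1})"
  define \<phi> where "\<phi> g = (\<Sum>c\<in>C. g c *\<^sub>R c)" for g :: "'a \<Rightarrow> real"
  have "compactin (product_topology (\<lambda>i::'a. euclidean :: real topology) UNIV) K"
    unfolding K_def by (subst compactin_PiE) auto
  then have "compact K" by (simp add: euclidean_product_topology)
  moreover have "continuous_on K \<phi>"
    unfolding \<phi>_def
    by (intro continuous_on_sum continuous_on_scaleR continuous_on_const
        continuous_on_subset[OF continuous_on_product_coordinates]) auto
  ultimately have "compact (\<phi> ` K)" by (rule compact_continuous_image[rotated])
  moreover have "sphere 0 1 \<subseteq> \<phi> ` K"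
  proof
    fix x :: 'a assume x: "x \<in> sphere 0 1"
    have "\<bar>x \<bullet> c\<bar> \<le> 1" if "c \<in> C" for c
      using Cauchy_Schwarz_ineq2[of x c] x unit_C[OF that] by simp
    then have "(\<lambda>c. if c \<in> C then x \<bullet> c else 0) \<in> K" by (auto simp: K_def PiE_def abs_le_iff)
    moreover have "\<phi> (\<lambda>c. if c \<in> C then x \<bullet> c else 0) = x"
      using expansion[of x] by (simp add: \<phi>_def)
    ultimately show "x \<in> \<phi> ` K" by (metis image_eqI)
  qed
  ultimately have "\<phi> ` K \<inter> sphere 0 1 = sphere 0 1" "compact (\<phi> ` K \<inter> sphere 0 1)"
    unfolding sphere_def
    by (blast, intro compact_Int_closed closed_Collect_eq continuous_intros)
  then show ?thesis by simp
qed

lemma finite_independent: "independent V \<Longrightarrow> finite V" for V :: "'a set"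
  using independent_span_bound[OF finite_C] span_C by auto

lemma dim_pos:
  fixes V :: "'a set"
  assumes "x \<in> V" "x \<noteq> 0"
  shows "dim V > 0"
proof -
  obtain b where b: "b \<subseteq> V" "independent b" "V \<subseteq> span b" "card b = dim V"
    using basis_exists[of V] by blast
  have "b \<noteq> {}" using b(3) assms by auto
  then show ?thesis using b(4) finite_independent[OF b(2)] by (metis card_gt_0_iff)
qed

end

section \<open>The lowest eigenvalue of a symmetric operator\<close>

definition symmetric_op :: "('a::real_inner \<Rightarrow>\<^sub>L 'a) \<Rightarrow> bool" where
  "symmetric_op A \<longleftrightarrow> (\<forall>x y. blinfun_apply A x \<bullet> y = x \<bullet> blinfun_apply A y)"

context finite_dim
begin

text \<open>The quadratic form attains its minimum \<mu> on the unit sphere at some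
  \<open>x\<close>. Then R = A - \<mu> is positive semidefinite with R x . x = 0, and this forces R
  x = 0.\<close>

lemma rayleigh_minimum:
  fixes A :: "'a \<Rightarrow>\<^sub>L 'a"
  assumes A: "symmetric_op A" and e: "norm (e :: 'a) = 1"
  obtains \<mu> x where "x \<noteq> 0" "blinfun_apply A x = \<mu> *\<^sub>R x" "\<And>y. \<mu> * (y \<bullet> y) \<le> blinfun_apply A y \<bullet> y"
proof -
  have "continuous_on (sphere 0 1) (\<lambda>x. blinfun_apply A x \<bullet> x)"
    by (intro continuous_intros)
  moreover have "sphere (0::'a) 1 \<noteq> {}" using e by auto
  ultimately obtain x where x: "norm x = 1" "\<And>y. norm y = 1 \<Longrightarrow> blinfun_apply A x \<bullet> x \<le> blinfun_apply A y \<bullet> y"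
    using continuous_attains_inf[OF compact_sphere] by fastforce
  define \<mu> where "\<mu> = blinfun_apply A x \<bullet> x"
  have min: "\<mu> * (y \<bullet> y) \<le> blinfun_apply A y \<bullet> y" for y
  proof (cases "y = 0")
    case False
    then have "\<mu> \<le> blinfun_apply A (sgn y) \<bullet> sgn y" unfolding \<mu>_def by (intro x(2)) (simp add: norm_sgn)
    also have "\<dots> = (blinfun_apply A y \<bullet> y) / (y \<bullet> y)"
      by (simp add: sgn_div_norm blinfun.scaleR_right power2_eq_square[symmetric] power2_norm_eq_inner
          divide_inverse flip: power_inverse) (simp add: power2_norm_eq_inner[symmetric] power2_eq_square)
    finally show ?thesis using False by (simp add: pos_le_divide_eq)
  qed simp
  define R where "R z = blinfun_apply A z - \<mu> *\<^sub>R z" for z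
  have Rlin: "R (u + t *\<^sub>R v) = R u + t *\<^sub>R R v" for u v t
    by (simp add: R_def blinfun.add_right blinfun.scaleR_right algebra_simps)
  have Rsym: "R u \<bullet> v = u \<bullet> R v" for u v
    using A by (simp add: symmetric_op_def R_def inner_diff_left inner_diff_right)
  have Rpos: "0 \<le> R u \<bullet> u" for u using min[of u] by (simp add: R_def inner_diff_left)
  have Rx: "R x \<bullet> x = 0" using x(1) by (simp add: R_def inner_diff_left \<mu>_def norm_eq_1)
  have "R x = 0"
  proof (rule ccontr)
    assume "R x \<noteq> 0"
    then have p: "R x \<bullet> R x > 0" by simp
    define m where "m = R (R x) \<bullet> R x"
    have m: "0 \<le> m" unfolding m_def by (rule Rpos)
    \<comment> \<open>A small step from \<open>x\<close> against R x: the form changes by 2 t |R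
      x|^2 + t^2 m, which is at most t |R x|^2 < 0. Using m + 1 avoids division by zero.\<close>
    define t where "t = - (R x \<bullet> R x) / (m + 1)"
    have "0 \<le> R (x + t *\<^sub>R R x) \<bullet> (x + t *\<^sub>R R x)" by (rule Rpos)
    also have "\<dots> = 2 * t * (R x \<bullet> R x) + t\<^sup>2 * m"
      using Rx Rsym[of "R x" x] by (simp add: Rlin inner_add_left inner_add_right m_def power2_eq_square algebra_simps)
    also have "t\<^sup>2 * m \<le> t\<^sup>2 * (m + 1)" by (intro mult_left_mono) auto
    also have "t\<^sup>2 * (m + 1) = - t * (R x \<bullet> R x)"
      using m by (simp add: t_def power2_eq_square)
    finally have "0 \<le> t * (R x \<bullet> R x)" by simp
    moreover have "t < 0" using p m by (simp add: t_def divide_neg_pos)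
    ultimately show False using p by (simp add: zero_le_mult_iff)
  qed
  then have "blinfun_apply A x = \<mu> *\<^sub>R x" by (simp add: R_def)
  moreover have "x \<noteq> 0" using x(1) by auto
  ultimately show ?thesis using that min by blast
qed

lemma eigenspace_nontrivial: "eigenspace A \<mu> \<noteq> {0} \<longleftrightarrow> (\<exists>x. x \<noteq> 0 \<and> blinfun_apply A x = \<mu> *\<^sub>R x)"
  for A :: "'a \<Rightarrow>\<^sub>L 'a"
  by (auto simp: eigenspace_def blinfun.zero_right)

text \<open>Eigenvectors for different eigenvalues are orthogonal, hence independent. Without
  finiteness the sum defining \<open>eigenvalues\<close> would default to the empty
  multiset.\<close>

lemma finite_eigenvalues:
  fixes A :: "'a \<Rightarrow>\<^sub>L 'a"
  assumes A: "symmetric_op A"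
  shows "finite {\<mu>. eigenspace A \<mu> \<noteq> {0}}" (is "finite ?S")
proof -
  define v where "v \<mu> = (SOME x. x \<noteq> 0 \<and> blinfun_apply A x = \<mu> *\<^sub>R x)" for \<mu>
  have v: "v \<mu> \<noteq> 0" "blinfun_apply A (v \<mu>) = \<mu> *\<^sub>R v \<mu>" if "\<mu> \<in> ?S" for \<mu>
    using someI_ex[of "\<lambda>x. x \<noteq> 0 \<and> blinfun_apply A x = \<mu> *\<^sub>R x"] that
    unfolding v_def mem_Collect_eq eigenspace_nontrivial by blast+
  have inj: "inj_on v ?S"
  proof (rule inj_onI)
    fix \<mu> \<nu> assume m: "\<mu> \<in> ?S" "\<nu> \<in> ?S" "v \<mu> = v \<nu>"
    then have "\<mu> *\<^sub>R v \<mu> = \<nu> *\<^sub>R v \<mu>" using v(2) by metis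
    then show "\<mu> = \<nu>" using v(1)[OF m(1)] by simp
  qed
  have "pairwise orthogonal (v ` ?S)"
  proof (rule pairwiseI)
    fix x y assume "x \<in> v ` ?S" "y \<in> v ` ?S" "x \<noteq> y"
    then obtain \<mu> \<nu> where m: "\<mu> \<in> ?S" "\<nu> \<in> ?S" "x = v \<mu>" "y = v \<nu>" "\<mu> \<noteq> \<nu>" by blast
    have "blinfun_apply A x \<bullet> y = x \<bullet> blinfun_apply A y" using A by (simp add: symmetric_op_def)
    then have "(\<mu> - \<nu>) * (x \<bullet> y) = 0" using v(2)[OF m(1)] v(2)[OF m(2)] m(3,4) by (simp add: algebra_simps)
    then show "orthogonal x y" using m(5) by (simp add: orthogonal_def)
  qed
  moreover have "0 \<notin> v ` ?S"
  proof
    assume "0 \<in> v ` ?S"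
    then obtain \<mu> where "0 = v \<mu>" "\<mu> \<in> ?S" by (rule imageE)
    then show False using v(1)[of \<mu>] by simp
  qed
  ultimately have "finite (v ` ?S)" by (intro finite_independent pairwise_orthogonal_independent)
  then show ?thesis using inj by (rule finite_imageD)
qed

text \<open>An eigenvalue is listed only if its eigenspace has positive \<open>dim\<close>, which
  finite dimension guarantees.\<close>

lemma set_eigenvalues:
  fixes A :: "'a \<Rightarrow>\<^sub>L 'a"
  assumes A: "symmetric_op A"
  shows "set (eigenvalues A) = {\<mu>. eigenspace A \<mu> \<noteq> {0}}"
proof -
  have d: "dim (eigenspace A \<mu>) > 0" if "eigenspace A \<mu> \<noteq> {0}" for \<mu>
    using that unfolding eigenspace_nontrivial by (auto intro!: dim_pos simp: eigenspace_def)
  show ?thesis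
    unfolding eigenvalues_def set_sorted_list_of_multiset set_mset_sum[OF finite_eigenvalues[OF A]]
    using d by (fastforce split: if_splits)
qed

lemma eigval_1_eq:
  fixes A :: "'a \<Rightarrow>\<^sub>L 'a"
  assumes A: "symmetric_op A" and x: "x \<noteq> 0" "blinfun_apply A x = \<mu> *\<^sub>R x"
    and min: "\<And>y. \<mu> * (y \<bullet> y) \<le> blinfun_apply A y \<bullet> y"
  shows "eigval 1 A = \<mu>"
proof -
  have mem: "\<mu> \<in> set (eigenvalues A)"
    unfolding set_eigenvalues[OF A] using x eigenspace_nontrivial by blast
  have le: "\<mu> \<le> \<nu>" if \<nu>: "\<nu> \<in> set (eigenvalues A)" for \<nu>
  proof -
    obtain y where y: "y \<noteq> 0" "blinfun_apply A y = \<nu> *\<^sub>R y"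
      using \<nu> unfolding set_eigenvalues[OF A] using eigenspace_nontrivial by blast
    have "\<mu> * (y \<bullet> y) \<le> \<nu> * (y \<bullet> y)" using min[of y] y(2) by simp
    then show ?thesis using y(1) by (simp add: mult_le_cancel_right)
  qed
  have sorted: "sorted (eigenvalues A)" by (simp add: eigenvalues_def)
  have len: "0 < length (eigenvalues A)" using mem by (cases "eigenvalues A") auto
  obtain i where "i < length (eigenvalues A)" "eigenvalues A ! i = \<mu>"
    using mem by (auto simp: in_set_conv_nth)
  then have "eigenvalues A ! 0 \<le> \<mu>" using sorted_nth_mono[OF sorted, of 0 i] by simp
  moreover have "\<mu> \<le> eigenvalues A ! 0" by (rule le) (use len in simp)
  ultimately show ?thesis by (simp add: eigval_def)
qed

end

section \<open>Perturbation of an operator of rank one\<close>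

definition proj_compl :: "'a::real_inner \<Rightarrow> 'a \<Rightarrow> 'a" where
  "proj_compl F x = x - ((x \<bullet> F) / (F \<bullet> F)) *\<^sub>R F"

lemma proj_compl_linear: "linear (proj_compl F)"
  by (rule linearI)
     (simp_all add: proj_compl_def inner_add_left add_divide_distrib scaleR_add_left algebra_simps)

lemma proj_compl_orthogonal: "F \<noteq> 0 \<Longrightarrow> proj_compl F x \<bullet> F = 0"
  by (simp add: proj_compl_def inner_diff_left)

lemma proj_compl_self: "F \<noteq> 0 \<Longrightarrow> proj_compl F F = 0"
  by (simp add: proj_compl_def)

lemma proj_compl_id: "x \<bullet> F = 0 \<Longrightarrow> proj_compl F x = x"
  by (simp add: proj_compl_def)

lemma proj_compl_inner: "z \<bullet> F = 0 \<Longrightarrow> proj_compl F x \<bullet> z = x \<bullet> z"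
  by (simp add: proj_compl_def inner_diff_left inner_commute[of F z])

lemma norm_proj_compl: "norm (proj_compl F x) \<le> norm x"
proof (cases "F = 0")
  case False
  have "proj_compl F x \<bullet> proj_compl F x = proj_compl F x \<bullet> x"
    using proj_compl_inner[OF proj_compl_orthogonal[OF False], of x x] by (simp add: inner_commute)
  then have "norm (proj_compl F x) * norm (proj_compl F x) \<le> norm (proj_compl F x) * norm x"
    using norm_cauchy_schwarz[of "proj_compl F x" x] by (simp add: power2_norm_eq_inner[symmetric] power2_eq_square)
  then show ?thesis by (cases "proj_compl F x = 0") (auto simp: mult_le_cancel_left)
qed (simp add: proj_compl_def)

locale rank_one = finite_dim C for C :: "'a::real_inner set" +
  fixes A0 :: "'a \<Rightarrow>\<^sub>L 'a" and F :: 'a and a :: real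
  assumes F: "F \<noteq> 0" and a: "a > 0" and A0: "\<And>x. blinfun_apply A0 x = - (a * (x \<bullet> F)) *\<^sub>R F"
begin

text \<open>The lowest eigenvalue of \<open>A0\<close> is \<open>- c\<close>, and 0 is the only
  other possible one; so \<open>c\<close> is the spectral gap against which perturbations are
  measured.\<close>

definition "c = a * (F \<bullet> F)"

lemma c_pos: "c > 0"
  using a F by (simp add: c_def)

lemma symmetric_A0: "symmetric_op A0"
  by (simp add: symmetric_op_def A0 inner_commute)

lemma A0_F: "blinfun_apply A0 F = - c *\<^sub>R F"
  by (simp add: A0 c_def)

lemma A0_lower: "- c * (y \<bullet> y) \<le> blinfun_apply A0 y \<bullet> y"
proof -
  have "(y \<bullet> F)\<^sup>2 \<le> (y \<bullet> y) * (F \<bullet> F)" by (rule Cauchy_Schwarz_ineq)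
  then have "a * (y \<bullet> F)\<^sup>2 \<le> a * ((y \<bullet> y) * (F \<bullet> F))" using a by (intro mult_left_mono) auto
  moreover have "blinfun_apply A0 y \<bullet> y = - (a * (y \<bullet> F)\<^sup>2)"
    by (simp add: A0 power2_eq_square inner_commute[of F y])
  ultimately show ?thesis by (simp add: c_def mult.assoc mult.commute[of "y \<bullet> y"])
qed

lemma eigval_1_A0: "eigval 1 A0 = - c"
  by (rule eigval_1_eq[OF symmetric_A0 F A0_F A0_lower])

lemma lowest_line_A0: "lowest_line A0 = span {F}"
proof -
  have "x \<in> span {F}" if "blinfun_apply A0 x = - c *\<^sub>R x" for x
  proof -
    have "c *\<^sub>R x = (a * (x \<bullet> F)) *\<^sub>R F" using that by (simp add: A0)
    then have "(1 / c) *\<^sub>R (c *\<^sub>R x) = (1 / c) *\<^sub>R ((a * (x \<bullet> F)) *\<^sub>R F)" by simp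
    then have "x = (a * (x \<bullet> F) / c) *\<^sub>R F" using c_pos by simp
    then show ?thesis by (metis span_scale span_base singletonI)
  qed
  moreover have "blinfun_apply A0 x = - c *\<^sub>R x" if "x \<in> span {F}" for x
  proof -
    obtain k where "x = k *\<^sub>R F" using \<open>x \<in> span {F}\<close> by (auto simp: span_singleton)
    then show ?thesis using A0_F by (simp add: blinfun.scaleR_right)
  qed
  ultimately show ?thesis
    unfolding lowest_line_def eigval_1_A0 eigenspace_def by auto
qed

text \<open>The vector \<open>G\<close> shows that 0 is an eigenvalue. As \<open>- c\<close> has
  multiplicity one, the sorted list is \<open>- c\<close> followed by zeros.\<close>

lemma eigval_2_A0:
  assumes G: "G \<noteq> 0" "G \<bullet> F = 0"
  shows "eigval 2 A0 = 0"
proof -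
  have ev: "\<mu> = - c \<or> \<mu> = 0" if \<mu>: "eigenspace A0 \<mu> \<noteq> {0}" for \<mu>
  proof (rule ccontr)
    assume n: "\<not> (\<mu> = - c \<or> \<mu> = 0)"
    obtain x where x: "x \<noteq> 0" "blinfun_apply A0 x = \<mu> *\<^sub>R x"
      using \<mu> unfolding eigenspace_nontrivial by blast
    have "blinfun_apply A0 x \<bullet> F = \<mu> * (x \<bullet> F)" by (simp add: x(2))
    then have "(\<mu> + c) * (x \<bullet> F) = 0" by (simp add: A0 c_def algebra_simps)
    then have "x \<bullet> F = 0" using n by (simp add: add_eq_0_iff)
    then have "\<mu> *\<^sub>R x = 0" using x(2) by (simp add: A0)
    then show False using x(1) n by simp
  qed
  have "eigenspace A0 0 \<noteq> {0}"
    unfolding eigenspace_nontrivial using G by (intro exI[of _ G]) (simp add: A0)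
  moreover have "eigenspace A0 (- c) \<noteq> {0}"
    unfolding eigenspace_nontrivial using F A0_F by blast
  ultimately have S: "{\<mu>. eigenspace A0 \<mu> \<noteq> {0}} = {- c, 0}" using ev by blast
  have d: "dim (eigenspace A0 0) > 0"
    by (rule dim_pos[OF _ G(1)]) (use G in \<open>simp add: eigenspace_def A0\<close>)
  have "eigenspace A0 (- c) = span {F}"
    using lowest_line_A0 unfolding lowest_line_def eigval_1_A0 .
  then have d1: "dim (eigenspace A0 (- c)) = 1"
    using F dim_span_eq_card_independent[of "{F}"] by simp
  have "eigenvalues A0 = sorted_list_of_multiset (mset (- c # replicate (dim (eigenspace A0 0)) 0))"
    unfolding eigenvalues_def S using c_pos d1 by simp
  also have "\<dots> = - c # replicate (dim (eigenspace A0 0)) 0"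
    unfolding sorted_list_of_multiset_mset
    by (rule sorted_sort_id) (use c_pos in simp)
  finally show ?thesis using d by (simp add: eigval_def)
qed

text \<open>With y = F + v the lowest eigenvector and H = A - A0, the part of the eigenvalue
  equation orthogonal to \<open>F\<close> is \<mu> v = P(H F) + P(H v). Here \<mu> = -c + O(|H|) and
  v = O(|H|), so v is -(1/c) P(H F) up to a quadratic error.\<close>

lemma perturbation:
  fixes A :: "'a \<Rightarrow>\<^sub>L 'a"
  assumes A: "symmetric_op A" and small: "norm (A - A0) \<le> c / 4"
  shows "norm (line_chart F (lowest_line A) + (1 / c) *\<^sub>R proj_compl F (blinfun_apply (A - A0) F))
     \<le> 10 * norm F / c\<^sup>2 * (norm (A - A0))\<^sup>2"
proof -
  define H where "H = A - A0"
  define \<epsilon> where "\<epsilon> = norm H"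
  have e: "0 \<le> \<epsilon>" "\<epsilon> \<le> c / 4" using small by (simp_all add: \<epsilon>_def H_def)
  have AH: "blinfun_apply A x = blinfun_apply A0 x + blinfun_apply H x" for x
    by (simp add: H_def blinfun.diff_left)
  have Hn: "norm (blinfun_apply H x) \<le> \<epsilon> * norm x" for x unfolding \<epsilon>_def by (rule norm_blinfun)
  have Hq: "\<bar>blinfun_apply H x \<bullet> x\<bar> \<le> \<epsilon> * (x \<bullet> x)" for x
  proof -
    have "\<bar>blinfun_apply H x \<bullet> x\<bar> \<le> norm (blinfun_apply H x) * norm x" by (rule Cauchy_Schwarz_ineq2)
    also have "\<dots> \<le> (\<epsilon> * norm x) * norm x" by (intro mult_right_mono Hn) auto
    also have "\<dots> = \<epsilon> * (x \<bullet> x)" by (simp add: power2_norm_eq_inner[symmetric] power2_eq_square)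
    finally show ?thesis .
  qed
  have "norm (sgn F) = 1" using F by (simp add: norm_sgn)
  then obtain \<mu> x where x: "x \<noteq> 0" "blinfun_apply A x = \<mu> *\<^sub>R x"
    and min: "\<And>y. \<mu> * (y \<bullet> y) \<le> blinfun_apply A y \<bullet> y"
    using rayleigh_minimum[OF A] by metis
  have ll: "lowest_line A = {y. blinfun_apply A y = \<mu> *\<^sub>R y}"
    unfolding lowest_line_def eigenspace_def eigval_1_eq[OF A x min] ..
  have FF: "F \<bullet> F > 0" using F by simp
  have mu_up: "\<mu> \<le> - c + \<epsilon>"
  proof -
    have "\<mu> * (F \<bullet> F) \<le> blinfun_apply A F \<bullet> F" by (rule min)
    also have "\<dots> = - c * (F \<bullet> F) + blinfun_apply H F \<bullet> F"
      by (simp only: AH A0_F inner_add_left inner_scaleR_left)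
    also have "\<dots> \<le> (- c + \<epsilon>) * (F \<bullet> F)" using Hq[of F] by (simp add: algebra_simps)
    finally show ?thesis using FF by (simp add: mult_le_cancel_right)
  qed
  have mu_low: "- c - \<epsilon> \<le> \<mu>"
  proof -
    have "(- c - \<epsilon>) * (x \<bullet> x) \<le> blinfun_apply A0 x \<bullet> x + blinfun_apply H x \<bullet> x"
      using A0_lower[of x] Hq[of x] by (simp add: algebra_simps)
    also have "\<dots> = \<mu> * (x \<bullet> x)" using x(2) by (simp add: AH flip: inner_add_left)
    finally show ?thesis using x(1) by (simp add: mult_le_cancel_right)
  qed
  \<comment> \<open>Every eigenvector for \<mu> has a definite component along \<open>F\<close>. So
    the lowest eigenspace meets the complement of \<open>F\<close> only in 0, which gives both
    existence and uniqueness of the chart value. The bound c / 4 enters through c - 2 \<epsilon>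
    \<ge> c / 2.\<close>
  have key: "(c / 2) * (y \<bullet> y) \<le> a * (y \<bullet> F)\<^sup>2" if "blinfun_apply A y = \<mu> *\<^sub>R y" for y
  proof -
    have "\<mu> * (y \<bullet> y) = - a * (y \<bullet> F)\<^sup>2 + blinfun_apply H y \<bullet> y"
    proof -
      have "\<mu> * (y \<bullet> y) = blinfun_apply A y \<bullet> y" using that by simp
      then show ?thesis by (simp add: AH A0 inner_add_left inner_diff_left power2_eq_square inner_commute[of F y])
    qed
    moreover have "\<mu> * (y \<bullet> y) \<le> (- c + \<epsilon>) * (y \<bullet> y)" by (intro mult_right_mono mu_up) auto
    ultimately have "(c - 2 * \<epsilon>) * (y \<bullet> y) \<le> a * (y \<bullet> F)\<^sup>2" using Hq[of y] by (simp add: algebra_simps)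
    moreover have "(c / 2) * (y \<bullet> y) \<le> (c - 2 * \<epsilon>) * (y \<bullet> y)" using e by (intro mult_right_mono) auto
    ultimately show ?thesis by linarith
  qed
  have nz: "y = 0" if "blinfun_apply A y = \<mu> *\<^sub>R y" "y \<bullet> F = 0" for y
  proof -
    have "(c / 2) * (y \<bullet> y) \<le> 0" using key[OF that(1)] that(2) by simp
    then have "y \<bullet> y \<le> 0" using c_pos by (simp add: mult_le_0_iff)
    then show ?thesis by (metis inner_ge_zero inner_eq_zero_iff order_antisym)
  qed
  \<comment> \<open>Scaled to have the same component along \<open>F\<close> as \<open>F\<close>
    itself, as the affine chart requires.\<close>
  define y where "y = ((F \<bullet> F) / (x \<bullet> F)) *\<^sub>R x"
  define v where "v = y - F"
  have xF: "x \<bullet> F \<noteq> 0" using nz[OF x(2)] x(1) by blast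
  have y: "blinfun_apply A y = \<mu> *\<^sub>R y" by (simp add: y_def blinfun.scaleR_right x(2))
  have yF: "y \<bullet> F = F \<bullet> F" using xF by (simp add: y_def)
  have vF: "v \<bullet> F = 0" by (simp add: v_def inner_diff_left yF)
  have chart: "line_chart F (lowest_line A) = v"
    unfolding line_chart_def ll
  proof (rule the_equality)
    show "v \<bullet> F = 0 \<and> F + v \<in> {y. blinfun_apply A y = \<mu> *\<^sub>R y}" using vF y by (simp add: v_def)
    fix u assume u: "u \<bullet> F = 0 \<and> F + u \<in> {y. blinfun_apply A y = \<mu> *\<^sub>R y}"
    have "blinfun_apply A ((F + u) - y) = \<mu> *\<^sub>R ((F + u) - y)"
      using u y by (simp add: blinfun.diff_right scaleR_diff_right)
    moreover have "((F + u) - y) \<bullet> F = 0" using u yF by (simp add: inner_diff_left inner_add_left)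
    ultimately have "(F + u) - y = 0" by (rule nz)
    then show "u = v" by (simp add: v_def algebra_simps)
  qed
  have yy: "y \<bullet> y = F \<bullet> F + v \<bullet> v"
  proof -
    have "y = F + v" by (simp add: v_def)
    then show ?thesis using vF by (simp add: inner_add_left inner_add_right inner_commute)
  qed
  have "(c / 2) * (F \<bullet> F + v \<bullet> v) \<le> c * (F \<bullet> F)"
    using key[OF y] by (simp add: yy yF c_def power2_eq_square mult_ac)
  then have "(c / 2) * (v \<bullet> v) \<le> (c / 2) * (F \<bullet> F)" by (simp add: algebra_simps)
  then have "v \<bullet> v \<le> F \<bullet> F" using c_pos by simp
  then have nv: "norm v \<le> norm F" by (simp add: norm_eq_sqrt_inner)
  have ny: "norm y \<le> 2 * norm F" using norm_triangle_ineq[of F v] nv by (simp add: v_def)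
  have Hy: "blinfun_apply H y = blinfun_apply H F + blinfun_apply H v"
    by (simp add: v_def flip: blinfun.add_right)
  note lin = proj_compl_linear[of F]
  have eq: "\<mu> *\<^sub>R v = proj_compl F (blinfun_apply H y)"
  proof -
    have "blinfun_apply H y = \<mu> *\<^sub>R y - blinfun_apply A0 y" using y by (simp add: AH algebra_simps)
    also have "\<dots> = \<mu> *\<^sub>R v + (\<mu> + c) *\<^sub>R F" by (simp add: A0 yF v_def c_def algebra_simps)
    finally show ?thesis
      using proj_compl_self[OF F] proj_compl_id[OF vF] by (simp add: linear_add[OF lin] linear_cmul[OF lin])
  qed
  have mu: "c / 2 \<le> \<bar>\<mu>\<bar>" "\<mu> < 0" using mu_up e c_pos by auto
  have nv2: "c * norm v \<le> 4 * \<epsilon> * norm F"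
  proof -
    have "(c / 2) * norm v \<le> \<bar>\<mu>\<bar> * norm v" by (intro mult_right_mono mu) auto
    also have "\<dots> = norm (proj_compl F (blinfun_apply H y))" by (simp flip: eq)
    also have "\<dots> \<le> norm (blinfun_apply H y)" by (rule norm_proj_compl)
    also have "\<dots> \<le> \<epsilon> * norm y" by (rule Hn)
    also have "\<dots> \<le> \<epsilon> * (2 * norm F)" by (intro mult_left_mono ny e)
    finally show ?thesis by simp
  qed
  let ?w = "v + (1 / c) *\<^sub>R proj_compl F (blinfun_apply H F)"
  \<comment> \<open>Multiplying by c \<mu> displays the error as two terms of second order, with
    coefficients 1 and 4 after estimating; the bound |\<mu>| \<ge> c / 2 turns their sum 5 into the
    final 10.\<close>
  have "(c * \<mu>) *\<^sub>R ?w = (c + \<mu>) *\<^sub>R proj_compl F (blinfun_apply H F) + c *\<^sub>R proj_compl F (blinfun_apply H v)"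
  proof -
    have "(c * \<mu>) *\<^sub>R ?w = c *\<^sub>R (\<mu> *\<^sub>R v) + \<mu> *\<^sub>R proj_compl F (blinfun_apply H F)"
      using c_pos by (simp add: scaleR_add_right)
    also have "\<mu> *\<^sub>R v = proj_compl F (blinfun_apply H F) + proj_compl F (blinfun_apply H v)"
      unfolding eq Hy by (rule linear_add[OF lin])
    finally show ?thesis by (simp add: algebra_simps)
  qed
  then have "norm ((c * \<mu>) *\<^sub>R ?w) \<le> norm ((c + \<mu>) *\<^sub>R proj_compl F (blinfun_apply H F)) +
      norm (c *\<^sub>R proj_compl F (blinfun_apply H v))"
    by (metis norm_triangle_ineq)
  also have "\<dots> = \<bar>c + \<mu>\<bar> * norm (proj_compl F (blinfun_apply H F)) + c * norm (proj_compl F (blinfun_apply H v))"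
    using c_pos by simp
  also have "\<dots> \<le> \<epsilon> * (\<epsilon> * norm F) + c * (\<epsilon> * norm v)"
    using mu_up mu_low c_pos e
    by (intro add_mono mult_mono order_trans[OF norm_proj_compl Hn]) auto
  also have "\<dots> = \<epsilon> * (\<epsilon> * norm F) + \<epsilon> * (c * norm v)" by simp
  also have "\<dots> \<le> \<epsilon> * (\<epsilon> * norm F) + \<epsilon> * (4 * \<epsilon> * norm F)"
    by (intro add_left_mono mult_left_mono nv2 e)
  also have "\<dots> = 5 * norm F * \<epsilon>\<^sup>2" by (simp add: power2_eq_square)
  finally have 1: "c * \<bar>\<mu>\<bar> * norm ?w \<le> 5 * norm F * \<epsilon>\<^sup>2" using c_pos by (simp add: abs_mult)
  have "c * (c / 2) * norm ?w \<le> c * \<bar>\<mu>\<bar> * norm ?w"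
    using mu c_pos by (intro mult_right_mono mult_left_mono) auto
  with 1 have "c\<^sup>2 * norm ?w \<le> 10 * norm F * \<epsilon>\<^sup>2" by (simp add: power2_eq_square)
  then have "norm ?w \<le> 10 * norm F * \<epsilon>\<^sup>2 / c\<^sup>2" using c_pos by (simp add: pos_le_divide_eq mult.commute)
  then show ?thesis by (simp add: chart H_def[symmetric] \<epsilon>_def)
qed

lemma lowest_line_differential:
  fixes V :: "('a \<Rightarrow>\<^sub>L 'a) set"
  assumes V: "\<And>A. A \<in> V \<Longrightarrow> symmetric_op A"
  shows "has_proj_differential lowest_line (\<lambda>H. - (1 / c) *\<^sub>R proj_compl F (blinfun_apply H F)) F A0 V"
proof -
  let ?D = "\<lambda>H :: 'a \<Rightarrow>\<^sub>L 'a. - (1 / c) *\<^sub>R proj_compl F (blinfun_apply H F)"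
  have "bounded_linear (proj_compl F)" by (rule linear_bounded_linear[OF proj_compl_linear])
  then have "bounded_linear (\<lambda>H :: 'a \<Rightarrow>\<^sub>L 'a. proj_compl F (blinfun_apply H F))"
    by (rule bounded_linear_compose) (rule blinfun.bounded_linear_left)
  then have bl: "bounded_linear ?D"
    by (rule bounded_linear_compose[OF bounded_linear_scaleR_right])
  \<comment> \<open>The quadratic estimate for the zero perturbation.\<close>
  have l0: "line_chart F (lowest_line A0) = 0"
  proof -
    have "norm (line_chart F (lowest_line A0) + (1 / c) *\<^sub>R proj_compl F (blinfun_apply (A0 - A0) F)) \<le> 0"
      using perturbation[OF symmetric_A0] c_pos by simp
    then show ?thesis by (simp add: linear_0[OF proj_compl_linear])
  qed
  define K where "K = 10 * norm F / c\<^sup>2"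
  have K: "K \<ge> 0" by (simp add: K_def)
  have "((\<lambda>x. line_chart F (lowest_line x)) has_derivative ?D) (at A0 within V)"
    unfolding has_derivative_within_alt
  proof (intro conjI allI impI bl)
    fix e :: real assume e: "e > 0"
    define d where "d = min (c / 4) (e / (K + 1))"
    have d: "d > 0" using c_pos e K by (simp add: d_def)
    have "norm (line_chart F (lowest_line A) - line_chart F (lowest_line A0) - ?D (A - A0)) \<le> e * norm (A - A0)"
      if A: "A \<in> V" "norm (A - A0) < d" for A
    proof -
      have "norm (A - A0) \<le> c / 4" using A(2) by (simp add: d_def)
      then have "norm (line_chart F (lowest_line A) + (1 / c) *\<^sub>R proj_compl F (blinfun_apply (A - A0) F))
          \<le> K * norm (A - A0) * norm (A - A0)"
        using perturbation[OF V[OF A(1)]] by (simp add: K_def power2_eq_square)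
      also have "\<dots> \<le> e * norm (A - A0)"
      proof (rule mult_right_mono)
        have "norm (A - A0) \<le> e / (K + 1)" using A(2) by (simp add: d_def)
        then have "K * norm (A - A0) \<le> K * (e / (K + 1))" using K by (rule mult_left_mono)
        also have "\<dots> \<le> (K + 1) * (e / (K + 1))" using e K by (intro mult_right_mono) auto
        finally show "K * norm (A - A0) \<le> e" using K by simp
      qed simp
      finally show ?thesis by (simp add: l0)
    qed
    with d show "\<exists>d>0. \<forall>A\<in>V. norm (A - A0) < d \<longrightarrow>
      norm (line_chart F (lowest_line A) - line_chart F (lowest_line A0) - ?D (A - A0)) \<le> e * norm (A - A0)"
      by blast
  qed
  then show ?thesis by (simp add: has_proj_differential_def lowest_line_A0)
qed

end

section \<open>The seed operator\<close>

lemma eigenspace168_finite_dim: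
  obtains C :: "eigenspace168 set" where "finite_dim C"
  using finite_dim_eigenspace168 finite_dim_ex by metis

definition pair_prod :: "eigenspace168 \<Rightarrow> eigenspace168 \<Rightarrow> dodec \<Rightarrow> real" where
  "pair_prod F G = (\<lambda>p. eig_fun F p * eig_fun G p)"

lemma linear_pair_prod: "linear (\<lambda>F. pair_prod F G)" "linear (pair_prod F)"
  by (auto intro!: linearI simp: pair_prod_def fun_eq_iff plus_eigenspace168.rep_eq
      scaleR_eigenspace168.rep_eq scaleR_fun_def algebra_simps)

lemma product_space_finite:
  obtains S where "finite S" "product_space = span S"
proof -
  obtain B :: "eigenspace168 set" where B: "finite B" "span B = UNIV"
    by (rule finite_dim_eigenspace168) blast
  define S where "S = (\<lambda>(b, c). pair_prod b c) ` (B \<times> B)"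
  have "pair_prod F G \<in> span S" for F G
  proof -
    have "pair_prod b G \<in> span S" if "b \<in> B" for b G
    proof -
      have "G \<in> span B" by (simp add: B)
      then have "pair_prod b G \<in> span (pair_prod b ` B)"
        using linear_span_image[OF linear_pair_prod(2)] by blast
      moreover have "pair_prod b ` B \<subseteq> S" using that by (auto simp: S_def)
      ultimately show ?thesis using span_mono by blast
    qed
    then have "span ((\<lambda>b. pair_prod b G) ` B) \<subseteq> span S"
      by (intro span_minimal subspace_span) auto
    moreover have "F \<in> span B" by (simp add: B)
    then have "pair_prod F G \<in> span ((\<lambda>b. pair_prod b G) ` B)"
      using linear_span_image[OF linear_pair_prod(1)[of G], of B] by blast
    ultimately show ?thesis by blast
  qed
  then have "product_space \<subseteq> span S"
    unfolding product_space_def by (intro span_minimal subspace_span) (auto simp: pair_prod_def)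
  moreover have "span S \<subseteq> product_space"
    unfolding product_space_def by (rule span_mono) (auto simp: S_def pair_prod_def)
  moreover have "finite S" unfolding S_def using B(1) by auto
  ultimately show ?thesis using that[of S] by blast
qed

lemma pair_prod_mem: "(\<lambda>p. eig_fun F p * eig_fun G p) \<in> product_space"
  unfolding product_space_def by (rule span_base) blast

lemma subspace_product_space: "subspace product_space"
  unfolding product_space_def by (rule subspace_span)

lemma continuous_product_space:
  assumes "q \<in> product_space"
  shows "continuous_on (-{0}) (lift q)"
  using assms unfolding product_space_def
proof (induction rule: span_induct_alt)
  case base
  have l: "lift 0 = (\<lambda>x. 0)" by (simp add: lift_def fun_eq_iff)
  show ?case unfolding l by simp
next
  case (step c x y)
  then obtain F G where x: "x = (\<lambda>p. eig_fun F p * eig_fun G p)" by blast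
  have "continuous_on (-{0}) (lift x)"
    unfolding x by (intro continuous_on_lift_mult eig_fun_continuous)
  moreover have l: "lift (c *\<^sub>R x + y) = (\<lambda>z. c * lift x z + lift y z)"
    by (rule ext) (simp only: lift_add lift_scaleR)
  ultimately show ?case unfolding l using step(2) by (intro continuous_intros)
qed

lemma integral_mult_add:
  assumes "q \<in> product_space" "h \<in> product_space" "k \<in> product_space"
  shows "integral_dodec (\<lambda>p. q p * (h + k) p) = integral_dodec (\<lambda>p. q p * h p) + integral_dodec (\<lambda>p. q p * k p)"
  using assms by (simp add: distrib_left integral_dodec_add continuous_on_lift_mult continuous_product_space)

lemma integral_mult_scaleR:
  "integral_dodec (\<lambda>p. q p * (c *\<^sub>R h) p) = c * integral_dodec (\<lambda>p. q p * h p)"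
proof -
  have "(\<lambda>p. q p * (c *\<^sub>R h) p) = (\<lambda>p. c * (q p * h p))" by (simp add: scaleR_fun_def fun_eq_iff)
  then show ?thesis by (simp add: integral_dodec_cmult)
qed

text \<open>Existence is Riesz representation of evaluation at the base point. It and uniqueness
  both use that a continuous function whose square integrates to zero vanishes.\<close>

lemma q_o:
  shows "q_o \<in> product_space"
    and "h \<in> product_space \<Longrightarrow> h base_point = integral_dodec (\<lambda>p. q_o p * h p)"
proof -
  let ?P = "\<lambda>q. q \<in> product_space \<and> (\<forall>h\<in>product_space. h base_point = integral_dodec (\<lambda>p. q p * h p))"
  obtain S where S: "finite S" "product_space = span S" by (rule product_space_finite)
  have ex: "\<exists>q\<in>product_space. \<forall>h\<in>product_space. h base_point = integral_dodec (\<lambda>p. q p * h p)"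
  proof (rule riesz_form[OF S(1), folded S(2), where \<beta> = "\<lambda>q h. integral_dodec (\<lambda>p. q p * h p)"
        and l = "\<lambda>h. h base_point"])
    fix x assume "x \<in> product_space" "integral_dodec (\<lambda>p. x p * x p) = 0"
    then show "x = 0" using integral_dodec_square_eq_0 continuous_product_space by blast
  next
    fix x y z assume m: "x \<in> product_space" "y \<in> product_space" "z \<in> product_space"
    show "integral_dodec (\<lambda>p. x p * (y + z) p) = integral_dodec (\<lambda>p. x p * y p) + integral_dodec (\<lambda>p. x p * z p)"
      by (rule integral_mult_add[OF m])
  next
    show "integral_dodec (\<lambda>p. x p * (c *\<^sub>R y) p) = c * integral_dodec (\<lambda>p. x p * y p)" for x y c
      by (rule integral_mult_scaleR)
  qed (simp_all add: mult.commute scaleR_fun_def)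
  have "q = q'" if q: "?P q" and q': "?P q'" for q q'
  proof -
    have d: "q - q' \<in> product_space" using q q' subspace_diff[OF subspace_product_space] by blast
    then have m: "-1 *\<^sub>R q' \<in> product_space" using q' subspace_scale[OF subspace_product_space] by blast
    have eq: "q - q' = q + -1 *\<^sub>R q'" by (simp add: fun_eq_iff scaleR_fun_def)
    have comm: "integral_dodec (\<lambda>p. f p * g p) = integral_dodec (\<lambda>p. g p * f p)" for f g
      by (rule arg_cong[where f = integral_dodec]) (simp add: fun_eq_iff)
    have "integral_dodec (\<lambda>p. (q - q') p * (q - q') p) =
        integral_dodec (\<lambda>p. (q - q') p * q p) + (-1) * integral_dodec (\<lambda>p. (q - q') p * q' p)"
      using integral_mult_add[OF d, of q "-1 *\<^sub>R q'"] q m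
      unfolding eq[symmetric] integral_mult_scaleR by blast
    also have "\<dots> = integral_dodec (\<lambda>p. q p * (q - q') p) - integral_dodec (\<lambda>p. q' p * (q - q') p)"
      unfolding comm[of "q - q'"] by simp
    also have "\<dots> = 0" using q q' d by (metis right_minus_eq)
    finally have "q - q' = 0" using integral_dodec_square_eq_0[OF continuous_product_space[OF d]] by blast
    then show ?thesis by simp
  qed
  then have "?P q_o" unfolding q_o_def using theI'[of ?P] ex by blast
  then show "q_o \<in> product_space"
    and "h \<in> product_space \<Longrightarrow> h base_point = integral_dodec (\<lambda>p. q_o p * h p)" by blast+
qed

lemma B_op_inner:
  assumes q: "q \<in> product_space"
  shows "blinfun_apply (B_op q) F \<bullet> G = - integral_dodec (\<lambda>p. q p * eig_fun F p * eig_fun G p)"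
proof -
  obtain C :: "eigenspace168 set" where "finite_dim C" by (rule eigenspace168_finite_dim)
  then interpret finite_dim C .
  let ?b = "\<lambda>F G. - integral_dodec (\<lambda>p. q p * eig_fun F p * eig_fun G p)"
  have b: "?b F G = - integral_dodec (\<lambda>p. q p * pair_prod F G p)" for F G
    by (simp add: pair_prod_def mult.assoc)
  have mem: "pair_prod F G \<in> product_space" for F G
    unfolding pair_prod_def by (rule pair_prod_mem)
  have "\<exists>!T. \<forall>F G. blinfun_apply T F \<bullet> G = ?b F G"
  proof (rule bilinear_operator)
    show "linear (\<lambda>F. ?b F G)" for G
      unfolding b
      by (rule linearI)
         (simp_all only: linear_add[OF linear_pair_prod(1)] linear_cmul[OF linear_pair_prod(1)]
           integral_mult_add[OF q mem mem] integral_mult_scaleR, simp_all)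
    show "linear (?b F)" for F
      unfolding b
      by (rule linearI)
         (simp_all only: linear_add[OF linear_pair_prod(2)] linear_cmul[OF linear_pair_prod(2)]
           integral_mult_add[OF q mem mem] integral_mult_scaleR, simp_all)
  qed
  from theI'[OF this] show ?thesis unfolding B_op_def by blast
qed

lemma symmetric_B_op: "q \<in> product_space \<Longrightarrow> symmetric_op (B_op q)"
  by (simp add: symmetric_op_def B_op_inner inner_commute[of _ "blinfun_apply _ _"])
     (simp add: mult_ac)

text \<open>\<open>B_op\<close> is linear on \<open>product_space\<close>. The image of the
  differential is then a subspace, to which tangent vectors can be projected orthogonally.\<close>

lemma subspace_op_space: "subspace op_space"
proof (rule subspaceI)
  have add: "B_op (q + c *\<^sub>R r) = B_op q + c *\<^sub>R B_op r"
    if "q \<in> product_space" "r \<in> product_space" for q r c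
  proof (rule blinfun_eqI_inner)
    fix F G
    note m = pair_prod_mem[of F G] and cr = subspace_scale[OF subspace_product_space that(2), of c]
    have eq: "(\<lambda>p. f p * eig_fun F p * eig_fun G p) = (\<lambda>p. (eig_fun F p * eig_fun G p) * f p)" for f
      by (simp add: fun_eq_iff)
    have "q + c *\<^sub>R r \<in> product_space" using subspace_add[OF subspace_product_space that(1) cr] .
    then show "blinfun_apply (B_op (q + c *\<^sub>R r)) F \<bullet> G = blinfun_apply (B_op q + c *\<^sub>R B_op r) F \<bullet> G"
      by (simp only: B_op_inner that blinfun.add_left blinfun.scaleR_left inner_add_left inner_scaleR_left
          eq integral_mult_add[OF m that(1) cr] integral_mult_scaleR)
  qed
  note 0 = subspace_0[OF subspace_product_space]
  have "B_op 0 = 0" using add[OF 0 0, of "-1"] by simp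
  then show "0 \<in> op_space" unfolding op_space_def using 0 by (metis imageI)
  fix S T c assume "S \<in> op_space" "T \<in> op_space"
  then obtain q r where qr: "q \<in> product_space" "r \<in> product_space" "S = B_op q" "T = B_op r"
    by (auto simp: op_space_def)
  have "S + T = B_op (q + 1 *\<^sub>R r)" using add[OF qr(1,2), of 1] qr(3,4) by simp
  moreover have "q + 1 *\<^sub>R r \<in> product_space" using qr subspace_add[OF subspace_product_space] by simp
  ultimately show "S + T \<in> op_space" unfolding op_space_def by blast
  have "c *\<^sub>R S = B_op (0 + c *\<^sub>R q)" using add[OF 0 qr(1), of c] \<open>B_op 0 = 0\<close> qr(3) by simp
  moreover have "0 + c *\<^sub>R q \<in> product_space" using qr subspace_scale[OF subspace_product_space] by simp
  ultimately show "c *\<^sub>R S \<in> op_space" unfolding op_space_def by blast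
qed

lemma eigenspace168_eqI:
  assumes "\<And>w. norm w = 1 \<Longrightarrow> eigl F w = eigl G w"
  shows "F = G"
proof -
  have "F + (-1) *\<^sub>R G = 0"
  proof (rule eigl_zeroI)
    fix w :: "complex \<times> complex" assume "norm w = 1"
    then show "eigl (F + (-1) *\<^sub>R G) w = 0" unfolding eigl_add eigl_scaleR by (simp add: assms)
  qed
  then show ?thesis by simp
qed

lemma eig_translate_inverse:
  assumes y: "norm y = 1"
  shows "eig_translate y (eig_translate (qcnj y) F) = F"
proof (rule eigenspace168_eqI)
  fix w :: "complex \<times> complex" assume w: "norm w = 1"
  have y': "norm (qcnj y) = 1" using y by (simp add: norm_qcnj)
  have w0: "w \<noteq> 0" using w by auto
  have "qmul y (qmul (qcnj y) w) = w"
    using qmul_qcnj[OF y'] by (simp add: qmul_assoc[symmetric] qcnj_qcnj qmul_one)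
  then show "eigl (eig_translate y (eig_translate (qcnj y) F)) w = eigl F w"
    by (simp add: eigl_eig_translate[OF y w0] eigl_eig_translate[OF y' qmul_nonzero[OF y' w0]] qcnj_qcnj)
qed

text \<open>Turns evaluation at any point into evaluation at the base point, that is, into an inner
  product with one fixed vector.\<close>

lemma eig_translate_base_point:
  assumes y: "norm y = 1"
  shows "eig_fun (eig_translate (qcnj y) F) base_point = eigl F y"
proof -
  have y': "norm (qcnj y) = 1" using y by (simp add: norm_qcnj)
  have "(1, 0) \<noteq> (0 :: complex \<times> complex)" by (simp add: zero_prod_def)
  then show ?thesis by (simp add: eig_fun_base_point eigl_eig_translate[OF y'] qcnj_qcnj qmul_one)
qed

theorem theorem11p11:
  fixes F0 :: eigenspace168
  assumes "F0 \<noteq> 0" and "invariant_line = span {F0}"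
  shows "A_0 \<in> Omega \<and> lowest_line A_0 = span {F0} \<and>
    (\<exists>D. has_proj_differential lowest_line D F0 A_0 op_space \<and>
         D ` op_space = proj_tangent_space F0)"
proof -
  obtain C :: "eigenspace168 set" where "finite_dim C" by (rule eigenspace168_finite_dim)
  then interpret finite_dim C .
  have "linear (\<lambda>F. eig_fun F base_point)"
    by (rule linearI) (simp_all add: plus_eigenspace168.rep_eq scaleR_eigenspace168.rep_eq scaleR_fun_def)
  then obtain k where k: "\<And>F. eig_fun F base_point = F \<bullet> k" using riesz_functional by blast
  \<comment> \<open>By the reproducing property of \<open>q_o\<close>, the form of
    \<open>A_0\<close> is -(F G)(o) = -(F . k)(G . k).\<close>
  have A_0: "blinfun_apply A_0 F = - (F \<bullet> k) *\<^sub>R k" for F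
  proof -
    have "(blinfun_apply A_0 F - (- (F \<bullet> k) *\<^sub>R k)) \<bullet> G = 0" for G
    proof -
      have "blinfun_apply A_0 F \<bullet> G = - integral_dodec (\<lambda>p. q_o p * (eig_fun F p * eig_fun G p))"
        by (simp add: A_0_def B_op_inner[OF q_o(1)] mult.assoc)
      also have "\<dots> = - (eig_fun F base_point * eig_fun G base_point)"
        using q_o(2)[OF pair_prod_mem[of F G]] by simp
      finally show ?thesis by (simp add: inner_diff_left inner_add_left k inner_commute[of k])
    qed
    then show ?thesis using inner_eq_zero_iff by (metis right_minus_eq)
  qed
  \<comment> \<open>Translating \<open>k\<close> by \<open>a\<close> represents evaluation at the
    coset of \<open>a\<close>, which is the base point.\<close>
  have "translate a (eig_fun k) = eig_fun k" if a: "a \<in> Istar" for a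
  proof -
    have "a \<in> carrier SU2" using a subgroup.subset[OF subgroup_Istar] by blast
    then obtain y where y: "norm y = 1" "a = su2 y" using carrier_SU2 by blast
    have "(eig_translate y k - k) \<bullet> G = 0" for G
    proof -
      have "eig_translate y k \<bullet> G = eig_translate y k \<bullet> eig_translate y (eig_translate (qcnj y) G)" by (simp add: eig_translate_inverse[OF y(1)])
      also have "\<dots> = eig_fun (eig_translate (qcnj y) G) base_point" by (simp add: inner_eig_translate[OF y(1)] k inner_commute)
      also have "\<dots> = eig_fun G (coset a)" using y by (simp add: eig_translate_base_point lift_def sgn_div_norm)
      also have "\<dots> = k \<bullet> G" by (simp add: coset_Istar[OF a] k inner_commute)
      finally show ?thesis by (simp add: inner_diff_left)
    qed
    then have "eig_translate y k = k" using inner_eq_zero_iff by (metis right_minus_eq)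
    then show ?thesis using eig_fun_eig_translate[OF y(1), of k] y(2) by simp
  qed
  then have "k \<in> invariant_line" by (simp add: invariant_line_def)
  then obtain \<gamma> where \<gamma>: "k = \<gamma> *\<^sub>R F0" unfolding assms(2) by (auto simp: span_singleton)
  \<comment> \<open>If \<open>k\<close> were 0, all eigenfunctions would vanish at the base point,
    hence by translation everywhere.\<close>
  have "\<gamma> \<noteq> 0"
  proof
    assume "\<gamma> = 0"
    then have "eigl F0 w = 0" if "norm w = 1" for w
      using eig_translate_base_point[OF that, of F0] by (simp add: k \<gamma>)
    then show False using eigl_zeroI assms(1) by blast
  qed
  have A0: "blinfun_apply A_0 x = - (\<gamma>\<^sup>2 * (x \<bullet> F0)) *\<^sub>R F0" for x
    by (simp add: A_0 \<gamma> power2_eq_square mult_ac)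
  interpret rank_one C A_0 F0 "\<gamma>\<^sup>2"
    by unfold_locales (use assms(1) \<open>\<gamma> \<noteq> 0\<close> A0 in auto)
  have mem: "A_0 \<in> op_space" unfolding A_0_def op_space_def using q_o(1) by blast
  obtain w where w: "norm w = 1" "eigl F0 w = 0" by (rule eigl_has_zero)
  \<comment> \<open>The translation moves the zero \<open>w\<close> of \<open>F0\<close> to the base
    point, so \<open>G\<close> is orthogonal to \<open>k\<close>.\<close>
  define G where "G = eig_translate (qcnj w) F0"
  have "G \<bullet> G = F0 \<bullet> F0" unfolding G_def by (rule inner_eig_translate) (simp add: norm_qcnj w)
  then have G: "G \<noteq> 0" using assms(1) by auto
  have "G \<bullet> k = 0" using eig_translate_base_point[OF w(1), of F0] w(2) by (simp add: G_def k)
  then have "G \<bullet> F0 = 0" using \<open>\<gamma> \<noteq> 0\<close> by (simp add: \<gamma>)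
  then have "eigval 2 A_0 = 0" by (rule eigval_2_A0[OF G])
  then have Omega: "A_0 \<in> Omega" unfolding Omega_def using mem c_pos by (simp only: eigval_1_A0 mem_Collect_eq) simp
  let ?D = "\<lambda>H. - (1 / c) *\<^sub>R proj_compl F0 (blinfun_apply H F0)"
  have D: "has_proj_differential lowest_line ?D F0 A_0 op_space"
    by (rule lowest_line_differential) (auto simp: op_space_def symmetric_B_op)
  have linD: "linear ?D"
    by (rule linearI)
       (simp_all add: blinfun.add_left blinfun.scaleR_left linear_add[OF proj_compl_linear]
         linear_cmul[OF proj_compl_linear] algebra_simps)
  have "proj_tangent_space F0 \<subseteq> ?D ` op_space"
  proof
    fix v assume "v \<in> proj_tangent_space F0"
    then have v: "v \<bullet> F0 = 0" by (simp add: proj_tangent_space_def)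
    define W where "W = ?D ` op_space"
    have sub: "subspace W" unfolding W_def by (rule linear_subspace_image[OF linD subspace_op_space])
    obtain b where b: "b \<subseteq> W" "independent b" "W \<subseteq> span b" "card b = dim W"
      by (rule basis_exists)
    have span_b: "span b = W"
      using b(3) span_minimal[OF b(1) sub] by blast
    \<comment> \<open>This \<open>u\<close> is the orthogonal projection of \<open>v\<close> to the
      image \<open>W\<close>; the residue \<open>z\<close> is orthogonal to \<open>W\<close> and
      still tangent.\<close>
    have "\<exists>u\<in>span b. \<forall>h\<in>span b. v \<bullet> h = u \<bullet> h"
      by (rule riesz_form[OF finite_independent[OF b(2)], where \<beta> = inner and l = "\<lambda>h. v \<bullet> h"])
         (simp_all add: inner_commute inner_add_right)
    then obtain u where u: "u \<in> W" "\<And>h. h \<in> W \<Longrightarrow> v \<bullet> h = u \<bullet> h"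
      unfolding span_b by blast
    define z where "z = v - u"
    have "u \<bullet> F0 = 0" using u(1) proj_compl_orthogonal[OF assms(1)] unfolding W_def by auto
    then have zF: "z \<bullet> F0 = 0" using v by (simp add: z_def inner_diff_left)
    let ?q = "\<lambda>p. eig_fun F0 p * eig_fun z p"
    have q: "?q \<in> product_space" by (rule pair_prod_mem)
    have "z \<bullet> ?D (B_op ?q) = 0"
    proof -
      have "B_op ?q \<in> op_space" unfolding op_space_def using q by (rule imageI)
      then have "?D (B_op ?q) \<in> W" unfolding W_def by (rule imageI)
      from u(2)[OF this] show ?thesis unfolding z_def inner_diff_left by (simp only: diff_self)
    qed
    then have "proj_compl F0 (blinfun_apply (B_op ?q) F0) \<bullet> z = 0"
      using c_pos by (simp add: inner_commute)
    then have "integral_dodec (\<lambda>p. ?q p * ?q p) = 0"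
      unfolding proj_compl_inner[OF zF] by (simp add: B_op_inner[OF q] mult.assoc)
    then have "?q = 0" by (rule integral_dodec_square_eq_0[OF continuous_product_space[OF q]])
    then have "eigl F0 x * eigl z x = 0" for x by (metis lift_def zero_fun_def)
    then have "z = 0" using eigl_mult_eq_0[of F0 z] assms(1) by blast
    then have "v = u" by (simp add: z_def)
    then show "v \<in> ?D ` op_space" using u(1) by (simp only: W_def)
  qed
  moreover have "?D ` op_space \<subseteq> proj_tangent_space F0"
    using proj_compl_orthogonal[OF assms(1)] by (auto simp: proj_tangent_space_def)
  ultimately have "?D ` op_space = proj_tangent_space F0" by blast
  with Omega D lowest_line_A0 show ?thesis by blast
qed

end
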